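(* Let $X=[0,1]$ with Lebesgue measure $\nu$, let $\alpha$ be the standard Gaussian white noise on $[0,1]$ (with realizations denoted $\eta$) and $\pi$ the homogeneous Poisson process on $[0,1]$ with unit rate, with law $\mathcal P$ on the space $\mathcal E$ of configurations. Let $\Phi:L^2(\alpha)\to L^2(\pi)$ be the isometry determined by $$\Phi\big(e^{\langle h,\cdot\rangle-\frac{\|h\|^2}{2}}\big)(\omega)=\prod_{x\in\omega}(1+h(x))\cdot e^{-\int_0^1 h(x)\,dx},\qquad h\in L^2([0,1])\ \text{real-valued}.$$ Then the kernel of $\Phi$, i.e. the generalized function $K(\omega,\eta)$ such that $$(\Phi^{-1}F)(\cdot)=\int_{\mathcal E}K(\omega,\cdot)F(\omega)\,d\mathcal P(\omega)\quad\text{for every }F\in L^2(\pi),$$ is given by $$K(\omega,\eta)=e^{-\frac12-\langle\eta,1\rangle}\sum_{R\in\Pi_{\le2}(\omega)}(-1)^{|R|}\prod_{z\in C_1(R)}(\eta+2)(z)\prod_{\{x,y\}\in C_2(R)}\delta(x-y)$$ for almost all $\omega,\eta$.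
   Context: Gaussian white noise on $[0,1]$: the generalized random process on real $L^2([0,1])$ with $\mathbb E e^{i\langle h,\cdot\rangle}=e^{-\|h\|^2/2}$; $\langle\eta,h\rangle=\langle h,\eta\rangle$ is its value at $h$ for the realization $\eta$. $L^2(\alpha)$, $L^2(\pi)$ are the complex Hilbert spaces of square integrable functionals of the two processes. Configurations of $\pi$ are a.s. finite and simple (all multiplicities equal one). $\Pi_{\le 2}(\omega)$ is the set of partitions of the finite set $\omega$ into subsets consisting of one or two points; for $R\in\Pi_{\le2}(\omega)$, $C_k(R)$ is the set of $k$-point subsets in $R$ ($k=1,2$) and $|R|=\#C_2(R)$. $\eta+2$ is the generalized function $\langle\eta+2,h\rangle=\langle\eta,h\rangle+2\int_0^1h(t)\,dt$; $\delta$ is the delta function; products are direct products of generalized functions. Meaning of the integral: a functional $F$ of $\pi$ is a sequence of symmetric functions $F_n$ on $[0,1]^n$, $F(\{x_1,\dots,x_n\})=F_n(x_1,\dots,x_n)$, and since the number of points is Poisson(1) and, given it equals $n$, the points are i.i.d. uniform, $$\int_{\mathcal E}K(\omega,\eta)F(\omega)\,d\mathcal P(\omega)=e^{-1}\sum_{n=0}^\infty\frac1{n!}\int_{[0,1]^n}F_n(x_1,\dots,x_n)\,K(\{x_1,\dots,x_n\},\eta)\,dx_1\cdots dx_n,$$ where the integrals are pairings with generalized functions: for $f_1\otimes\cdots\otimes f_n$ the pairing with $\prod_{z\in C_1(R)}(\eta+2)(z)\prod_{\{x,y\}\in C_2(R)}\delta(x-y)$ (where $R$ is a partition of the $n$ variables)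 is $\prod_{\{i\}\in C_1(R)}\langle\eta+2,f_i\rangle\prod_{\{i,j\}\in C_2(R)}\int_0^1f_if_j\,dx$. The total pairing with $K(\{x_1,\dots,x_n\},\eta)$ is extended from linear combinations of such products to all of $L^2([0,1]^n)$ by linearity and continuity into $L^2(\alpha)$, and the sum over $n$ is taken in $L^2(\alpha)$. *)

theory Defs
  imports "HOL-Probability.Probability"
begin

text \<open>Elements of an \<open>L\<^sup>2\<close> space are represented by functions; all relations between
  them below are stated up to almost everywhere equality.\<close>

definition square_integrable :: "'a measure \<Rightarrow> ('a \<Rightarrow> 'b::real_normed_vector) \<Rightarrow> bool" where
  "square_integrable M f \<longleftrightarrow> f \<in> borel_measurable M \<and> integrable M (\<lambda>x. (norm (f x))\<^sup>2)"

definition l2norm :: "'a measure \<Rightarrow> ('a \<Rightarrow> 'b::real_normed_vector) \<Rightarrow> real" where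
  "l2norm M f = sqrt (\<integral>x. (norm (f x))\<^sup>2 \<partial>M)"

definition L2_linear ::
  "'a measure \<Rightarrow> 'b measure \<Rightarrow> (('a \<Rightarrow> complex) \<Rightarrow> 'b \<Rightarrow> complex) \<Rightarrow> bool" where
  "L2_linear M N T \<longleftrightarrow>
     (\<forall>f. square_integrable M f \<longrightarrow> square_integrable N (T f)) \<and>
     (\<forall>f g a b. square_integrable M f \<longrightarrow> square_integrable M g \<longrightarrow>
        (AE y in N. T (\<lambda>x. a * f x + b * g x) y = a * T f y + b * T g y))"

definition L2_continuous_linear ::
  "'a measure \<Rightarrow> 'b measure \<Rightarrow> (('a \<Rightarrow> complex) \<Rightarrow> 'b \<Rightarrow> complex) \<Rightarrow> bool" where
  "L2_continuous_linear M N T \<longleftrightarrow> L2_linear M N T \<and>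
     (\<exists>C. \<forall>f. square_integrable M f \<longrightarrow> l2norm N (T f) \<le> C * l2norm M f)"

definition L2_isometry ::
  "'a measure \<Rightarrow> 'b measure \<Rightarrow> (('a \<Rightarrow> complex) \<Rightarrow> 'b \<Rightarrow> complex) \<Rightarrow> bool" where
  "L2_isometry M N T \<longleftrightarrow> L2_linear M N T \<and>
     (\<forall>f. square_integrable M f \<longrightarrow> l2norm N (T f) = l2norm M f)"

definition L2_sums :: "'a measure \<Rightarrow> (nat \<Rightarrow> 'a \<Rightarrow> complex) \<Rightarrow> ('a \<Rightarrow> complex) \<Rightarrow> bool" where
  "L2_sums M f G \<longleftrightarrow> (\<forall>n. square_integrable M (f n)) \<and> square_integrable M G \<and>
     (\<lambda>N. l2norm M (\<lambda>x. (\<Sum>n<N. f n x) - G x)) \<longlonglongrightarrow> 0"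

abbreviation unit_leb :: "real measure" where
  "unit_leb \<equiv> restrict_space lborel {0..1}"

abbreviation unit_leb_power :: "nat \<Rightarrow> (nat \<Rightarrow> real) measure" where
  "unit_leb_power n \<equiv> Pi\<^sub>M {..<n} (\<lambda>_. unit_leb)"

text \<open>\<open>W h \<eta>\<close> is the value at \<open>h\<close> of the realization \<open>\<eta>\<close>. The \<open>\<sigma>\<close>-algebra
  of \<open>M\<close> is the one generated by the process, so that the square integrable functions on \<open>M\<close>
  are exactly the square integrable functionals of the process.\<close>

definition gaussian_white_noise :: "'w measure \<Rightarrow> ((real \<Rightarrow> real) \<Rightarrow> 'w \<Rightarrow> real) \<Rightarrow> bool" where
  "gaussian_white_noise M W \<longleftrightarrow>
     prob_space M \<and>
     sets M = sigma_sets (space M)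
       {W h -` B \<inter> space M | h B. square_integrable unit_leb h \<and> B \<in> sets borel} \<and>
     (\<forall>h g a b. square_integrable unit_leb h \<longrightarrow> square_integrable unit_leb g \<longrightarrow>
        (AE \<eta> in M. W (\<lambda>x. a * h x + b * g x) \<eta> = a * W h \<eta> + b * W g \<eta>)) \<and>
     (\<forall>h. square_integrable unit_leb h \<longrightarrow>
        (\<integral>\<eta>. iexp (W h \<eta>) \<partial>M) = complex_of_real (exp (- (l2norm unit_leb h)\<^sup>2 / 2)))"

definition configurations :: "real set set" where
  "configurations = {\<omega>. finite \<omega> \<and> \<omega> \<subseteq> {0..1}}"

definition configuration_space :: "real set measure" where
  "configuration_space = sigma configurations
     {{\<omega> \<in> configurations. card (\<omega> \<inter> B) = k} | B k. B \<in> sets borel}"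

text \<open>\<open>P\<close> is the law of the homogeneous Poisson process of unit rate on the unit interval.
  The convention \<open>0 ^ 0 = 1\<close> makes the formula correct also for null sets \<open>B\<close>.\<close>

definition poisson_process_law :: "real set measure \<Rightarrow> bool" where
  "poisson_process_law P \<longleftrightarrow>
     prob_space P \<and> sets P = sets configuration_space \<and>
     (\<forall>B k. B \<in> sets borel \<longrightarrow> B \<subseteq> {0..1} \<longrightarrow>
        measure P {\<omega> \<in> space P. card (\<omega> \<inter> B) = k} =
          exp (- measure lborel B) * measure lborel B ^ k / fact k) \<and>
     (\<forall>(I :: nat set) B. finite I \<longrightarrow> disjoint_family_on B I \<longrightarrow>
        (\<forall>i\<in>I. B i \<in> sets borel \<and> B i \<subseteq> {0..1}) \<longrightarrow>
        prob_space.indep_vars P (\<lambda>_. count_space UNIV) (\<lambda>i \<omega>. card (\<omega> \<inter> B i)) I)"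

text \<open>A generalized function \<open>K(\<omega>, \<eta>)\<close> is given by its pairings
  \<open>K n f = \<integral> f(x\<^sub>1,\<dots>,x\<^sub>n) K({x\<^sub>1,\<dots>,x\<^sub>n}, \<cdot>) dx\<^sub>1 \<dots> dx\<^sub>n\<close>, which are symmetric because
  \<open>K\<close> depends on the point set only.\<close>

definition generalized_kernel ::
  "'w measure \<Rightarrow> (nat \<Rightarrow> ((nat \<Rightarrow> real) \<Rightarrow> complex) \<Rightarrow> 'w \<Rightarrow> complex) \<Rightarrow> bool" where
  "generalized_kernel M K \<longleftrightarrow>
     (\<forall>n. L2_continuous_linear (unit_leb_power n) M (K n)) \<and>
     (\<forall>n p f. p permutes {..<n} \<longrightarrow> square_integrable (unit_leb_power n) f \<longrightarrow>
        (AE \<eta> in M. K n (\<lambda>x. f (x \<circ> p)) \<eta> = K n f \<eta>))"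

text \<open>The functions \<open>F\<^sub>n\<close> representing a functional \<open>F\<close> of configurations. On the null set
  where two coordinates coincide the value is irrelevant.\<close>

definition npoint :: "(real set \<Rightarrow> complex) \<Rightarrow> nat \<Rightarrow> (nat \<Rightarrow> real) \<Rightarrow> complex" where
  "npoint F n = (\<lambda>x. F (x ` {..<n}))"

text \<open>\<open>G = \<integral> K(\<omega>, \<cdot>) F(\<omega>) dP(\<omega>)\<close> for the Poisson law \<open>P\<close>\<close>

definition has_kernel_integral ::
  "'w measure \<Rightarrow> (nat \<Rightarrow> ((nat \<Rightarrow> real) \<Rightarrow> complex) \<Rightarrow> 'w \<Rightarrow> complex) \<Rightarrow>
   (real set \<Rightarrow> complex) \<Rightarrow> ('w \<Rightarrow> complex) \<Rightarrow> bool" where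
  "has_kernel_integral M K F G \<longleftrightarrow>
     L2_sums M (\<lambda>n \<eta>. complex_of_real (exp (-1) / fact n) * K n (npoint F n) \<eta>) G"

text \<open>Here \<open>G\<close> is \<open>\<Phi>\<inverse> F\<close>, which is unique almost everywhere for an isometry \<open>\<Phi>\<close>;
  its existence for all \<open>F\<close> (surjectivity of \<open>\<Phi>\<close>) is part of the definition.\<close>

definition is_kernel_of ::
  "'w measure \<Rightarrow> real set measure \<Rightarrow> (('w \<Rightarrow> complex) \<Rightarrow> real set \<Rightarrow> complex) \<Rightarrow>
   (nat \<Rightarrow> ((nat \<Rightarrow> real) \<Rightarrow> complex) \<Rightarrow> 'w \<Rightarrow> complex) \<Rightarrow> bool" where
  "is_kernel_of M P \<Phi> K \<longleftrightarrow>
     (\<forall>F. square_integrable P F \<longrightarrow>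
        (\<exists>G. square_integrable M G \<and> (AE \<omega> in P. \<Phi> G \<omega> = F \<omega>) \<and> has_kernel_integral M K F G))"

definition partitions_le2 :: "'a set \<Rightarrow> 'a set set set" where
  "partitions_le2 A = {R. partition_on A R \<and> (\<forall>B\<in>R. card B = 1 \<or> card B = 2)}"

definition blocks :: "nat \<Rightarrow> 'a set set \<Rightarrow> 'a set set" where
  "blocks k R = {B \<in> R. card B = k}"

text \<open>Pairing of \<open>f\<^sub>0 \<otimes> \<dots> \<otimes> f\<^sub>n\<^sub>-\<^sub>1\<close> with
  \<open>\<Prod>\<^bsub>{z} \<in> C\<^sub>1(R)\<^esub> (\<eta> + 2)(z) \<Prod>\<^bsub>{x, y} \<in> C\<^sub>2(R)\<^esub> \<delta>(x - y)\<close>\<close>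

definition partition_pairing ::
  "((real \<Rightarrow> real) \<Rightarrow> 'w \<Rightarrow> real) \<Rightarrow> (nat \<Rightarrow> real \<Rightarrow> real) \<Rightarrow> 'w \<Rightarrow> nat set set \<Rightarrow> real" where
  "partition_pairing W f \<eta> R =
     (\<Prod>B\<in>blocks 1 R. W (f (the_elem B)) \<eta> + 2 * (\<integral>t. f (the_elem B) t \<partial>unit_leb)) *
     (\<Prod>B\<in>blocks 2 R. \<integral>x. (\<Prod>i\<in>B. f i x) \<partial>unit_leb)"

definition tensor :: "nat \<Rightarrow> (nat \<Rightarrow> real \<Rightarrow> real) \<Rightarrow> (nat \<Rightarrow> real) \<Rightarrow> complex" where
  "tensor n f = (\<lambda>x. complex_of_real (\<Prod>i<n. f i (x i)))"

text \<open>\<open>K(\<omega>, \<eta>)\<close> is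
  \<open>exp (- 1/2 - \<langle>\<eta>, 1\<rangle>) \<Sum>\<^sub>R (-1)\<^bsup>|R|\<^esup> \<Prod>\<^bsub>{z} \<in> C\<^sub>1(R)\<^esub> (\<eta> + 2)(z) \<Prod>\<^bsub>{x, y} \<in> C\<^sub>2(R)\<^esub> \<delta>(x - y)\<close>
  as a generalized function. A continuous linear \<open>K n\<close> is determined by its values on products,
  whose complex linear combinations are dense.\<close>

definition white_noise_poisson_formula ::
  "'w measure \<Rightarrow> ((real \<Rightarrow> real) \<Rightarrow> 'w \<Rightarrow> real) \<Rightarrow>
   (nat \<Rightarrow> ((nat \<Rightarrow> real) \<Rightarrow> complex) \<Rightarrow> 'w \<Rightarrow> complex) \<Rightarrow> bool" where
  "white_noise_poisson_formula M W K \<longleftrightarrow>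
     (\<forall>n f. (\<forall>i<n. square_integrable unit_leb (f i)) \<longrightarrow>
        (AE \<eta> in M. K n (tensor n f) \<eta> = complex_of_real
           (exp (- 1 / 2 - W (\<lambda>_. 1) \<eta>) *
            (\<Sum>R\<in>partitions_le2 {..<n}. (-1) ^ card (blocks 2 R) * partition_pairing W f \<eta> R))))"

end

theory Submission
  imports Defs
begin

text \<open>For \<open>h = -1 + \<Sum>\<^sub>i s\<^sub>i f\<^sub>i\<close> the multiplicative functional
  \<open>\<Prod>\<^bsub>x\<in>\<omega>\<^esub> (1 + h x)\<close> is a power series in \<open>s\<close> whose coefficient at
  \<open>s\<^sub>1 \<dots> s\<^sub>n\<close> is the symmetrization of \<open>f\<^sub>1 \<otimes> \<dots> \<otimes> f\<^sub>n\<close> on the \<open>n\<close>-point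
  configurations, and its preimage under \<open>\<Phi>\<close> is, up to constants,
  \<open>exp (- \<langle>\<eta>, 1\<rangle>) exp (\<Sum>\<^sub>i s\<^sub>i \<langle>\<eta> + 2, f\<^sub>i\<rangle> - 1/2 \<Sum>\<^sub>i\<^sub>j s\<^sub>i s\<^sub>j \<integral> f\<^sub>i f\<^sub>j)\<close>, whose
  corresponding coefficient is the sum over partitions into blocks of size one and two.
  Instead of expanding in \<open>s\<close>, the proof compares inner products with exponential functionals:
  on the Gaussian side by integration by parts, on the Poisson side by the representation of the
  Poisson process as a mixture of i.i.d. points. Multiplicative functionals are total in
  \<open>L\<^sup>2\<close> of the Poisson process, which settles the formula and gives surjectivity of
  \<open>\<Phi>\<close>. The kernel applied to \<open>f\<close> is then the preimage of \<open>e\<close> times the symmetrization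
  of \<open>f\<close>, and the integral of \<open>F\<close> against it is the preimage of the decomposition of \<open>F\<close>
  by the number of points.\<close>

subsection \<open>Square integrable functions\<close>

text \<open>Comparing coefficients of the power series would mean exchanging \<open>\<Phi>\<close>
  with a series, although \<open>W\<close> is linear and \<open>\<Phi>\<close> is known on
  exponentials only up to null sets that depend on the parameters. Testing against one exponential
  functional at a time turns every comparison into an identity of integrals. The prefactor of the
  formula is the exponential functional of the constant function -1. \<open>\<Phi>\<close> sends it
  to \<open>e\<close> times the indicator of the empty configuration, and this is where the factor
  \<open>e\<close> in front of the symmetrization comes from; it is the inverse of the probability
  of having no points. The formula prescribes a generalized kernel on products only. Taking
  preimages under \<open>\<Phi>\<close> defines one on all square integrable functions at once,
  without extension by density; density of products serves for uniqueness alone. As operators act on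
  functions and not on classes, their compatibility with almost everywhere equality has to be
  derived from the norm bound.\<close>

lemma norm_add_sq_le: "(norm (a + b))\<^sup>2 \<le> 2 * (norm a)\<^sup>2 + 2 * (norm (b::'a::real_normed_vector))\<^sup>2"
proof -
  have "(norm (a + b))\<^sup>2 \<le> (norm a + norm b)\<^sup>2"
    by (intro power_mono norm_triangle_ineq) auto
  also have "\<dots> \<le> 2 * (norm a)\<^sup>2 + 2 * (norm b)\<^sup>2"
    using sum_squares_bound[of "norm a" "norm b"] by (simp add: power2_sum)
  finally show ?thesis .
qed

lemma square_integrable_measurable: "square_integrable M f \<Longrightarrow> f \<in> borel_measurable M"
  and square_integrable_integrable: "square_integrable M f \<Longrightarrow> integrable M (\<lambda>x. (norm (f x))\<^sup>2)"
  by (auto simp: square_integrable_def)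

lemma square_integrable_cong:
  assumes "\<And>x. x \<in> space M \<Longrightarrow> f x = g x"
  shows "square_integrable M f \<longleftrightarrow> square_integrable M g"
  unfolding square_integrable_def using assms
  by (intro conj_cong measurable_cong Bochner_Integration.integrable_cong) auto

lemma square_integrable_AE_bound:
  assumes "f \<in> borel_measurable M" "square_integrable M g" "AE x in M. norm (f x) \<le> norm (g x)"
  shows "square_integrable M (f :: 'a \<Rightarrow> 'b::{real_normed_vector,second_countable_topology})"
  unfolding square_integrable_def
proof
  note assms(1)[measurable]
  show "integrable M (\<lambda>x. (norm (f x))\<^sup>2)"
    by (rule Bochner_Integration.integrable_bound[OF square_integrable_integrable[OF assms(2)]])
      (use assms(3) in \<open>auto intro!: power_mono elim: eventually_mono\<close>)
qed fact

lemma square_integrable_add: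
  fixes f g :: "'a \<Rightarrow> 'b::{real_normed_vector,second_countable_topology}"
  assumes "square_integrable M f" "square_integrable M g"
  shows "square_integrable M (\<lambda>x. f x + g x)"
proof -
  note [measurable] = assms[THEN square_integrable_measurable]
  have "integrable M (\<lambda>x. 2 * (norm (f x))\<^sup>2 + 2 * (norm (g x))\<^sup>2)"
    using assms by (auto simp: square_integrable_def)
  then show ?thesis
    unfolding square_integrable_def
    by (intro conjI, simp, elim Bochner_Integration.integrable_bound) (auto simp: norm_add_sq_le)
qed

lemma square_integrable_cmult:
  fixes f :: "'a \<Rightarrow> 'b::{real_normed_field,second_countable_topology}"
  assumes "square_integrable M f"
  shows "square_integrable M (\<lambda>x. c * f x)"
  using assms by (auto simp: square_integrable_def norm_mult power_mult_distrib)

lemma square_integrable_lincomb: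
  fixes f g :: "'a \<Rightarrow> 'b::{real_normed_field,second_countable_topology}"
  assumes "square_integrable M f" "square_integrable M g"
  shows "square_integrable M (\<lambda>x. a * f x + b * g x)"
  using assms by (intro square_integrable_add square_integrable_cmult)

lemma square_integrable_diff:
  fixes f g :: "'a \<Rightarrow> 'b::{real_normed_field,second_countable_topology}"
  assumes "square_integrable M f" "square_integrable M g"
  shows "square_integrable M (\<lambda>x. f x - g x)"
  using square_integrable_lincomb[OF assms, of 1 "-1"] by simp

lemma square_integrable_zero: "square_integrable M (\<lambda>_. 0)"
  by (simp add: square_integrable_def)

lemma square_integrable_sum:
  fixes f :: "'i \<Rightarrow> 'a \<Rightarrow> 'b::{real_normed_vector,second_countable_topology}"
  assumes "\<And>i. i \<in> I \<Longrightarrow> square_integrable M (f i)"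
  shows "square_integrable M (\<lambda>x. \<Sum>i\<in>I. f i x)"
  using assms
  by (induction I rule: infinite_finite_induct)
    (auto intro!: square_integrable_zero square_integrable_add)

lemma square_integrable_of_real:
  "square_integrable M (\<lambda>x. complex_of_real (f x)) \<longleftrightarrow> square_integrable M f"
proof -
  have "(\<lambda>x. complex_of_real (f x)) \<in> borel_measurable M \<longleftrightarrow> f \<in> borel_measurable M"
  proof
    assume "(\<lambda>x. complex_of_real (f x)) \<in> borel_measurable M"
    from measurable_compose[OF this borel_measurable_Re] show "f \<in> borel_measurable M" by simp
  qed measurable
  then show ?thesis
    unfolding square_integrable_def by simp
qed

lemma square_integrable_Re: "square_integrable M f \<Longrightarrow> square_integrable M (\<lambda>x. Re (f x))"
  by (rule square_integrable_AE_bound[where g=f])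
    (auto dest: square_integrable_measurable simp: abs_Re_le_cmod)

lemma square_integrable_Im: "square_integrable M f \<Longrightarrow> square_integrable M (\<lambda>x. Im (f x))"
  by (rule square_integrable_AE_bound[where g=f])
    (auto dest: square_integrable_measurable simp: abs_Im_le_cmod)

lemma integrable_mult_square_integrable:
  fixes f g :: "'a \<Rightarrow> 'b::{real_normed_field,banach,second_countable_topology}"
  assumes "square_integrable M f" "square_integrable M g"
  shows "integrable M (\<lambda>x. f x * g x)"
proof -
  note [measurable] = assms[THEN square_integrable_measurable]
  have "integrable M (\<lambda>x. (norm (f x))\<^sup>2 + (norm (g x))\<^sup>2)"
    using assms by (auto simp: square_integrable_def)
  then show ?thesis
  proof (rule Bochner_Integration.integrable_bound)
    show "AE x in M. norm (f x * g x) \<le> norm ((norm (f x))\<^sup>2 + (norm (g x))\<^sup>2)"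
    proof (rule AE_I2)
      fix x
      have "norm (f x) * norm (g x) \<le> 2 * norm (f x) * norm (g x)" by simp
      also note sum_squares_bound
      finally show "norm (f x * g x) \<le> norm ((norm (f x))\<^sup>2 + (norm (g x))\<^sup>2)"
        by (simp add: norm_mult)
    qed
  qed simp
qed

lemma (in finite_measure) square_integrable_bounded:
  fixes f :: "'a \<Rightarrow> 'b::{real_normed_vector,second_countable_topology}"
  assumes "f \<in> borel_measurable M" "\<And>x. x \<in> space M \<Longrightarrow> norm (f x) \<le> C"
  shows "square_integrable M f"
proof -
  note assms(1)[measurable]
  show ?thesis
    unfolding square_integrable_def
    by (intro conjI assms(1), rule integrable_const_bound[where B="C\<^sup>2"]) (use assms in \<open>auto intro!: power_mono\<close>)
qed

lemma (in finite_measure) square_integrable_imp_integrable: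
  fixes f :: "'a \<Rightarrow> 'b::{real_normed_field,banach,second_countable_topology}"
  assumes "square_integrable M f"
  shows "integrable M f"
  using integrable_mult_square_integrable[OF assms square_integrable_bounded[of "\<lambda>_. 1" 1]] by simp

section \<open>Norm, convergence and completeness in L2\<close>

lemma l2norm_sq: "(l2norm M f)\<^sup>2 = (\<integral>x. (norm (f x))\<^sup>2 \<partial>M)"
  by (simp add: l2norm_def)

lemma l2norm_nonneg: "0 \<le> l2norm M f"
  by (simp add: l2norm_def)

lemma l2norm_cong_AE:
  assumes "f \<in> borel_measurable M" "g \<in> borel_measurable M" "AE x in M. f x = g x"
  shows "l2norm M f = l2norm M (g :: 'a \<Rightarrow> 'b::{real_normed_vector,second_countable_topology})"
proof -
  note assms(1,2)[measurable]
  show ?thesis unfolding l2norm_def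
    by (rule arg_cong[where f=sqrt], rule integral_cong_AE) (use assms(3) in auto)
qed

lemma l2norm_eq_0_iff:
  assumes "square_integrable M f"
  shows "l2norm M f = 0 \<longleftrightarrow> (AE x in M. f x = 0)"
  using integral_nonneg_eq_0_iff_AE[OF square_integrable_integrable[OF assms]]
  by (simp add: l2norm_def)

text \<open>Stands in for the triangle inequality of the norm: it is the integrated pointwise bound,
  and the factor 2 does no harm where both terms can be made small.\<close>

lemma l2norm_sq_add_le:
  fixes f g :: "'a \<Rightarrow> 'b::{real_normed_vector,second_countable_topology}"
  assumes "square_integrable M f" "square_integrable M g"
  shows "(l2norm M (\<lambda>x. f x + g x))\<^sup>2 \<le> 2 * (l2norm M f)\<^sup>2 + 2 * (l2norm M g)\<^sup>2"
proof -
  note * = square_integrable_integrable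
  have "(\<integral>x. (norm (f x + g x))\<^sup>2 \<partial>M) \<le> (\<integral>x. 2 * (norm (f x))\<^sup>2 + 2 * (norm (g x))\<^sup>2 \<partial>M)"
    by (intro integral_mono *[OF square_integrable_add] assms norm_add_sq_le)
      (use assms in \<open>auto simp: square_integrable_def\<close>)
  also have "\<dots> = 2 * (l2norm M f)\<^sup>2 + 2 * (l2norm M g)\<^sup>2"
    using assms[THEN *] by (simp add: l2norm_sq)
  finally show ?thesis by (simp add: l2norm_sq)
qed

lemma l2norm_cmult:
  fixes f :: "'a \<Rightarrow> 'b::real_normed_field"
  shows "l2norm M (\<lambda>x. c * f x) = norm c * l2norm M f"
  by (simp add: l2norm_def norm_mult power_mult_distrib real_sqrt_mult)

lemma l2norm_minus_commute: "l2norm M (\<lambda>x. f x - g x) = l2norm M (\<lambda>x. g x - f x)"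
  by (simp add: l2norm_def norm_minus_commute)

text \<open>The integral of a non-integrable function is 0 by convention, so the condition has its
  meaning only next to square integrability hypotheses, which are stated separately.\<close>

definition L2_tendsto :: "'a measure \<Rightarrow> (nat \<Rightarrow> 'a \<Rightarrow> complex) \<Rightarrow> ('a \<Rightarrow> complex) \<Rightarrow> bool" where
  "L2_tendsto M f g \<longleftrightarrow> (\<lambda>n. l2norm M (\<lambda>x. f n x - g x)) \<longlonglongrightarrow> 0"

lemma tendsto_l2norm_iff: "(\<lambda>n. l2norm M (f n)) \<longlonglongrightarrow> 0 \<longleftrightarrow> (\<lambda>n. (l2norm M (f n))\<^sup>2) \<longlonglongrightarrow> 0"
proof
  assume "(\<lambda>n. (l2norm M (f n))\<^sup>2) \<longlonglongrightarrow> 0"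
  from tendsto_real_sqrt[OF this] show "(\<lambda>n. l2norm M (f n)) \<longlonglongrightarrow> 0"
    by (simp add: l2norm_nonneg)
qed (auto dest: tendsto_power[where n=2])

lemma L2_tendsto_unique:
  assumes "\<And>n. square_integrable M (f n)" "square_integrable M g" "square_integrable M h"
    and "L2_tendsto M f g" "L2_tendsto M f h"
  shows "AE x in M. g x = h x"
proof -
  have sq: "square_integrable M (\<lambda>x. g x - h x)"
    by (intro square_integrable_diff assms)
  have "(l2norm M (\<lambda>x. g x - h x))\<^sup>2 \<le>
      2 * (l2norm M (\<lambda>x. f n x - g x))\<^sup>2 + 2 * (l2norm M (\<lambda>x. f n x - h x))\<^sup>2" for n
    using l2norm_sq_add_le[of M "\<lambda>x. g x - f n x" "\<lambda>x. f n x - h x"] assms(1-3)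
    by (simp add: square_integrable_diff l2norm_minus_commute[of M g])
  moreover have "(\<lambda>n. 2 * (l2norm M (\<lambda>x. f n x - g x))\<^sup>2 + 2 * (l2norm M (\<lambda>x. f n x - h x))\<^sup>2)
      \<longlonglongrightarrow> 2 * 0\<^sup>2 + 2 * 0\<^sup>2"
    using assms(4,5) unfolding L2_tendsto_def by (intro tendsto_intros)
  ultimately have "(l2norm M (\<lambda>x. g x - h x))\<^sup>2 \<le> 0"
    by (intro LIMSEQ_le_const[of _ _ "(l2norm M (\<lambda>x. g x - h x))\<^sup>2"]) auto
  then have "l2norm M (\<lambda>x. g x - h x) = 0" by simp
  with l2norm_eq_0_iff[OF sq] show ?thesis by simp
qed

text \<open>A single dominating function gives membership and convergence together. Simple
  approximations, increasing unions of events and truncation by the number of points are all handled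
  this way.\<close>

lemma L2_dominated_convergence:
  fixes f :: "nat \<Rightarrow> 'a \<Rightarrow> complex"
  assumes meas: "\<And>i. f i \<in> borel_measurable M" "g \<in> borel_measurable M"
    and w: "square_integrable M (w :: 'a \<Rightarrow> real)"
    and bd: "\<And>i x. x \<in> space M \<Longrightarrow> norm (f i x) \<le> w x"
    and lim: "\<And>x. x \<in> space M \<Longrightarrow> (\<lambda>i. f i x) \<longlonglongrightarrow> g x"
  shows "\<And>i. square_integrable M (f i)" "square_integrable M g" "L2_tendsto M f g"
proof -
  have gb: "norm (g x) \<le> w x" if "x \<in> space M" for x
    using bd that by (intro LIMSEQ_le_const2[OF tendsto_norm[OF lim[OF that]]]) auto
  have w0: "0 \<le> w x" if "x \<in> space M" for x
    using gb[OF that] by (meson norm_ge_zero order_trans)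
  show "square_integrable M (f i)" for i
    by (rule square_integrable_AE_bound[OF meas(1) w]) (use bd w0 in \<open>auto intro!: AE_I2\<close>)
  show "square_integrable M g"
    by (rule square_integrable_AE_bound[OF meas(2) w]) (use gb w0 in \<open>auto intro!: AE_I2\<close>)
  note meas[measurable]
  have [measurable]: "w \<in> borel_measurable M" using w by (rule square_integrable_measurable)
  have "(\<lambda>n. \<integral>x. (norm (f n x - g x))\<^sup>2 \<partial>M) \<longlonglongrightarrow> (\<integral>x. 0 \<partial>M)"
  proof (rule integral_dominated_convergence[where w="\<lambda>x. 4 * (w x)\<^sup>2"])
    show "integrable M (\<lambda>x. 4 * (w x)\<^sup>2)"
      using w by (auto simp: square_integrable_def)
    show "AE x in M. (\<lambda>n. (norm (f n x - g x))\<^sup>2) \<longlonglongrightarrow> 0"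
    proof (rule AE_I2)
      fix x assume "x \<in> space M"
      then have "(\<lambda>n. (norm (f n x - g x))\<^sup>2) \<longlonglongrightarrow> (norm (g x - g x))\<^sup>2"
        by (intro tendsto_intros lim)
      then show "(\<lambda>n. (norm (f n x - g x))\<^sup>2) \<longlonglongrightarrow> 0" by simp
    qed
    show "AE x in M. norm ((norm (f n x - g x))\<^sup>2) \<le> 4 * (w x)\<^sup>2" for n
    proof (rule AE_I2)
      fix x assume x: "x \<in> space M"
      have "norm (f n x - g x) \<le> 2 * w x"
        using norm_triangle_ineq4[of "f n x" "g x"] bd[OF x, of n] gb[OF x] by simp
      then have "(norm (f n x - g x))\<^sup>2 \<le> (2 * w x)\<^sup>2"
        by (intro power_mono) auto
      then show "norm ((norm (f n x - g x))\<^sup>2) \<le> 4 * (w x)\<^sup>2"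
        by simp
    qed
  qed auto
  then show "L2_tendsto M f g"
    unfolding L2_tendsto_def tendsto_l2norm_iff by (simp add: l2norm_sq)
qed

text \<open>Simple functions dominated by \<open>2 * norm (f x)\<close> converge to \<open>f\<close>
  in L2, so a property closed under linear combinations and L2 limits spreads from indicators to the
  whole space.\<close>

lemma (in finite_measure) L2_indicator_induct [consumes 1, case_names lincomb lim indicator]:
  assumes f: "square_integrable M f"
    and lin: "\<And>f g a b. V f \<Longrightarrow> V g \<Longrightarrow> V (\<lambda>x. a * f x + b * g x)"
    and lim: "\<And>f g. (\<And>i. square_integrable M (f i)) \<Longrightarrow> (\<And>i. V (f i)) \<Longrightarrow> square_integrable M g
      \<Longrightarrow> L2_tendsto M f g \<Longrightarrow> V g"
    and ind: "\<And>A. A \<in> sets M \<Longrightarrow> V (\<lambda>x. complex_of_real (indicat_real A x))"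
  shows "V f"
proof -
  have [measurable]: "f \<in> borel_measurable M" using f by (rule square_integrable_measurable)
  obtain s where "\<forall>i. simple_function M (s i)"
    "\<forall>x\<in>space M. (\<lambda>i. s i x) \<longlonglongrightarrow> f x"
    "\<forall>i. \<forall>x\<in>space M. dist (s i x) 0 \<le> 2 * dist (f x) 0"
    using borel_measurable_implies_sequence_metric[of f M 0] by auto
  then have s: "simple_function M (s i)" "x \<in> space M \<Longrightarrow> (\<lambda>i. s i x) \<longlonglongrightarrow> f x"
    "x \<in> space M \<Longrightarrow> dist (s i x) 0 \<le> 2 * dist (f x) 0" for i x
    by auto
  \<comment> \<open>\<open>V\<close> speaks of functions and not of classes, so \<open>s i\<close>
    is replaced by a literal combination of indicators. The two agree on the space of
    \<open>M\<close>, which is all that the limit sees.\<close>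
  define S where "S i x = (\<Sum>y\<in>s i ` space M. y * complex_of_real (indicat_real (s i -` {y} \<inter> space M) x))" for i x
  have S: "S i x = s i x" if "x \<in> space M" for i x
  proof -
    have "S i x = (\<Sum>y\<in>s i ` space M. if y = s i x then s i x else 0)"
      unfolding S_def using that by (intro sum.cong) (auto simp: indicator_def)
    also have "\<dots> = s i x"
      using that simple_functionD(1)[OF s(1)] by (subst sum.delta) auto
    finally show ?thesis .
  qed
  have V0: "V (\<lambda>_. 0)"
    using lin[OF ind[of "{}"] ind[of "{}"], of 0 0] by simp
  have Vsum: "V (\<lambda>x. \<Sum>y\<in>Y. y * complex_of_real (indicat_real (A y) x))"
    if "finite Y" "\<And>y. A y \<in> sets M" for Y :: "complex set" and A
    using that(1)
  proof induction
    case (insert y Y)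
    then show ?case
      using lin[OF ind[OF that(2), of y] insert.IH, of y 1] by simp
  qed (simp add: V0)
  have VS: "V (S i)" for i
    unfolding S_def by (intro Vsum simple_functionD s)
  have [measurable]: "S i \<in> borel_measurable M" for i
    using borel_measurable_simple_function[OF s(1)] S by (subst measurable_cong[of _ "S i" "s i"]) auto
  have "square_integrable M (\<lambda>x. 2 * norm (f x))"
    using f by (intro square_integrable_cmult) (auto simp: square_integrable_def)
  note dc = L2_dominated_convergence[where f=S and g=f, OF _ _ this]
  show "V f"
    by (rule lim[OF dc(1) VS f dc(3)]) (use s S in auto)
qed

text \<open>Nonnegativity of the variance of \<open>norm (f x)\<close>. It makes L2 Cauchy sequences
  L1 Cauchy.\<close>

lemma (in prob_space) integral_norm_le_l2norm:
  assumes "square_integrable M (f :: 'a \<Rightarrow> complex)"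
  shows "(\<integral>x. norm (f x) \<partial>M) \<le> l2norm M f"
proof -
  have "square_integrable M (\<lambda>x. norm (f x))"
    using assms by (auto simp: square_integrable_def)
  then have i: "integrable M (\<lambda>x. norm (f x))" by (rule square_integrable_imp_integrable)
  have "(\<integral>x. norm (f x) \<partial>M)\<^sup>2 \<le> (\<integral>x. (norm (f x))\<^sup>2 \<partial>M)"
    using variance_positive[of "\<lambda>x. norm (f x)"]
      variance_eq[OF i square_integrable_integrable[OF assms]] by simp
  then show ?thesis
    unfolding l2norm_def by (rule real_le_rsqrt)
qed

text \<open>Riesz-Fischer by way of L1: an L1 Cauchy sequence has a subsequence converging almost
  everywhere, and Fatou's lemma along it turns the L2 Cauchy bound into a bound on the distance to
  the pointwise limit.\<close>

lemma (in prob_space) L2_complete: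
  fixes f :: "nat \<Rightarrow> 'a \<Rightarrow> complex"
  assumes sq: "\<And>n. square_integrable M (f n)"
    and cauchy: "\<And>e. e > 0 \<Longrightarrow> \<exists>N. \<forall>i\<ge>N. \<forall>j\<ge>N. l2norm M (\<lambda>x. f i x - f j x) < e"
  obtains g where "square_integrable M g" "L2_tendsto M f g"
proof -
  note [measurable] = sq[THEN square_integrable_measurable]
  obtain r where r: "strict_mono r" "AE x in M. Cauchy (\<lambda>i. f (r i) x)"
  proof (rule cauchy_L1_AE_cauchy_subseq[of M f])
    show "integrable M (f n)" for n by (rule square_integrable_imp_integrable[OF sq])
    fix e :: real assume "e > 0"
    from cauchy[OF this] obtain N where N: "\<forall>i\<ge>N. \<forall>j\<ge>N. l2norm M (\<lambda>x. f i x - f j x) < e" by auto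
    have "(LINT x|M. norm (f i x - f j x)) < e" if "i \<ge> N" "j \<ge> N" for i j
      using integral_norm_le_l2norm[OF square_integrable_diff[OF sq sq], of i j] N that
      by (meson order.strict_trans1)
    then show "\<exists>N. \<forall>i\<ge>N. \<forall>j\<ge>N. (LINT x|M. norm (f i x - f j x)) < e" by auto
  qed auto
  \<comment> \<open>The default 0 off the set of convergence keeps \<open>g\<close> measurable on
    the whole space.\<close>
  define g where "g x = (if Cauchy (\<lambda>i. f (r i) x) then lim (\<lambda>i. f (r i) x) else 0)" for x
  have [measurable]: "g \<in> borel_measurable M" unfolding g_def by measurable
  have glim: "AE x in M. (\<lambda>i. f (r i) x) \<longlonglongrightarrow> g x"
    using r(2) by eventually_elim (auto simp: g_def Cauchy_convergent_iff convergent_LIMSEQ_iff)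
  have fatou: "(\<integral>\<^sup>+x. ennreal ((norm (f i x - g x))\<^sup>2) \<partial>M) \<le> ennreal (e\<^sup>2)"
    if e: "e > 0" "\<And>j. j \<ge> N \<Longrightarrow> l2norm M (\<lambda>x. f i x - f j x) < e" for i N e
  proof -
    have "(\<integral>\<^sup>+x. ennreal ((norm (f i x - g x))\<^sup>2) \<partial>M) =
        (\<integral>\<^sup>+x. liminf (\<lambda>k. ennreal ((norm (f i x - f (r k) x))\<^sup>2)) \<partial>M)"
    proof (rule nn_integral_cong_AE)
      show "AE x in M. ennreal ((norm (f i x - g x))\<^sup>2) = liminf (\<lambda>k. ennreal ((norm (f i x - f (r k) x))\<^sup>2))"
        using glim
      proof eventually_elim
        case (elim x)
        then have "(\<lambda>k. ennreal ((norm (f i x - f (r k) x))\<^sup>2)) \<longlonglongrightarrow> ennreal ((norm (f i x - g x))\<^sup>2)"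
          by (intro tendsto_intros)
        then show ?case
          by (rule lim_imp_Liminf[OF sequentially_bot, symmetric])
      qed
    qed
    also have "\<dots> \<le> liminf (\<lambda>k. \<integral>\<^sup>+x. ennreal ((norm (f i x - f (r k) x))\<^sup>2) \<partial>M)"
      by (rule nn_integral_liminf) auto
    also have "\<dots> \<le> ennreal (e\<^sup>2)"
    proof (rule Liminf_le)
      have "(\<integral>\<^sup>+x. ennreal ((norm (f i x - f (r k) x))\<^sup>2) \<partial>M) \<le> ennreal (e\<^sup>2)" if "k \<ge> N" for k
      proof -
        have "r k \<ge> N" using seq_suble[OF r(1), of k] that by linarith
        then have "(l2norm M (\<lambda>x. f i x - f (r k) x))\<^sup>2 \<le> e\<^sup>2"
          using e(2)[of "r k"] by (intro power_mono) (auto simp: l2norm_nonneg)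
        then show ?thesis
          using square_integrable_integrable[OF square_integrable_diff[OF sq sq], of i "r k"]
          by (subst nn_integral_eq_integral) (auto simp: l2norm_sq)
      qed
      then show "\<forall>\<^sub>F k in sequentially. (\<integral>\<^sup>+x. ennreal ((norm (f i x - f (r k) x))\<^sup>2) \<partial>M) \<le> ennreal (e\<^sup>2)"
        by (auto simp: eventually_sequentially)
    qed auto
    finally show ?thesis .
  qed
  have *: "square_integrable M (\<lambda>x. f i x - g x)" "l2norm M (\<lambda>x. f i x - g x) \<le> e"
    if e: "e > 0" "\<And>j. j \<ge> N \<Longrightarrow> l2norm M (\<lambda>x. f i x - f j x) < e" for i N e
  proof -
    note ft = fatou[OF e]
    have "integrable M (\<lambda>x. (norm (f i x - g x))\<^sup>2)"
      by (rule integrableI_bounded) (use le_less_trans[OF ft[of N]] in auto)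
    then show "square_integrable M (\<lambda>x. f i x - g x)" by (auto simp: square_integrable_def)
    have "(\<integral>x. (norm (f i x - g x))\<^sup>2 \<partial>M) \<le> e\<^sup>2"
      using ft \<open>integrable M _\<close> by (subst (asm) nn_integral_eq_integral) auto
    then show "l2norm M (\<lambda>x. f i x - g x) \<le> e"
      using e(1) by (auto simp: l2norm_def intro!: real_le_lsqrt)
  qed
  have ge: "square_integrable M g"
  proof -
    from cauchy[of 1] obtain N where N: "\<forall>i\<ge>N. \<forall>j\<ge>N. l2norm M (\<lambda>x. f i x - f j x) < 1" by auto
    have "square_integrable M (\<lambda>x. f N x - g x)" by (rule *[of 1 N]) (use N in auto)
    from square_integrable_diff[OF sq[of N] this] show ?thesis by simp
  qed
  moreover have "L2_tendsto M f g"
    unfolding L2_tendsto_def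
  proof (rule LIMSEQ_I)
    fix e :: real assume "e > 0"
    with cauchy[of "e/2"] obtain N where N: "\<forall>i\<ge>N. \<forall>j\<ge>N. l2norm M (\<lambda>x. f i x - f j x) < e/2" by auto
    have "l2norm M (\<lambda>x. f i x - g x) \<le> e/2" if "i \<ge> N" for i
      by (rule *(2)[of _ N]) (use N that \<open>e > 0\<close> in auto)
    then show "\<exists>N. \<forall>n\<ge>N. norm (l2norm M (\<lambda>x. f n x - g x) - 0) < e"
      using \<open>e > 0\<close> by (intro exI[of _ N]) (force simp: l2norm_nonneg)
  qed
  ultimately show ?thesis using that by blast
qed

subsection \<open>The configuration space\<close>

lemma space_configuration_space: "space configuration_space = configurations"
  unfolding configuration_space_def by (rule space_measure_of) auto

lemma sets_configuration_space: "sets configuration_space =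
    sigma_sets configurations {{\<omega> \<in> configurations. card (\<omega> \<inter> B) = k} | B k. B \<in> sets borel}"
  unfolding configuration_space_def by (rule sets_measure_of) auto

lemma finite_configuration: "\<omega> \<in> configurations \<Longrightarrow> finite \<omega>"
  by (simp add: configurations_def)

lemma measurable_count:
  assumes "B \<in> sets borel"
  shows "(\<lambda>\<omega>. card (\<omega> \<inter> B)) \<in> measurable configuration_space (count_space UNIV)"
proof (rule measurable_count_space_eq2_countable[THEN iffD2], auto)
  fix k
  have "{\<omega> \<in> configurations. card (\<omega> \<inter> B) = k} \<in> sets configuration_space"
    unfolding sets_configuration_space using assms by (intro sigma_sets.Basic) auto
  moreover have "(\<lambda>\<omega>. card (\<omega> \<inter> B)) -` {k} \<inter> space configuration_space =
      {\<omega> \<in> configurations. card (\<omega> \<inter> B) = k}"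
    by (auto simp: space_configuration_space)
  ultimately show "(\<lambda>\<omega>. card (\<omega> \<inter> B)) -` {k} \<inter> space configuration_space \<in> sets configuration_space"
    by simp
qed

lemma measurable_card: "card \<in> measurable configuration_space (count_space UNIV)"
  using measurable_count[of UNIV] by simp

lemma prod_power_card:
  fixes c :: "'b::comm_monoid_mult"
  assumes "finite \<omega>"
  shows "(\<Prod>x\<in>\<omega>. if x \<in> B then c else 1) = c ^ card (\<omega> \<inter> B)"
  using prod.inter_restrict[of \<omega> "\<lambda>_. c" B] assms by simp

text \<open>The event that there are \<open>k\<close> points in \<open>B\<close> has indicator
  \<open>lim (c\<^sup>N - \<Sum>j<k. c\<^sup>j 1\<^bsub>N = j\<^esub>) / c\<^sup>k\<close> for \<open>c \<rightarrow> 0\<close>, where \<open>N\<close> counts the points in \<open>B\<close>;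
  so multiplicative functionals generate all events by linear combinations and bounded limits.\<close>

lemma configuration_monotone_class:
  fixes V :: "(real set \<Rightarrow> real) \<Rightarrow> bool"
  assumes lin: "\<And>f g a b. V f \<Longrightarrow> V g \<Longrightarrow> V (\<lambda>\<omega>. a * f \<omega> + b * g \<omega>)"
    and lim: "\<And>f g C. (\<And>i. V (f i)) \<Longrightarrow> (\<And>i \<omega>. \<omega> \<in> configurations \<Longrightarrow> \<bar>f i \<omega>\<bar> \<le> C) \<Longrightarrow>
      (\<And>\<omega>. \<omega> \<in> configurations \<Longrightarrow> (\<lambda>i. f i \<omega>) \<longlonglongrightarrow> g \<omega>) \<Longrightarrow> V g"
    and mult: "\<And>u. simple_function borel u \<Longrightarrow> (\<And>x. 0 \<le> u x) \<Longrightarrow> (\<And>x. u x \<le> 1) \<Longrightarrow>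
      V (\<lambda>\<omega>. \<Prod>x\<in>\<omega>. u x)"
    and A: "A \<in> sets configuration_space"
  shows "V (indicat_real A)"
proof -
  \<comment> \<open>\<open>lim\<close> applied to a constant sequence: it looks at configurations
    only, so a bounded function may be changed elsewhere.\<close>
  have cong: "V g" if "V f" "\<And>\<omega>. \<omega> \<in> configurations \<Longrightarrow> f \<omega> = g \<omega>"
    "\<And>\<omega>. \<omega> \<in> configurations \<Longrightarrow> \<bar>f \<omega>\<bar> \<le> C" for f g C
    by (rule lim[of "\<lambda>_. f" C]) (use that in auto)
  have zero: "V (\<lambda>_. 0)"
    using lin[OF mult[of "\<lambda>_. 0"] mult[of "\<lambda>_. 0"], of 0 0] by simp
  have sum: "V (\<lambda>\<omega>. \<Sum>j<n. a j * f j \<omega>)" if "\<And>j. j < n \<Longrightarrow> V (f j)" for n :: nat and f a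
    using that
  proof (induction n)
    case (Suc n)
    then have "V (\<lambda>\<omega>. 1 * (\<Sum>j<n. a j * f j \<omega>) + a n * f n \<omega>)"
      by (intro lin) auto
    then show ?case by simp
  qed (simp add: zero)
  define ind :: "(real set \<times> nat) list \<Rightarrow> real set \<Rightarrow> real"
    where "ind L \<omega> = of_bool (\<forall>(B, k)\<in>set L. card (\<omega> \<inter> B) = k)" for L \<omega>
  \<comment> \<open>The factor over \<open>u\<close> strengthens the claim so that the induction
    over the list works: a further condition on \<open>B\<close> is reached by multiplying
    \<open>u\<close> by a constant on \<open>B\<close>. The case \<open>u = 1\<close> gives the
    indicators.\<close>
  have ind_mult: "V (\<lambda>\<omega>. ind L \<omega> * (\<Prod>x\<in>\<omega>. u x))"
    if "\<forall>(B, k)\<in>set L. B \<in> sets borel" "simple_function borel u" "\<And>x. 0 \<le> u x" "\<And>x. u x \<le> 1"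
    for L u
    using that
  proof (induction L arbitrary: u)
    case Nil
    then show ?case using mult by (simp add: ind_def)
  next
    case (Cons Bk L)
    obtain B k where Bk: "Bk = (B, k)" by force
    with Cons have B: "B \<in> sets borel" by simp
    define Y where "Y \<omega> = ind L \<omega> * (\<Prod>x\<in>\<omega>. u x)" for \<omega>
    have Y: "0 \<le> Y \<omega>" "Y \<omega> \<le> 1" for \<omega>
      using Cons.prems by (auto simp: Y_def ind_def intro!: prod_nonneg prod_le_1)
    have pow: "V (\<lambda>\<omega>. Y \<omega> * c ^ card (\<omega> \<inter> B))" if c: "0 \<le> c" "c \<le> 1" for c
    proof -
      define u' where "u' x = u x * (if x \<in> B then c else 1)" for x
      have "simple_function borel (\<lambda>x. if x \<in> B then c else 1)"
        using B by (intro simple_function_If_set) auto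
      then have u': "simple_function borel u'"
        unfolding u'_def using Cons.prems(2) by (intro simple_function_mult)
      have "u' x \<le> 1" for x
        using Cons.prems(3,4)[of x] c by (auto simp: u'_def mult_le_one)
      moreover have "0 \<le> u' x" for x
        using Cons.prems(3)[of x] c by (auto simp: u'_def)
      ultimately have V': "V (\<lambda>\<omega>. ind L \<omega> * (\<Prod>x\<in>\<omega>. u' x))"
        using Cons.prems(1) u' by (intro Cons.IH) auto
      show ?thesis
      proof (rule cong[OF V'])
        fix \<omega> assume "\<omega> \<in> configurations"
        then show "ind L \<omega> * (\<Prod>x\<in>\<omega>. u' x) = Y \<omega> * c ^ card (\<omega> \<inter> B)"
          unfolding u'_def Y_def by (simp add: prod.distrib prod_power_card finite_configuration)
        then show "\<bar>ind L \<omega> * (\<Prod>x\<in>\<omega>. u' x)\<bar> \<le> 1"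
          using Y[of \<omega>] c by (simp add: abs_mult mult_le_one power_le_one)
      qed
    qed
    have "V (\<lambda>\<omega>. Y \<omega> * of_bool (card (\<omega> \<inter> B) = k))"
    proof (induction k rule: less_induct)
      case (less k)
      define c where "c i = inverse (real (Suc i))" for i
      have c: "0 < c i" "c i \<le> 1" for i
        by (auto simp: c_def field_simps)
      have c0: "c \<longlonglongrightarrow> 0"
        unfolding c_def by (rule LIMSEQ_inverse_real_of_nat)
      define f where "f i \<omega> = (1 / c i ^ k) * (Y \<omega> * c i ^ card (\<omega> \<inter> B)) +
        (- 1 / c i ^ k) * (\<Sum>j<k. c i ^ j * (Y \<omega> * of_bool (card (\<omega> \<inter> B) = j)))" for i \<omega>
      have V: "V (f i)" for i
        unfolding f_def using c by (intro lin sum pow less.IH) (auto intro: less_imp_le)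
      \<comment> \<open>After subtracting the events with fewer than \<open>k\<close> points only
        nonnegative powers of \<open>c i\<close> are left, so the functions stay bounded although
        they were divided by \<open>c i ^ k\<close>.\<close>
      have f: "f i \<omega> = (if card (\<omega> \<inter> B) < k then 0 else Y \<omega> * c i ^ (card (\<omega> \<inter> B) - k))" for i \<omega>
      proof -
        have "(\<Sum>j<k. c i ^ j * (Y \<omega> * of_bool (card (\<omega> \<inter> B) = j))) =
            (\<Sum>j<k. if card (\<omega> \<inter> B) = j then c i ^ j * Y \<omega> else 0)"
          by (intro sum.cong) auto
        then have "(\<Sum>j<k. c i ^ j * (Y \<omega> * of_bool (card (\<omega> \<inter> B) = j))) =
            (if card (\<omega> \<inter> B) < k then c i ^ card (\<omega> \<inter> B) * Y \<omega> else 0)"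
          by simp
        then show ?thesis
          using c(1)[of i] by (auto simp: f_def power_diff not_less)
      qed
      show ?case
      proof (rule lim[of f, OF V])
        fix i \<omega>
        show "\<bar>f i \<omega>\<bar> \<le> 1"
          using Y[of \<omega>] c[of i] by (auto simp: f abs_mult mult_le_one power_le_one less_imp_le)
        show "(\<lambda>i. f i \<omega>) \<longlonglongrightarrow> Y \<omega> * of_bool (card (\<omega> \<inter> B) = k)"
        proof (cases "card (\<omega> \<inter> B)" k rule: linorder_cases)
          case greater
          then have "(\<lambda>i. Y \<omega> * c i ^ (card (\<omega> \<inter> B) - k)) \<longlonglongrightarrow> Y \<omega> * 0 ^ (card (\<omega> \<inter> B) - k)"
            by (intro tendsto_intros c0)
          with greater show ?thesis by (simp add: f power_0_left)
        qed (auto simp: f)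
      qed
    qed
    moreover have "Y \<omega> * of_bool (card (\<omega> \<inter> B) = k) = ind (Bk # L) \<omega> * (\<Prod>x\<in>\<omega>. u x)" for \<omega>
      by (auto simp: Y_def ind_def Bk)
    ultimately show ?case by simp
  qed
  \<comment> \<open>Finite intersections of generating events, described by lists so that
    intersection becomes concatenation.\<close>
  define G where "G = {{\<omega> \<in> configurations. \<forall>(B, k)\<in>set L. card (\<omega> \<inter> B) = k} | L. \<forall>(B, k)\<in>set L. B \<in> sets borel}"
  have "Int_stable G"
    unfolding Int_stable_def
  proof safe
    fix a b assume "a \<in> G" "b \<in> G"
    then obtain L L' where "a = {\<omega> \<in> configurations. \<forall>(B, k)\<in>set L. card (\<omega> \<inter> B) = k}"
      "b = {\<omega> \<in> configurations. \<forall>(B, k)\<in>set L'. card (\<omega> \<inter> B) = k}"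
      "\<forall>(B, k)\<in>set L. B \<in> sets borel" "\<forall>(B, k)\<in>set L'. B \<in> sets borel"
      unfolding G_def by blast
    then have "a \<inter> b = {\<omega> \<in> configurations. \<forall>(B, k)\<in>set (L @ L'). card (\<omega> \<inter> B) = k}"
      and "\<forall>(B, k)\<in>set (L @ L'). B \<in> sets borel"
      unfolding set_append ball_Un by auto
    then show "a \<inter> b \<in> G"
      unfolding G_def by blast
  qed
  moreover have "G \<subseteq> Pow configurations"
    by (auto simp: G_def)
  moreover have "A \<in> sigma_sets configurations G"
  proof -
    have "{{\<omega> \<in> configurations. card (\<omega> \<inter> B) = k} | B k. B \<in> sets borel} \<subseteq> G"
    proof safe
      fix B :: "real set" and k :: nat assume "B \<in> sets borel"
      then show "{\<omega> \<in> configurations. card (\<omega> \<inter> B) = k} \<in> G"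
        unfolding G_def by (intro CollectI exI[of _ "[(B, k)]"]) auto
    qed
    from sigma_sets_mono'[OF this] show ?thesis
      using A unfolding sets_configuration_space by auto
  qed
  ultimately show ?thesis
  proof (induction rule: sigma_sets_induct_disjoint)
    case (basic A)
    then obtain L where L: "A = {\<omega> \<in> configurations. \<forall>(B, k)\<in>set L. card (\<omega> \<inter> B) = k}"
      "\<forall>(B, k)\<in>set L. B \<in> sets borel"
      unfolding G_def by blast
    have "V (\<lambda>\<omega>. ind L \<omega> * (\<Prod>x\<in>\<omega>. 1))"
      using L(2) by (intro ind_mult) auto
    then show ?case
      by (rule cong[where C=1]) (auto simp: L(1) ind_def indicator_def)
  next
    case empty
    then show ?case using zero by simp
  next
    case (compl A)
    have "V (\<lambda>\<omega>. 1 * (\<Prod>x\<in>\<omega>. 1) + (-1) * indicat_real A \<omega>)"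
      by (intro lin mult compl) auto
    then show ?case
      by (rule cong[where C=1]) (auto simp: indicator_def)
  next
    case (union A)
    define f where "f i \<omega> = (\<Sum>j<i. 1 * indicat_real (A j) \<omega>)" for i \<omega>
    have f: "f i \<omega> = indicat_real (\<Union>j<i. A j) \<omega>" for i \<omega>
      using union(1) by (simp add: f_def indicator_UN_disjoint[OF _ disjoint_family_on_mono[of "{..<i}" UNIV]])
    have "V (f i)" for i
      unfolding f_def by (intro sum union)
    then show ?case
    proof (rule lim)
      show "\<bar>f i \<omega>\<bar> \<le> 1" for i \<omega> by (simp add: f indicator_def)
      show "(\<lambda>i. f i \<omega>) \<longlonglongrightarrow> indicat_real (\<Union> (range A)) \<omega>" for \<omega>
        unfolding f by (rule LIMSEQ_indicator_UN)
    qed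
  qed
qed

subsection \<open>The uniform distribution on the cube\<close>

lemma prob_space_unit_leb: "prob_space unit_leb"
  by (rule prob_space_restrict_space) auto

lemma space_unit_leb: "space unit_leb = {0..1}"
  by (simp add: space_restrict_space)

lemma prob_space_unit_leb_power: "prob_space (unit_leb_power n)"
  by (intro prob_space_PiM prob_space_unit_leb)

lemma product_sigma_finite_unit_leb: "product_sigma_finite (\<lambda>_. unit_leb)"
  using prob_space_imp_sigma_finite[OF prob_space_unit_leb] by (simp add: product_sigma_finite_def)

lemma space_unit_leb_power: "space (unit_leb_power n) = {..<n} \<rightarrow>\<^sub>E {0..1}"
  by (simp add: space_PiM space_unit_leb)

lemma borel_measurable_unit_leb: "f \<in> borel_measurable borel \<Longrightarrow> f \<in> borel_measurable unit_leb"
  by (intro measurable_restrict_space1) auto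

lemma measurable_component_unit_leb [measurable]:
  assumes "i < n"
  shows "(\<lambda>x. x i) \<in> borel_measurable (unit_leb_power n)"
proof -
  have "(\<lambda>x. x i) \<in> measurable (unit_leb_power n) unit_leb"
    using assms by (intro measurable_component_singleton) auto
  from measurable_compose[OF this borel_measurable_unit_leb[of "\<lambda>x. x"]] show ?thesis by simp
qed

text \<open>Fubini in coordinate \<open>i\<close>: each section of the diagonal is contained in the
  single point \<open>x j\<close>, a null set.\<close>

lemma AE_unit_leb_power_neq:
  assumes "i < n" "j < n" "i \<noteq> j"
  shows "AE x in unit_leb_power n. x i \<noteq> x j"
proof -
  interpret product_sigma_finite "\<lambda>_. unit_leb" by (rule product_sigma_finite_unit_leb)
  define I where "I = {..<n} - {i}"
  have I: "finite I" "i \<notin> I" "insert i I = {..<n}" "j \<in> I"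
    using assms by (auto simp: I_def)
  let ?D = "{x \<in> space (unit_leb_power n). x i = x j}"
  have [measurable]: "?D \<in> sets (unit_leb_power n)"
    using assms by measurable
  have "emeasure (unit_leb_power n) ?D = (\<integral>\<^sup>+x. indicator ?D x \<partial>PiM (insert i I) (\<lambda>_. unit_leb))"
    by (simp add: I(3))
  also have "\<dots> = (\<integral>\<^sup>+x. (\<integral>\<^sup>+y. indicator ?D (x(i := y)) \<partial>unit_leb) \<partial>PiM I (\<lambda>_. unit_leb))"
    by (rule product_nn_integral_insert) (use I in auto)
  also have "\<dots> \<le> (\<integral>\<^sup>+x. 0 \<partial>PiM I (\<lambda>_. unit_leb))"
  proof (rule nn_integral_mono)
    fix x assume "x \<in> space (PiM I (\<lambda>_. unit_leb))"
    then have "x j \<in> {0..1}" using I(4) by (auto simp: space_PiM space_unit_leb)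
    have "(\<integral>\<^sup>+y. indicator ?D (x(i := y)) \<partial>unit_leb) \<le> (\<integral>\<^sup>+y. indicator {x j} y \<partial>unit_leb)"
      using assms(3) by (intro nn_integral_mono) (auto simp: indicator_def)
    also have "\<dots> = emeasure unit_leb {x j}"
      using \<open>x j \<in> {0..1}\<close> by (intro nn_integral_indicator) (auto simp: sets_restrict_space_iff)
    also have "\<dots> = 0"
      using \<open>x j \<in> {0..1}\<close> by (subst emeasure_restrict_space) auto
    finally show "(\<integral>\<^sup>+y. indicator ?D (x(i := y)) \<partial>unit_leb) \<le> 0" .
  qed
  finally show ?thesis
    by (intro AE_I[of _ _ ?D]) auto
qed

lemma AE_unit_leb_power_inj: "AE x in unit_leb_power n. inj_on x {..<n}"
proof -
  have "AE x in unit_leb_power n. \<forall>(i, j)\<in>{(i, j). i < n \<and> j < n \<and> i \<noteq> j}. x i \<noteq> x j"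
  proof (rule AE_finite_allI)
    show "finite {(i, j). i < n \<and> j < n \<and> i \<noteq> j}"
      by (rule finite_subset[of _ "{..<n} \<times> {..<n}"]) auto
  qed (auto intro: AE_unit_leb_power_neq)
  then show ?thesis
    by eventually_elim (auto simp: inj_on_def)
qed

lemma measurable_point_set:
  "(\<lambda>x. x ` {..<n}) \<in> measurable (unit_leb_power n) configuration_space"
  unfolding configuration_space_def
proof (rule measurable_sigma_sets[OF sets_configuration_space[unfolded configuration_space_def]])
  show "(\<lambda>x. x ` {..<n}) \<in> space (unit_leb_power n) \<rightarrow> configurations"
    by (auto simp: space_unit_leb_power configurations_def)
  fix A assume "A \<in> {{\<omega> \<in> configurations. card (\<omega> \<inter> B) = k} | B k. B \<in> sets borel}"
  then obtain B :: "real set" and k where A: "A = {\<omega> \<in> configurations. card (\<omega> \<inter> B) = k}"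
    and [measurable]: "B \<in> sets borel" by auto
  \<comment> \<open>Every point is counted at the first index where it occurs, which keeps the
    formula valid when coordinates coincide and the image has fewer than \<open>m\<close>
    points.\<close>
  have card_eq: "card (x ` {..<m} \<inter> B) =
      (\<Sum>i<m. of_bool (x i \<in> B \<and> (\<forall>j\<in>{..<i}. x j \<noteq> x i)))" for x :: "nat \<Rightarrow> real" and m
  proof (induction m)
    case (Suc m)
    have "x ` {..<Suc m} \<inter> B = (if x m \<in> B \<and> (\<forall>j<m. x j \<noteq> x m) then insert (x m) (x ` {..<m} \<inter> B)
        else x ` {..<m} \<inter> B)"
      by (auto simp: lessThan_Suc) (metis imageI lessThan_iff)
    moreover have "x m \<notin> x ` {..<m} \<inter> B" if "\<forall>j<m. x j \<noteq> x m"
      using that by force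
    ultimately have "card (x ` {..<Suc m} \<inter> B) = card (x ` {..<m} \<inter> B) + of_bool (x m \<in> B \<and> (\<forall>j<m. x j \<noteq> x m))"
      by auto
    then show ?case using Suc by (simp add: Ball_def)
  qed simp
  have "(\<lambda>x. x ` {..<n}) -` A \<inter> space (unit_leb_power n) = {x \<in> space (unit_leb_power n).
      (\<Sum>i<n. of_bool (x i \<in> B \<and> (\<forall>j\<in>{..<i}. x j \<noteq> x i))) = k}"
  proof -
    have "x ` {..<n} \<in> configurations" if "x \<in> space (unit_leb_power n)" for x
      using that by (auto simp: space_unit_leb_power configurations_def)
    then show ?thesis unfolding A card_eq[symmetric] by blast
  qed
  also have "\<dots> \<in> sets (unit_leb_power n)"
  proof -
    have "Measurable.pred (unit_leb_power n) (\<lambda>x. x i \<in> B \<and> (\<forall>j\<in>{..<i}. x j \<noteq> x i))" if "i < n" for i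
    proof -
      note [measurable] = measurable_component_unit_leb[OF that]
      have 1: "Measurable.pred (unit_leb_power n) (\<lambda>x. x i \<in> B)"
        by measurable
      have 2: "Measurable.pred (unit_leb_power n) (\<lambda>x. x j \<noteq> x i)" if "j < i" for j
        unfolding pred_def by (intro borel_measurable_neq measurable_component_unit_leb) (use that \<open>i < n\<close> in auto)
      have "Measurable.pred (unit_leb_power n) (\<lambda>x. \<forall>j\<in>{..<i}. x j \<noteq> x i)"
        by (rule pred_intros_finite(3)) (use 2 in \<open>simp_all only: finite_lessThan lessThan_iff\<close>)
      with 1 show ?thesis by (rule pred_intros_logic)
    qed
    then have "(\<lambda>x. \<Sum>i<n. of_bool (x i \<in> B \<and> (\<forall>j\<in>{..<i}. x j \<noteq> x i)) :: nat)
        \<in> measurable (unit_leb_power n) (count_space UNIV)"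
      unfolding of_bool_def by (intro measurable_sum_nat measurable_If) auto
    then show ?thesis
      by (rule measurable_sets_Collect[of _ _ _ "\<lambda>m. m = k"]) auto
  qed
  finally show "(\<lambda>x. x ` {..<n}) -` A \<inter> space (unit_leb_power n) \<in> sets (unit_leb_power n)" .
qed auto

subsection \<open>The Poisson process\<close>

text \<open>The probability generating function of the Poisson distribution, summed by the
  exponential series of \<open>c * l\<close>.\<close>

lemma nn_integral_power_poisson:
  fixes c l :: real and N :: "'a \<Rightarrow> nat"
  assumes "prob_space P" and N: "N \<in> measurable P (count_space UNIV)"
    and pois: "\<And>k. measure P {\<omega> \<in> space P. N \<omega> = k} = exp (- l) * l ^ k / fact k"
    and c: "0 \<le> c" and l: "0 \<le> l"
  shows "(\<integral>\<^sup>+\<omega>. ennreal (c ^ N \<omega>) \<partial>P) = ennreal (exp ((c - 1) * l))"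
proof -
  interpret prob_space P by fact
  have [measurable]: "{\<omega> \<in> space P. N \<omega> = k} \<in> sets P" for k
    using N by measurable
  have "(\<integral>\<^sup>+\<omega>. ennreal (c ^ N \<omega>) \<partial>P) =
      (\<integral>\<^sup>+\<omega>. (\<Sum>k. ennreal (c ^ k) * indicator {\<omega> \<in> space P. N \<omega> = k} \<omega>) \<partial>P)"
  proof (rule nn_integral_cong)
    fix \<omega> assume "\<omega> \<in> space P"
    then show "ennreal (c ^ N \<omega>) = (\<Sum>k. ennreal (c ^ k) * indicator {\<omega> \<in> space P. N \<omega> = k} \<omega>)"
      by (subst suminf_finite[of "{N \<omega>}"]) (auto simp: indicator_def)
  qed
  also have "\<dots> = (\<Sum>k. ennreal (c ^ k) * emeasure P {\<omega> \<in> space P. N \<omega> = k})"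
    by (simp add: nn_integral_suminf nn_integral_cmult)
  also have "\<dots> = (\<Sum>k. ennreal (exp (- l) * ((c * l) ^ k /\<^sub>R fact k)))"
    using c l by (simp add: emeasure_eq_measure pois ennreal_mult[symmetric] power_mult_distrib field_simps)
  also have "\<dots> = ennreal (exp (- l) * exp (c * l))"
    by (rule suminf_ennreal_eq[OF _ sums_mult[OF exp_converges]]) (use c l in auto)
  also have "exp (- l) * exp (c * l) = exp ((c - 1) * l)"
    by (simp add: exp_add[symmetric] algebra_simps)
  finally show ?thesis .
qed

lemma poisson_process_law_sets:
  assumes "poisson_process_law P"
  shows "sets P = sets configuration_space" "space P = configurations" "prob_space P"
  using assms sets_eq_imp_space_eq[of P configuration_space]
  by (auto simp: poisson_process_law_def space_configuration_space)

lemma poisson_process_law_count: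
  assumes "poisson_process_law P" "B \<in> sets borel" "B \<subseteq> {0..1}"
  shows "measure P {\<omega> \<in> space P. card (\<omega> \<inter> B) = k} =
    exp (- measure lborel B) * measure lborel B ^ k / fact k"
  using assms unfolding poisson_process_law_def by blast

lemma poisson_process_law_indep:
  fixes I :: "nat set"
  assumes "poisson_process_law P" "finite I" "disjoint_family_on B I"
    and "\<And>i. i \<in> I \<Longrightarrow> B i \<in> sets borel" "\<And>i. i \<in> I \<Longrightarrow> B i \<subseteq> {0..1}"
  shows "prob_space.indep_vars P (\<lambda>_. count_space UNIV) (\<lambda>i \<omega>. card (\<omega> \<inter> B i)) I"
proof -
  have "\<forall>(I :: nat set) B. finite I \<longrightarrow> disjoint_family_on B I \<longrightarrow>
      (\<forall>i\<in>I. B i \<in> sets borel \<and> B i \<subseteq> {0..1}) \<longrightarrow>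
      prob_space.indep_vars P (\<lambda>_. count_space UNIV) (\<lambda>i \<omega>. card (\<omega> \<inter> B i)) I"
    using assms(1) unfolding poisson_process_law_def by (elim conjE)
  from this[rule_format, OF assms(2,3)] show ?thesis
    using assms(4,5) by blast
qed

text \<open>The Laplace functional for step functions: the level sets of \<open>u\<close> are
  disjoint, so the numbers of points in them are independent Poisson variables whose generating
  functions multiply.\<close>

lemma poisson_process_generating:
  fixes u :: "real \<Rightarrow> real"
  assumes P: "poisson_process_law P"
    and u: "simple_function borel u" "\<And>x. 0 \<le> u x" "\<And>x. u x \<le> 1"
  shows "(\<integral>\<omega>. (\<Prod>x\<in>\<omega>. u x) \<partial>P) = exp ((\<integral>x. u x \<partial>unit_leb) - 1)"
proof -
  interpret prob_space P using P by (rule poisson_process_law_sets)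
  interpret U: prob_space unit_leb by (rule prob_space_unit_leb)
  have meas: "f \<in> measurable P N \<longleftrightarrow> f \<in> measurable configuration_space N" for N :: "'c measure" and f
    using measurable_cong_sets[OF poisson_process_law_sets(1)[OF P] refl, of N] by simp
  have "finite (range u)" using u(1) by (simp add: simple_function_def)
  \<comment> \<open>The values of \<open>u\<close> are numbered because
    \<open>poisson_process_law\<close> states independence for families indexed by natural
    numbers.\<close>
  then obtain h where h: "bij_betw h {0..<card (range u)} (range u)"
    using ex_bij_betw_nat_finite by blast
  define I where "I = {0..<card (range u)}"
  note h = h[folded I_def]
  have I: "finite I" by (simp add: I_def)
  define B where "B i = u -` {h i} \<inter> {0..1}" for i
  have [measurable]: "B i \<in> sets borel" for i
    unfolding B_def using simple_functionD(2)[OF u(1), of "{h i}"] by auto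
  have B_sub: "B i \<subseteq> {0..1}" for i by (simp add: B_def)
  have hh: "0 \<le> h i" "h i \<le> 1" if "i \<in> I" for i
    using bij_betwE[OF h] that u by auto
  have disj: "disjoint_family_on B I"
    using bij_betw_imp_inj_on[OF h] by (auto simp: disjoint_family_on_def B_def inj_on_def)
  have prod_eq: "(\<Prod>x\<in>\<omega>. u x) = (\<Prod>i\<in>I. h i ^ card (\<omega> \<inter> B i))" if "\<omega> \<in> configurations" for \<omega>
  proof -
    have fin: "finite \<omega>" and sub: "\<omega> \<subseteq> {0..1}" using that by (auto simp: configurations_def)
    have "(\<Prod>x\<in>\<omega>. u x) = (\<Prod>y\<in>range u. \<Prod>x\<in>{x \<in> \<omega>. u x = y}. u x)"
      by (rule prod.group[symmetric]) (use fin \<open>finite (range u)\<close> in auto)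
    also have "\<dots> = (\<Prod>y\<in>range u. y ^ card {x \<in> \<omega>. u x = y})"
      by (intro prod.cong) (auto simp: prod_constant)
    also have "\<dots> = (\<Prod>i\<in>I. h i ^ card {x \<in> \<omega>. u x = h i})"
      by (rule prod.reindex_bij_betw[OF h, symmetric])
    also have "\<dots> = (\<Prod>i\<in>I. h i ^ card (\<omega> \<inter> B i))"
      using sub by (intro prod.cong arg_cong[where f=card] arg_cong2[where f=power]) (auto simp: B_def)
    finally show ?thesis .
  qed
  have count: "(\<lambda>\<omega>. card (\<omega> \<inter> B i)) \<in> measurable P (count_space UNIV)" for i
    unfolding meas by (rule measurable_count) simp
  have "(\<integral>\<omega>. (\<Prod>x\<in>\<omega>. u x) \<partial>P) = (\<integral>\<omega>. (\<Prod>i\<in>I. h i ^ card (\<omega> \<inter> B i)) \<partial>P)"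
    using prod_eq by (intro Bochner_Integration.integral_cong) (auto simp: poisson_process_law_sets[OF P])
  also have "\<dots> = (\<Prod>i\<in>I. \<integral>\<omega>. h i ^ card (\<omega> \<inter> B i) \<partial>P)"
  proof (rule indep_vars_lebesgue_integral[OF I])
    have "indep_vars (\<lambda>_. count_space UNIV) (\<lambda>i \<omega>. card (\<omega> \<inter> B i)) I"
      by (rule poisson_process_law_indep[OF P I disj], simp) (auto simp: B_def)
    then show "indep_vars (\<lambda>_. borel) (\<lambda>i \<omega>. h i ^ card (\<omega> \<inter> B i)) I"
      by (rule indep_vars_compose2) simp
    show "integrable P (\<lambda>\<omega>. h i ^ card (\<omega> \<inter> B i))" if "i \<in> I" for i
    proof (rule integrable_const_bound[where B=1])
      show "(\<lambda>\<omega>. h i ^ card (\<omega> \<inter> B i)) \<in> borel_measurable P"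
        using measurable_compose[OF count, of "\<lambda>n. h i ^ n" borel i] by simp
    qed (use hh[OF that] in \<open>auto simp: power_le_one\<close>)
  qed
  also have "\<dots> = (\<Prod>i\<in>I. exp ((h i - 1) * measure lborel (B i)))"
  proof (rule prod.cong[OF refl])
    fix i assume i: "i \<in> I"
    have "(\<integral>\<^sup>+\<omega>. ennreal (h i ^ card (\<omega> \<inter> B i)) \<partial>P) = ennreal (exp ((h i - 1) * measure lborel (B i)))"
    proof (rule nn_integral_power_poisson[OF prob_space_axioms count _ hh(1)[OF i] measure_nonneg])
      show "measure P {\<omega> \<in> space P. card (\<omega> \<inter> B i) = k} =
          exp (- measure lborel (B i)) * measure lborel (B i) ^ k / fact k" for k
        by (rule poisson_process_law_count[OF P], simp) (auto simp: B_def)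
    qed
    then show "(\<integral>\<omega>. h i ^ card (\<omega> \<inter> B i) \<partial>P) = exp ((h i - 1) * measure lborel (B i))"
      using measurable_compose[OF count, of "\<lambda>n. h i ^ n" borel i] hh(1)[OF i]
      by (subst integral_eq_nn_integral) auto
  qed
  also have "\<dots> = exp (\<Sum>i\<in>I. (h i - 1) * measure lborel (B i))"
    using I by (simp add: exp_sum)
  also have "(\<Sum>i\<in>I. (h i - 1) * measure lborel (B i)) = (\<integral>x. u x - 1 \<partial>unit_leb)"
  proof -
    have B: "B i \<in> sets unit_leb" "measure unit_leb (B i) = measure lborel (B i)" for i
      using B_sub[of i] by (simp_all add: sets_restrict_space_iff measure_restrict_space)
    have "(\<integral>x. u x - 1 \<partial>unit_leb) = (\<integral>x. (\<Sum>i\<in>I. (h i - 1) * indicator (B i) x) \<partial>unit_leb)"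
    proof (rule Bochner_Integration.integral_cong[OF refl])
      fix x assume "x \<in> space unit_leb"
      then have x: "x \<in> {0..1}" by (simp add: space_unit_leb)
      obtain i where i: "i \<in> I" "h i = u x"
        using bij_betw_imp_surj_on[OF h] by (metis imageE rangeI)
      have "(\<Sum>i\<in>I. (h i - 1) * indicator (B i) x) = (\<Sum>j\<in>I. if j = i then h i - 1 else 0)"
        using i x bij_betw_imp_inj_on[OF h] by (intro sum.cong) (auto simp: B_def indicator_def inj_on_def)
      then show "u x - 1 = (\<Sum>i\<in>I. (h i - 1) * indicator (B i) x)"
        using i I by simp
    qed
    also have "\<dots> = (\<Sum>i\<in>I. (h i - 1) * measure lborel (B i))"
      using B B_sub by (subst Bochner_Integration.integral_sum) (auto simp: U.emeasure_eq_measure Int_absorb2)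
    finally show ?thesis ..
  qed
  also have "\<dots> = (\<integral>x. u x \<partial>unit_leb) - 1"
  proof -
    have "integrable unit_leb u"
      using u by (intro U.integrable_const_bound[where B=1] borel_measurable_unit_leb
        borel_measurable_simple_function) auto
    then show ?thesis by (simp add: U.prob_space[unfolded space_unit_leb])
  qed
  finally show ?thesis .
qed

section \<open>The process as a Poisson mixture of uniform samples\<close>

definition poisson_mixture :: "real set measure" where
  "poisson_mixture = measure_pmf (poisson_pmf 1) \<bind>
     (\<lambda>n. distr (unit_leb_power n) configuration_space (\<lambda>x. x ` {..<n}))"

lemma poisson_mixture_kernel:
  "(\<lambda>n. distr (unit_leb_power n) configuration_space (\<lambda>x. x ` {..<n}))
    \<in> measurable (measure_pmf (poisson_pmf 1)) (prob_algebra configuration_space)"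
  using prob_space.prob_space_distr[OF prob_space_unit_leb_power measurable_point_set]
  by (auto simp: space_prob_algebra)

lemma sets_poisson_mixture: "sets poisson_mixture = sets configuration_space"
  unfolding poisson_mixture_def by (rule sets_bind) auto

lemma prob_space_poisson_mixture: "prob_space poisson_mixture"
  unfolding poisson_mixture_def
  by (rule prob_space_bind'[OF _ poisson_mixture_kernel])
     (simp add: space_prob_algebra measure_pmf.prob_space_axioms)

lemma nn_integral_poisson_mixture:
  assumes f: "f \<in> borel_measurable configuration_space"
  shows "(\<integral>\<^sup>+\<omega>. f \<omega> \<partial>poisson_mixture) =
    (\<Sum>n. ennreal (exp (-1) / fact n) * (\<integral>\<^sup>+x. f (x ` {..<n}) \<partial>unit_leb_power n))"
proof -
  have "(\<integral>\<^sup>+\<omega>. f \<omega> \<partial>poisson_mixture) =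
      (\<integral>\<^sup>+n. \<integral>\<^sup>+\<omega>. f \<omega> \<partial>distr (unit_leb_power n) configuration_space (\<lambda>x. x ` {..<n}) \<partial>measure_pmf (poisson_pmf 1))"
    unfolding poisson_mixture_def
    by (rule nn_integral_bind[OF f measurable_prob_algebraD[OF poisson_mixture_kernel]])
  also have "\<dots> = (\<integral>\<^sup>+n. \<integral>\<^sup>+x. f (x ` {..<n}) \<partial>unit_leb_power n \<partial>measure_pmf (poisson_pmf 1))"
    by (simp add: nn_integral_distr[OF measurable_point_set] f)
  also have "\<dots> = (\<Sum>n. ennreal (exp (-1) / fact n) * (\<integral>\<^sup>+x. f (x ` {..<n}) \<partial>unit_leb_power n))"
    by (simp add: nn_integral_measure_pmf nn_integral_count_space_nat)
  finally show ?thesis .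
qed

lemma nn_integral_prod_unit_leb_power:
  assumes "u \<in> borel_measurable unit_leb"
  shows "(\<integral>\<^sup>+x. (\<Prod>y\<in>x ` {..<n}. u y) \<partial>unit_leb_power n) = (\<integral>\<^sup>+x. u x \<partial>unit_leb) ^ n"
proof -
  interpret product_sigma_finite "\<lambda>_. unit_leb" by (rule product_sigma_finite_unit_leb)
  have "(\<integral>\<^sup>+x. (\<Prod>y\<in>x ` {..<n}. u y) \<partial>unit_leb_power n) = (\<integral>\<^sup>+x. (\<Prod>i<n. u (x i)) \<partial>unit_leb_power n)"
    using AE_unit_leb_power_inj[of n]
    by (intro nn_integral_cong_AE) (auto elim!: eventually_mono simp: prod.reindex)
  also have "\<dots> = (\<integral>\<^sup>+x. u x \<partial>unit_leb) ^ n"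
    using assms by (subst product_nn_integral_prod) auto
  finally show ?thesis .
qed

text \<open>Given \<open>n\<close> points the expectation is the \<open>n\<close>-th power of the
  integral of \<open>u\<close>, and the Poisson weights sum these powers to the same exponential as
  for the process.\<close>

lemma poisson_mixture_generating:
  fixes u :: "real \<Rightarrow> real"
  assumes u: "u \<in> borel_measurable borel" "\<And>x. 0 \<le> u x" "\<And>x. u x \<le> 1"
    and meas: "(\<lambda>\<omega>. \<Prod>x\<in>\<omega>. u x) \<in> borel_measurable configuration_space"
  shows "(\<integral>\<omega>. (\<Prod>x\<in>\<omega>. u x) \<partial>poisson_mixture) = exp ((\<integral>x. u x \<partial>unit_leb) - 1)"
proof -
  interpret U: prob_space unit_leb by (rule prob_space_unit_leb)
  define a where "a = (\<integral>x. u x \<partial>unit_leb)"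
  have a0: "0 \<le> a" unfolding a_def by (rule Bochner_Integration.integral_nonneg_AE) (simp add: u)
  have "integrable unit_leb u"
    using u by (intro U.integrable_const_bound[where B=1] borel_measurable_unit_leb) auto
  then have a: "(\<integral>\<^sup>+x. ennreal (u x) \<partial>unit_leb) = ennreal a"
    unfolding a_def using u by (intro nn_integral_eq_integral) auto
  have "(\<integral>\<^sup>+\<omega>. ennreal (\<Prod>x\<in>\<omega>. u x) \<partial>poisson_mixture) =
      (\<Sum>n. ennreal (exp (-1) / fact n) * (\<integral>\<^sup>+x. ennreal (\<Prod>y\<in>x ` {..<n}. u y) \<partial>unit_leb_power n))"
    using meas by (intro nn_integral_poisson_mixture) auto
  also have "\<dots> = (\<Sum>n. ennreal (exp (-1) * (a ^ n /\<^sub>R fact n)))"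
  proof (intro suminf_cong)
    fix n
    have "(\<integral>\<^sup>+x. ennreal (\<Prod>y\<in>x ` {..<n}. u y) \<partial>unit_leb_power n) =
        (\<integral>\<^sup>+x. (\<Prod>y\<in>x ` {..<n}. ennreal (u y)) \<partial>unit_leb_power n)"
      using u by (simp add: prod_ennreal)
    also have "\<dots> = ennreal (a ^ n)"
      using borel_measurable_unit_leb[OF u(1)] a0
      by (subst nn_integral_prod_unit_leb_power) (auto simp: a ennreal_power)
    finally show "ennreal (exp (-1) / fact n) * (\<integral>\<^sup>+x. ennreal (\<Prod>y\<in>x ` {..<n}. u y) \<partial>unit_leb_power n) =
        ennreal (exp (-1) * (a ^ n /\<^sub>R fact n))"
      using a0 by (simp add: ennreal_mult[symmetric] field_simps)
  qed
  also have "\<dots> = ennreal (exp (-1) * exp a)"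
    by (rule suminf_ennreal_eq[OF _ sums_mult[OF exp_converges]]) (use a0 in auto)
  also have "exp (-1) * exp a = exp (a - 1)"
    by (simp add: exp_add[symmetric])
  finally have "(\<integral>\<^sup>+\<omega>. ennreal (\<Prod>x\<in>\<omega>. u x) \<partial>poisson_mixture) = ennreal (exp (a - 1))" .
  moreover have "(\<lambda>\<omega>. \<Prod>x\<in>\<omega>. u x) \<in> borel_measurable poisson_mixture"
    using meas measurable_cong_sets[OF sets_poisson_mixture refl] by blast
  ultimately show ?thesis
    using u by (subst integral_eq_nn_integral) (auto simp: a_def intro!: prod_nonneg)
qed

section \<open>Measurable enumeration of the points of a configuration\<close>

lemma sorted_nth_le_iff:
  fixes t :: "'a::linorder"
  assumes "sorted xs" "distinct xs" "i < length xs"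
  shows "xs ! i \<le> t \<longleftrightarrow> i < card (set xs \<inter> {..t})"
proof
  assume le: "xs ! i \<le> t"
  have "(!) xs ` {..i} \<subseteq> set xs \<inter> {..t}"
    using le assms by (auto simp: intro: order_trans[OF sorted_nth_mono])
  then have "card ((!) xs ` {..i}) \<le> card (set xs \<inter> {..t})"
    by (intro card_mono) auto
  moreover have "card ((!) xs ` {..i}) = Suc i"
    using assms by (subst card_image) (auto simp: inj_on_def nth_eq_iff_index_eq)
  ultimately show "i < card (set xs \<inter> {..t})" by simp
next
  assume less: "i < card (set xs \<inter> {..t})"
  show "xs ! i \<le> t"
  proof (rule ccontr)
    assume "\<not> xs ! i \<le> t"
    then have "set xs \<inter> {..t} \<subseteq> (!) xs ` {..<i}"
      using assms(1) by (auto simp: in_set_conv_nth image_iff not_le)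
        (metis lessThan_iff not_le_imp_less order.strict_trans1 sorted_nth_mono leD order_trans)
    then have "card (set xs \<inter> {..t}) \<le> card ((!) xs ` {..<i})"
      by (intro card_mono) auto
    also have "\<dots> \<le> i" using card_image_le[of "{..<i}" "(!) xs"] by simp
    finally show False using less by simp
  qed
qed

text \<open>The points in increasing order. The choice of the order does not matter, as the
  enumeration enters only permutation invariant expressions. The default 0 keeps the values in the
  unit interval off the \<open>n\<close>-point configurations, and the restriction makes them points
  of the product space.\<close>

definition config_coord :: "nat \<Rightarrow> real set \<Rightarrow> nat \<Rightarrow> real" where
  "config_coord n \<omega> = (\<lambda>i\<in>{..<n}. if card \<omega> = n then sorted_list_of_set \<omega> ! i else 0)"

lemma config_coord_bij:
  assumes "\<omega> \<in> configurations" "card \<omega> = n"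
  shows "bij_betw (config_coord n \<omega>) {..<n} \<omega>"
proof -
  have "bij_betw ((!) (sorted_list_of_set \<omega>)) {..<n} \<omega>"
    using assms by (intro bij_betw_nth) (auto simp: finite_configuration)
  then show ?thesis
    by (rule bij_betw_cong[THEN iffD1, rotated]) (use assms in \<open>auto simp: config_coord_def\<close>)
qed

lemma config_coord_image:
  "\<omega> \<in> configurations \<Longrightarrow> card \<omega> = n \<Longrightarrow> config_coord n \<omega> ` {..<n} = \<omega>"
  by (rule bij_betw_imp_surj_on[OF config_coord_bij])

text \<open>Counting from zero, the \<open>i\<close>-th smallest point is at most \<open>a\<close>
  exactly if more than \<open>i\<close> points lie in \<open>{..a}\<close>. Order statistics thus
  reduce to the counts that generate the sigma-algebra.\<close>

lemma measurable_config_coord: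
  "config_coord n \<in> measurable configuration_space (unit_leb_power n)"
  unfolding config_coord_def
proof (rule measurable_restrict)
  fix i assume "i \<in> {..<n}"
  then have i: "i < n" by simp
  let ?f = "\<lambda>\<omega>. if card \<omega> = n then sorted_list_of_set \<omega> ! i else 0"
  note [measurable] = measurable_card measurable_count
  show "?f \<in> measurable configuration_space unit_leb"
  proof (rule measurable_restrict_space2)
    show "?f \<in> space configuration_space \<rightarrow> {0..1}"
    proof
      fix \<omega> assume "\<omega> \<in> space configuration_space"
      then have \<omega>: "\<omega> \<in> configurations" by (simp add: space_configuration_space)
      have "sorted_list_of_set \<omega> ! i \<in> \<omega>" if "card \<omega> = n"
        using nth_mem[of i "sorted_list_of_set \<omega>"] i that finite_configuration[OF \<omega>] by simp
      then show "?f \<omega> \<in> {0..1}" using \<omega> by (auto simp: configurations_def)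
    qed
    have "?f \<in> borel_measurable configuration_space"
      unfolding borel_measurable_iff_le
    proof
      fix a :: real
      have "{\<omega> \<in> space configuration_space. ?f \<omega> \<le> a} =
        {\<omega> \<in> space configuration_space. if card \<omega> = n then i < card (\<omega> \<inter> {..a}) else 0 \<le> a}"
        using i sorted_nth_le_iff[of "sorted_list_of_set \<omega>" i a for \<omega>]
        by (auto simp: space_configuration_space finite_configuration)
      also have "\<dots> \<in> sets configuration_space" by measurable
      finally show "{\<omega> \<in> space configuration_space. ?f \<omega> \<le> a} \<in> sets configuration_space" .
    qed
    then show "?f \<in> measurable configuration_space lborel" by simp
  qed
qed

lemma borel_measurable_prod_configuration:
  fixes u :: "real \<Rightarrow> real"
  assumes u: "u \<in> borel_measurable unit_leb"
  shows "(\<lambda>\<omega>. \<Prod>x\<in>\<omega>. u x) \<in> borel_measurable configuration_space"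
proof -
  note [measurable] = measurable_card u
  have [measurable]: "(\<lambda>\<omega>. config_coord n \<omega> i) \<in> measurable configuration_space unit_leb" if "i < n" for i n
    using measurable_compose[OF measurable_config_coord[of n] measurable_component_singleton[of i]] that by simp
  \<comment> \<open>A series with one nonzero term, so that the number of factors is fixed in each
    term and does not depend on \<omega>.\<close>
  have eq: "(\<Prod>x\<in>\<omega>. u x) = (\<Sum>n. of_bool (card \<omega> = n) * (\<Prod>i<n. u (config_coord n \<omega> i)))"
    if "\<omega> \<in> configurations" for \<omega>
  proof -
    have "(\<Sum>n. of_bool (card \<omega> = n) * (\<Prod>i<n. u (config_coord n \<omega> i))) =
        (\<Sum>n\<in>{card \<omega>}. of_bool (card \<omega> = n) * (\<Prod>i<n. u (config_coord n \<omega> i)))"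
      by (rule suminf_finite) auto
    also have "\<dots> = (\<Prod>x\<in>\<omega>. u x)"
      using prod.reindex_bij_betw[OF config_coord_bij[OF that refl]] by simp
    finally show ?thesis ..
  qed
  have "(\<lambda>\<omega>. \<Sum>n. of_bool (card \<omega> = n) * (\<Prod>i<n. u (config_coord n \<omega> i))) \<in> borel_measurable configuration_space"
    by measurable
  then show ?thesis
    by (subst measurable_cong[OF eq]) (simp add: space_configuration_space)
qed

lemma (in finite_measure) tendsto_integral_bounded:
  fixes f :: "nat \<Rightarrow> 'a \<Rightarrow> real"
  assumes "\<And>i. f i \<in> borel_measurable M" "g \<in> borel_measurable M"
    and "\<And>i x. x \<in> space M \<Longrightarrow> \<bar>f i x\<bar> \<le> C" "\<And>x. x \<in> space M \<Longrightarrow> (\<lambda>i. f i x) \<longlonglongrightarrow> g x"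
  shows "(\<lambda>i. \<integral>x. f i x \<partial>M) \<longlonglongrightarrow> (\<integral>x. g x \<partial>M)"
  by (rule integral_dominated_convergence[where w="\<lambda>_. C"]) (use assms in auto)

lemma abs_lincomb_le:
  fixes x y :: real
  assumes "\<bar>x\<bar> \<le> C" "\<bar>y\<bar> \<le> D"
  shows "\<bar>a * x + b * y\<bar> \<le> \<bar>a\<bar> * C + \<bar>b\<bar> * D"
  using abs_triangle_ineq[of "a * x" "b * y"] mult_left_mono[OF assms(1) abs_ge_zero[of a]]
    mult_left_mono[OF assms(2) abs_ge_zero[of b]]
  by (simp add: abs_mult)

text \<open>Both laws give the same expectation to every multiplicative functional of a step
  function, and these functionals determine a law on configurations. The axiomatic description of
  the process thereby becomes an explicit integration formula.\<close>

lemma poisson_process_eq_mixture: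
  assumes P: "poisson_process_law P"
  shows "P = poisson_mixture"
proof -
  interpret P: prob_space P using P by (rule poisson_process_law_sets)
  interpret Q: prob_space poisson_mixture by (rule prob_space_poisson_mixture)
  note sets = poisson_process_law_sets(1)[OF P] sets_poisson_mixture
  note spaces = sets[THEN sets_eq_imp_space_eq, unfolded space_configuration_space]
  have meas: "f \<in> borel_measurable P" "f \<in> borel_measurable poisson_mixture"
    if "f \<in> borel_measurable configuration_space" for f :: "real set \<Rightarrow> real"
    using that sets[THEN measurable_cong_sets, OF refl] by auto
  \<comment> \<open>Boundedness is included so that linear combinations are integrable under both
    laws.\<close>
  define V where "V f \<longleftrightarrow> f \<in> borel_measurable configuration_space \<and>
    (\<exists>C. \<forall>\<omega>\<in>configurations. \<bar>f \<omega>\<bar> \<le> C) \<and> (\<integral>\<omega>. f \<omega> \<partial>P) = (\<integral>\<omega>. f \<omega> \<partial>poisson_mixture)"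
    for f :: "real set \<Rightarrow> real"
  have "V (indicat_real A)" if "A \<in> sets configuration_space" for A
  proof (rule configuration_monotone_class[OF _ _ _ that])
    fix f g and a b :: real assume "V f" "V g"
    then obtain C D where f: "f \<in> borel_measurable configuration_space" "\<And>\<omega>. \<omega> \<in> configurations \<Longrightarrow> \<bar>f \<omega>\<bar> \<le> C"
      and g: "g \<in> borel_measurable configuration_space" "\<And>\<omega>. \<omega> \<in> configurations \<Longrightarrow> \<bar>g \<omega>\<bar> \<le> D"
      and eq: "(\<integral>\<omega>. f \<omega> \<partial>P) = (\<integral>\<omega>. f \<omega> \<partial>poisson_mixture)" "(\<integral>\<omega>. g \<omega> \<partial>P) = (\<integral>\<omega>. g \<omega> \<partial>poisson_mixture)"
      unfolding V_def by blast
    have "integrable P f" "integrable poisson_mixture f"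
      using f meas[OF f(1)] by (auto intro!: P.integrable_const_bound[where B=C] Q.integrable_const_bound[where B=C] simp: spaces)
    moreover have "integrable P g" "integrable poisson_mixture g"
      using g meas[OF g(1)] by (auto intro!: P.integrable_const_bound[where B=D] Q.integrable_const_bound[where B=D] simp: spaces)
    moreover have "\<forall>\<omega>\<in>configurations. \<bar>a * f \<omega> + b * g \<omega>\<bar> \<le> \<bar>a\<bar> * C + \<bar>b\<bar> * D"
      using f(2) g(2) by (auto intro!: abs_lincomb_le)
    ultimately show "V (\<lambda>\<omega>. a * f \<omega> + b * g \<omega>)"
      unfolding V_def using eq f(1) g(1) by auto
  next
    fix f :: "nat \<Rightarrow> real set \<Rightarrow> real" and g C
    assume V: "\<And>i. V (f i)" and C: "\<And>i \<omega>. \<omega> \<in> configurations \<Longrightarrow> \<bar>f i \<omega>\<bar> \<le> C"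
      and lim: "\<And>\<omega>. \<omega> \<in> configurations \<Longrightarrow> (\<lambda>i. f i \<omega>) \<longlonglongrightarrow> g \<omega>"
    have f: "f i \<in> borel_measurable configuration_space" for i
      using V by (simp add: V_def)
    have g: "g \<in> borel_measurable configuration_space"
      by (rule borel_measurable_LIMSEQ_real[where u=f]) (auto simp: space_configuration_space lim f)
    have "(\<lambda>i. \<integral>\<omega>. f i \<omega> \<partial>P) \<longlonglongrightarrow> (\<integral>\<omega>. g \<omega> \<partial>P)"
      by (rule P.tendsto_integral_bounded[OF meas(1)[OF f] meas(1)[OF g], where C=C]) (simp_all add: C lim spaces)
    moreover have "(\<lambda>i. \<integral>\<omega>. f i \<omega> \<partial>poisson_mixture) \<longlonglongrightarrow> (\<integral>\<omega>. g \<omega> \<partial>poisson_mixture)"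
      by (rule Q.tendsto_integral_bounded[OF meas(2)[OF f] meas(2)[OF g], where C=C]) (simp_all add: C lim spaces)
    moreover have "(\<integral>\<omega>. f i \<omega> \<partial>P) = (\<integral>\<omega>. f i \<omega> \<partial>poisson_mixture)" for i
      using V[of i] by (simp add: V_def)
    ultimately have "(\<integral>\<omega>. g \<omega> \<partial>P) = (\<integral>\<omega>. g \<omega> \<partial>poisson_mixture)"
      using LIMSEQ_unique by simp
    moreover have "\<bar>g \<omega>\<bar> \<le> C" if "\<omega> \<in> configurations" for \<omega>
      by (rule LIMSEQ_le_const2[OF tendsto_rabs[OF lim[OF that]]]) (use C that in auto)
    ultimately show "V g" using g unfolding V_def by blast
  next
    fix u :: "real \<Rightarrow> real"
    assume u: "simple_function borel u" "\<And>x. 0 \<le> u x" "\<And>x. u x \<le> 1"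
    then have ub: "u \<in> borel_measurable borel" by (intro borel_measurable_simple_function)
    have m: "(\<lambda>\<omega>. \<Prod>x\<in>\<omega>. u x) \<in> borel_measurable configuration_space"
      by (intro borel_measurable_prod_configuration borel_measurable_unit_leb ub)
    have "\<forall>\<omega>\<in>configurations. \<bar>\<Prod>x\<in>\<omega>. u x\<bar> \<le> 1"
      using u by (auto simp: abs_prod intro!: prod_le_1)
    then show "V (\<lambda>\<omega>. \<Prod>x\<in>\<omega>. u x)"
      unfolding V_def using m poisson_process_generating[OF P u] poisson_mixture_generating[OF ub u(2,3) m]
      by auto
  qed
  then have "measure P A = measure poisson_mixture A" if "A \<in> sets P" for A
    using that sets by (auto simp: V_def P.emeasure_eq_measure Q.emeasure_eq_measure)
  then show ?thesis
    by (intro measure_eqI) (auto simp: sets P.emeasure_eq_measure Q.emeasure_eq_measure)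
qed

section \<open>Functionals of n-point configurations\<close>

lemma nn_integral_poisson_process:
  assumes "poisson_process_law P" "f \<in> borel_measurable configuration_space"
  shows "(\<integral>\<^sup>+\<omega>. f \<omega> \<partial>P) =
    (\<Sum>n. ennreal (exp (-1) / fact n) * (\<integral>\<^sup>+x. f (x ` {..<n}) \<partial>unit_leb_power n))"
  using nn_integral_poisson_mixture[OF assms(2)] by (simp add: poisson_process_eq_mixture[OF assms(1)])

text \<open>Coordinates in the \<open>m\<close>-cube are almost surely distinct, so a sample of
  \<open>m\<close> coordinates has exactly \<open>m\<close> points and the terms with
  \<open>m \<noteq> n\<close> vanish.\<close>

lemma nn_integral_poisson_process_n:
  assumes P: "poisson_process_law P" and f: "f \<in> borel_measurable configuration_space"
    and supp: "\<And>\<omega>. card \<omega> \<noteq> n \<Longrightarrow> f \<omega> = 0"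
  shows "(\<integral>\<^sup>+\<omega>. f \<omega> \<partial>P) = ennreal (exp (-1) / fact n) * (\<integral>\<^sup>+x. f (x ` {..<n}) \<partial>unit_leb_power n)"
proof -
  have "(\<integral>\<^sup>+x. f (x ` {..<m}) \<partial>unit_leb_power m) = 0" if "m \<noteq> n" for m
  proof -
    have "AE x in unit_leb_power m. f (x ` {..<m}) = 0"
      using AE_unit_leb_power_inj[of m] by eventually_elim (auto intro!: supp simp: card_image that not_sym[OF that])
    then have "(\<integral>\<^sup>+x. f (x ` {..<m}) \<partial>unit_leb_power m) = (\<integral>\<^sup>+x. 0 \<partial>unit_leb_power m)"
      by (intro nn_integral_cong_AE)
    then show ?thesis by simp
  qed
  then show ?thesis
    unfolding nn_integral_poisson_process[OF P f]
    by (subst suminf_finite[of "{n}"]) auto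
qed

lemma integral_poisson_process_n:
  fixes f :: "real set \<Rightarrow> real"
  assumes P: "poisson_process_law P" and f: "integrable P f"
    and supp: "\<And>\<omega>. card \<omega> \<noteq> n \<Longrightarrow> f \<omega> = 0"
    and int: "integrable (unit_leb_power n) (\<lambda>x. f (x ` {..<n}))"
  shows "(\<integral>\<omega>. f \<omega> \<partial>P) = exp (-1) / fact n * (\<integral>x. f (x ` {..<n}) \<partial>unit_leb_power n)"
proof -
  have [measurable]: "f \<in> borel_measurable configuration_space"
    using f measurable_cong_sets[OF poisson_process_law_sets(1)[OF P] refl] by blast
  have "(\<integral>\<omega>. f \<omega> \<partial>P) = enn2real (\<integral>\<^sup>+\<omega>. ennreal (f \<omega>) \<partial>P) - enn2real (\<integral>\<^sup>+\<omega>. ennreal (- f \<omega>) \<partial>P)"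
    by (rule real_lebesgue_integral_def[OF f])
  also have "\<dots> = exp (-1) / fact n * enn2real (\<integral>\<^sup>+x. ennreal (f (x ` {..<n})) \<partial>unit_leb_power n) -
      exp (-1) / fact n * enn2real (\<integral>\<^sup>+x. ennreal (- f (x ` {..<n})) \<partial>unit_leb_power n)"
    using supp by (subst (1 2) nn_integral_poisson_process_n[OF P, where n=n]) (auto simp: enn2real_mult)
  also have "\<dots> = exp (-1) / fact n * (\<integral>x. f (x ` {..<n}) \<partial>unit_leb_power n)"
    by (simp add: real_lebesgue_integral_def[OF int] right_diff_distrib)
  finally show ?thesis .
qed

text \<open>The squared norm of \<open>F\<close> is a finite series of nonnegative terms, and the
  weight \<open>exp (-1) / fact n\<close> of each term is positive.\<close>

lemma square_integrable_npoint:
  assumes P: "poisson_process_law P" and F: "square_integrable P F"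
  shows "square_integrable (unit_leb_power n) (npoint F n)"
proof -
  have [measurable]: "F \<in> borel_measurable configuration_space"
    using square_integrable_measurable[OF F]
      measurable_cong_sets[OF poisson_process_law_sets(1)[OF P] refl] by blast
  have m: "npoint F n \<in> borel_measurable (unit_leb_power n)"
    unfolding npoint_def by (rule measurable_compose[OF measurable_point_set]) simp
  have "(\<integral>\<^sup>+\<omega>. ennreal ((norm (F \<omega>))\<^sup>2) \<partial>P) < \<infinity>"
    using square_integrable_integrable[OF F] by (simp add: integrable_iff_bounded)
  then have "(\<Sum>n. ennreal (exp (-1) / fact n) * (\<integral>\<^sup>+x. ennreal ((norm (F (x ` {..<n})))\<^sup>2) \<partial>unit_leb_power n)) < \<infinity>"
    by (subst (asm) nn_integral_poisson_process[OF P]) auto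
  then have "ennreal (exp (-1) / fact n) * (\<integral>\<^sup>+x. ennreal ((norm (F (x ` {..<n})))\<^sup>2) \<partial>unit_leb_power n) < \<infinity>"
    using ennreal_suminf_lessD by blast
  then have "(\<integral>\<^sup>+x. ennreal ((norm (npoint F n x))\<^sup>2) \<partial>unit_leb_power n) < \<infinity>"
    by (auto simp: ennreal_mult_less_top npoint_def)
  then show ?thesis
    unfolding square_integrable_def using m by (auto simp: integrable_iff_bounded)
qed

section \<open>Permutations of coordinates and symmetrization\<close>

lemma space_unit_leb_power_perm:
  "p permutes {..<n} \<Longrightarrow> x \<in> space (unit_leb_power n) \<Longrightarrow> (\<lambda>i\<in>{..<n}. x (p i)) = x \<circ> p"
  by (auto simp: space_unit_leb_power fun_eq_iff PiE_def extensional_def permutes_in_image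
    restrict_def permutes_not_in)

lemma distr_unit_leb_power_perm:
  assumes p: "p permutes {..<n}"
  shows "distr (unit_leb_power n) (unit_leb_power n) (\<lambda>x. x \<circ> p) = unit_leb_power n"
proof -
  have "distr (unit_leb_power n) (unit_leb_power n) (\<lambda>x. \<lambda>i\<in>{..<n}. x (p i)) = unit_leb_power n"
    by (rule distr_PiM_reindex[of "{..<n}" "\<lambda>_. unit_leb" p "{..<n}"])
      (use p permutes_in_image[OF p] in \<open>auto simp: prob_space_unit_leb permutes_inj_on\<close>)
  \<comment> \<open>Points of the cube are \<open>undefined\<close> off \<open>{..<n}\<close>, where
    \<open>p\<close> is the identity, so composition with \<open>p\<close> agrees with restricted
    reindexing.\<close>
  then show ?thesis
    using space_unit_leb_power_perm[OF p] by (subst (asm) distr_cong[OF refl refl]) auto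
qed

lemma measurable_perm:
  assumes p: "p permutes {..<n}"
  shows "(\<lambda>x. x \<circ> p) \<in> measurable (unit_leb_power n) (unit_leb_power n)"
proof -
  have "(\<lambda>x. \<lambda>i\<in>{..<n}. x (p i)) \<in> measurable (unit_leb_power n) (unit_leb_power n)"
    by (intro measurable_restrict measurable_component_singleton)
      (use permutes_in_image[OF p] in auto)
  then show ?thesis
    using space_unit_leb_power_perm[OF p] by (subst (asm) measurable_cong) auto
qed

lemma
  fixes f :: "(nat \<Rightarrow> real) \<Rightarrow> complex"
  assumes p: "p permutes {..<n}" and f: "square_integrable (unit_leb_power n) f"
  shows square_integrable_perm: "square_integrable (unit_leb_power n) (\<lambda>x. f (x \<circ> p))"
    and l2norm_perm: "l2norm (unit_leb_power n) (\<lambda>x. f (x \<circ> p)) = l2norm (unit_leb_power n) f"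
proof -
  have [measurable]: "f \<in> borel_measurable (unit_leb_power n)"
    using f by (rule square_integrable_measurable)
  note [measurable] = measurable_perm[OF p]
  show "square_integrable (unit_leb_power n) (\<lambda>x. f (x \<circ> p))"
    unfolding square_integrable_def
  proof
    show "integrable (unit_leb_power n) (\<lambda>x. (norm (f (x \<circ> p)))\<^sup>2)"
      by (rule integrable_distr[OF measurable_perm[OF p]])
        (use f in \<open>simp add: distr_unit_leb_power_perm[OF p] square_integrable_def\<close>)
  qed measurable
  have "(\<integral>x. (norm (f x))\<^sup>2 \<partial>unit_leb_power n) =
      (\<integral>x. (norm (f x))\<^sup>2 \<partial>distr (unit_leb_power n) (unit_leb_power n) (\<lambda>x. x \<circ> p))"
    by (simp add: distr_unit_leb_power_perm[OF p])
  also have "\<dots> = (\<integral>x. (norm (f (x \<circ> p)))\<^sup>2 \<partial>unit_leb_power n)"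
    by (rule integral_distr) auto
  finally show "l2norm (unit_leb_power n) (\<lambda>x. f (x \<circ> p)) = l2norm (unit_leb_power n) f"
    by (simp add: l2norm_def)
qed

text \<open>A sum over permutations and not an average, so that its \<open>fact n\<close> terms
  cancel the factorial in the Poisson weight. Evaluating \<open>f\<close> along
  \<open>config_coord\<close> produces a function of the point set.\<close>

definition symmetrize :: "nat \<Rightarrow> ((nat \<Rightarrow> real) \<Rightarrow> 'a::comm_monoid_add) \<Rightarrow> real set \<Rightarrow> 'a" where
  "symmetrize n f \<omega> = (if card \<omega> = n then \<Sum>p | p permutes {..<n}. f (config_coord n \<omega> \<circ> p) else 0)"

lemma config_coord_point_set:
  assumes x: "x \<in> space (unit_leb_power n)" and inj: "inj_on x {..<n}"
  obtains p where "p permutes {..<n}" "config_coord n (x ` {..<n}) = x \<circ> p"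
proof
  define \<omega> where "\<omega> = x ` {..<n}"
  have "\<omega> \<in> configurations" "card \<omega> = n"
    using x inj by (auto simp: \<omega>_def configurations_def space_unit_leb_power card_image)
  then have 1: "bij_betw (config_coord n \<omega>) {..<n} \<omega>"
    by (rule config_coord_bij)
  have 2: "bij_betw x {..<n} \<omega>" using inj by (simp add: \<omega>_def bij_betw_def)
  \<comment> \<open>The index at which the \<open>i\<close>-th smallest point occurs in
    \<open>x\<close>; the identity elsewhere, as \<open>permutes\<close> demands.\<close>
  define p where "p i = (if i < n then the_inv_into {..<n} x (config_coord n \<omega> i) else i)" for i
  have "bij_betw (the_inv_into {..<n} x \<circ> config_coord n \<omega>) {..<n} {..<n}"
    by (rule bij_betw_trans[OF 1 bij_betw_the_inv_into[OF 2]])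
  then have "bij_betw p {..<n} {..<n}"
    by (rule bij_betw_cong[THEN iffD1, rotated]) (auto simp: p_def)
  then show "p permutes {..<n}"
    by (rule bij_imp_permutes) (auto simp: p_def)
  show "config_coord n (x ` {..<n}) = x \<circ> p"
  proof
    fix i
    show "config_coord n (x ` {..<n}) i = (x \<circ> p) i"
    proof (cases "i < n")
      case True
      then have "config_coord n \<omega> i \<in> x ` {..<n}"
        using bij_betwE[OF 1] by (auto simp: \<omega>_def)
      then show ?thesis
        using True inj by (simp add: p_def f_the_inv_into_f \<omega>_def)
    next
      case False
      then show ?thesis
        using x by (auto simp: p_def config_coord_def space_unit_leb_power PiE_def extensional_def)
    qed
  qed
qed

text \<open>Sorting \<open>x\<close> composes it with some permutation \<open>q\<close>, which the
  sum over all permutations absorbs.\<close>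

lemma symmetrize_point_set:
  assumes x: "x \<in> space (unit_leb_power n)" and inj: "inj_on x {..<n}"
  shows "symmetrize n f (x ` {..<n}) = (\<Sum>p | p permutes {..<n}. f (x \<circ> p))"
proof -
  obtain q where q: "q permutes {..<n}" "config_coord n (x ` {..<n}) = x \<circ> q"
    using config_coord_point_set[OF assms] .
  have "symmetrize n f (x ` {..<n}) = (\<Sum>p | p permutes {..<n}. f (x \<circ> (q \<circ> p)))"
    using inj by (simp add: symmetrize_def card_image q(2) comp_assoc)
  also have "\<dots> = (\<Sum>p | p permutes {..<n}. f (x \<circ> p))"
    by (rule setum_permutations_compose_left[OF q(1), symmetric])
  finally show ?thesis .
qed

lemma symmetrize_perm:
  assumes q: "q permutes {..<n}"
  shows "symmetrize n (\<lambda>x. f (x \<circ> q)) = symmetrize n f"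
proof
  fix \<omega>
  have "(\<Sum>p | p permutes {..<n}. f (config_coord n \<omega> \<circ> p)) =
      (\<Sum>p | p permutes {..<n}. f (config_coord n \<omega> \<circ> (p \<circ> q)))"
    by (rule sum_permutations_compose_right[OF q])
  then show "symmetrize n (\<lambda>x. f (x \<circ> q)) \<omega> = symmetrize n f \<omega>"
    by (simp add: symmetrize_def comp_assoc)
qed

lemma symmetrize_lincomb:
  fixes f g :: "(nat \<Rightarrow> real) \<Rightarrow> 'a::comm_ring_1"
  shows "symmetrize n (\<lambda>x. a * f x + b * g x) \<omega> = a * symmetrize n f \<omega> + b * symmetrize n g \<omega>"
  by (simp add: symmetrize_def sum.distrib sum_distrib_left)

lemma symmetrize_of_real:
  "symmetrize n (\<lambda>x. complex_of_real (f x)) \<omega> = complex_of_real (symmetrize n f \<omega>)"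
  by (simp add: symmetrize_def)

lemma symmetrize_npoint:
  assumes "\<omega> \<in> configurations"
  shows "symmetrize n (npoint F n) \<omega> = (if card \<omega> = n then fact n * F \<omega> else 0)"
proof -
  have "(config_coord n \<omega> \<circ> p) ` {..<n} = \<omega>" if "p permutes {..<n}" "card \<omega> = n" for p
    unfolding image_comp[symmetric] permutes_image[OF that(1)]
    by (rule config_coord_image[OF assms that(2)])
  then show ?thesis
    by (simp add: symmetrize_def npoint_def card_permutations[of "{..<n}" n])
qed

lemma npoint_symmetrize:
  assumes "x \<in> space (unit_leb_power m)" "inj_on x {..<m}"
  shows "npoint (symmetrize n f) m x = (if m = n then \<Sum>p | p permutes {..<n}. f (x \<circ> p) else 0)"
proof (cases "m = n")
  case True
  then show ?thesis using symmetrize_point_set[of x n f] assms by (simp add: npoint_def)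
next
  case False
  then show ?thesis using assms by (simp add: npoint_def symmetrize_def card_image)
qed

lemma borel_measurable_symmetrize:
  fixes f :: "(nat \<Rightarrow> real) \<Rightarrow> 'a::{real_normed_vector,second_countable_topology}"
  assumes "f \<in> borel_measurable (unit_leb_power n)"
  shows "symmetrize n f \<in> borel_measurable configuration_space"
proof -
  note [measurable] = measurable_card
  have "(\<lambda>\<omega>. f (config_coord n \<omega> \<circ> p)) \<in> borel_measurable configuration_space" if "p permutes {..<n}" for p
    by (rule measurable_compose[OF measurable_config_coord measurable_compose[OF measurable_perm[OF that] assms]])
  then have "(\<lambda>\<omega>. \<Sum>p | p permutes {..<n}. f (config_coord n \<omega> \<circ> p)) \<in> borel_measurable configuration_space"
    by (intro borel_measurable_sum) auto
  then show ?thesis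
    unfolding symmetrize_def[abs_def] by measurable
qed

lemma l2norm_sq_sum_le:
  fixes f :: "'i \<Rightarrow> 'a \<Rightarrow> complex"
  assumes "\<And>i. i \<in> I \<Longrightarrow> square_integrable M (f i)" "\<And>i. i \<in> I \<Longrightarrow> l2norm M (f i) \<le> c"
  shows "(l2norm M (\<lambda>x. \<Sum>i\<in>I. f i x))\<^sup>2 \<le> real (card I) ^ 2 * c\<^sup>2"
proof (cases "finite I")
  case True
  have "(\<integral>x. (norm (\<Sum>i\<in>I. f i x))\<^sup>2 \<partial>M) \<le> (\<integral>x. real (card I) * (\<Sum>i\<in>I. (norm (f i x))\<^sup>2) \<partial>M)"
  proof (rule integral_mono)
    show "integrable M (\<lambda>x. (norm (\<Sum>i\<in>I. f i x))\<^sup>2)"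
      by (intro square_integrable_integrable square_integrable_sum assms)
    show "integrable M (\<lambda>x. real (card I) * (\<Sum>i\<in>I. (norm (f i x))\<^sup>2))"
      using assms(1) by (intro integrable_mult_right Bochner_Integration.integrable_sum square_integrable_integrable)
    fix x
    have "(norm (\<Sum>i\<in>I. f i x))\<^sup>2 \<le> (\<Sum>i\<in>I. 1 * norm (f i x))\<^sup>2"
      using norm_sum[of "\<lambda>i. f i x" I] by (intro power_mono) auto
    also have "\<dots> \<le> (\<Sum>i\<in>I. 1\<^sup>2) * (\<Sum>i\<in>I. (norm (f i x))\<^sup>2)"
      by (rule Cauchy_Schwarz_ineq_sum)
    finally show "(norm (\<Sum>i\<in>I. f i x))\<^sup>2 \<le> real (card I) * (\<Sum>i\<in>I. (norm (f i x))\<^sup>2)" by simp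
  qed
  also have "\<dots> = real (card I) * (\<Sum>i\<in>I. (l2norm M (f i))\<^sup>2)"
    using assms(1) by (simp add: l2norm_sq square_integrable_integrable)
  also have "\<dots> \<le> real (card I) * (\<Sum>i\<in>I. c\<^sup>2)"
    using assms(2) by (intro mult_left_mono sum_mono power_mono) (auto simp: l2norm_nonneg)
  finally show ?thesis unfolding l2norm_sq by (simp add: power2_eq_square ac_simps)
qed (simp add: l2norm_def)

text \<open>Each of the \<open>fact n\<close> rearrangements of \<open>f\<close> has the norm of
  \<open>f\<close>, and the Poisson weight is at most 1. Continuity asks for no better
  constant.\<close>

lemma
  fixes f :: "(nat \<Rightarrow> real) \<Rightarrow> complex"
  assumes P: "poisson_process_law P" and f: "square_integrable (unit_leb_power n) f"
  shows square_integrable_symmetrize: "square_integrable P (symmetrize n f)"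
    and l2norm_symmetrize_le: "l2norm P (symmetrize n f) \<le> fact n * l2norm (unit_leb_power n) f"
proof -
  let ?S = "\<lambda>x. \<Sum>p | p permutes {..<n}. f (x \<circ> p)"
  let ?l = "l2norm (unit_leb_power n) f"
  have S: "square_integrable (unit_leb_power n) ?S"
    using f by (intro square_integrable_sum square_integrable_perm) auto
  have l: "(l2norm (unit_leb_power n) ?S)\<^sup>2 \<le> (fact n * ?l)\<^sup>2"
    using l2norm_sq_sum_le[of "{p. p permutes {..<n}}" "unit_leb_power n" "\<lambda>p x. f (x \<circ> p)" ?l] f
    by (simp add: square_integrable_perm l2norm_perm card_permutations[of "{..<n}" n] power_mult_distrib)
  have m0 [measurable]: "symmetrize n f \<in> borel_measurable configuration_space"
    by (intro borel_measurable_symmetrize square_integrable_measurable f)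
  then have m: "symmetrize n f \<in> borel_measurable P"
    using measurable_cong_sets[OF poisson_process_law_sets(1)[OF P] refl] by blast
  have "(\<integral>\<^sup>+\<omega>. ennreal ((norm (symmetrize n f \<omega>))\<^sup>2) \<partial>P) =
      ennreal (exp (-1) / fact n) * (\<integral>\<^sup>+x. ennreal ((norm (symmetrize n f (x ` {..<n})))\<^sup>2) \<partial>unit_leb_power n)"
    by (rule nn_integral_poisson_process_n[OF P], measurable) (simp add: symmetrize_def)
  also have "(\<integral>\<^sup>+x. ennreal ((norm (symmetrize n f (x ` {..<n})))\<^sup>2) \<partial>unit_leb_power n) =
      (\<integral>\<^sup>+x. ennreal ((norm (?S x))\<^sup>2) \<partial>unit_leb_power n)"
    using AE_unit_leb_power_inj[of n] AE_space
    by (intro nn_integral_cong_AE, eventually_elim) (simp add: symmetrize_point_set)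
  also have "\<dots> = ennreal ((l2norm (unit_leb_power n) ?S)\<^sup>2)"
    using square_integrable_integrable[OF S] by (simp add: nn_integral_eq_integral l2norm_sq)
  finally have eq: "(\<integral>\<^sup>+\<omega>. ennreal ((norm (symmetrize n f \<omega>))\<^sup>2) \<partial>P) =
      ennreal (exp (-1) / fact n * (l2norm (unit_leb_power n) ?S)\<^sup>2)"
    by (simp add: ennreal_mult[symmetric])
  show sq: "square_integrable P (symmetrize n f)"
    unfolding square_integrable_def using m eq by (auto simp: integrable_iff_bounded)
  have "(l2norm P (symmetrize n f))\<^sup>2 = exp (-1) / fact n * (l2norm (unit_leb_power n) ?S)\<^sup>2"
    using eq square_integrable_integrable[OF sq] by (simp add: nn_integral_eq_integral l2norm_sq)
  also have "\<dots> \<le> 1 * (fact n * ?l)\<^sup>2"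
  proof (intro mult_mono l)
    have "exp (-1) \<le> (1::real)" by simp
    also have "1 \<le> (fact n :: real)" by (rule fact_ge_1)
    finally show "exp (-1) / fact n \<le> (1::real)" by (simp add: divide_le_eq)
  qed auto
  finally have "(l2norm P (symmetrize n f))\<^sup>2 \<le> (fact n * ?l)\<^sup>2" by simp
  then show "l2norm P (symmetrize n f) \<le> fact n * ?l"
    by (rule power2_le_imp_le) (simp_all add: l2norm_nonneg)
qed

subsection \<open>Wick polynomials\<close>

text \<open>A multivariate Hermite polynomial: for finite \<open>I\<close> it is the coefficient of
  the product of all \<open>s i\<close> in the exponential of the sum of \<open>s i * a i\<close>
  minus half the sum of \<open>s i * s j * b {i, j}\<close>.\<close>

definition wick :: "('a \<Rightarrow> real) \<Rightarrow> ('a set \<Rightarrow> real) \<Rightarrow> 'a set \<Rightarrow> real" where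
  "wick a b I = (\<Sum>R\<in>partitions_le2 I. (-1) ^ card (blocks 2 R) *
     ((\<Prod>B\<in>blocks 1 R. a (the_elem B)) * (\<Prod>B\<in>blocks 2 R. b B)))"

text \<open>Classification by the block containing \<open>i\<close>: it is \<open>{i}\<close> alone
  or \<open>{i, j}\<close> with one partner \<open>j\<close>, and removing it leaves a partition of
  the other points.\<close>

lemma partitions_le2_insert:
  assumes i: "i \<notin> I"
  shows "partitions_le2 (insert i I) =
    insert {i} ` partitions_le2 I \<union> (\<Union>j\<in>I. insert {i, j} ` partitions_le2 (I - {j}))"
    (is "_ = ?R")
proof (intro equalityI subsetI)
  fix R assume "R \<in> partitions_le2 (insert i I)"
  then have R: "partition_on (insert i I) R" "\<And>B. B \<in> R \<Longrightarrow> card B = 1 \<or> card B = 2"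
    by (auto simp: partitions_le2_def)
  from R(1) obtain B where B: "B \<in> R" "i \<in> B"
    by (auto simp: partition_on_def)
  define R' where "R' = R - {B}"
  have ins: "R = insert B R'" "B \<notin> R'" using B by (auto simp: R'_def)
  have "disjnt B (\<Union>R')"
    using partition_onD2[OF R(1)] B(1) by (auto simp: R'_def disjoint_def disjnt_def)
  then have R': "partition_on (insert i I - B) R'"
    using R(1) by (simp add: ins(1) partition_on_insert)
  have cR': "\<forall>C\<in>R'. card C = 1 \<or> card C = 2" using R(2) by (auto simp: R'_def)
  from R(2)[OF B(1)] show "R \<in> ?R"
  proof
    assume "card B = 1"
    then have "B = {i}" using B(2) by (auto simp: card_1_singleton_iff)
    then have "R' \<in> partitions_le2 I" "R = insert {i} R'"
      using R' cR' i ins by (auto simp: partitions_le2_def)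
    then show ?thesis by blast
  next
    assume "card B = 2"
    then obtain j where j: "B = {i, j}" "j \<noteq> i" using B(2) by (auto simp: card_2_iff)
    moreover have "B \<subseteq> insert i I" using partition_onD1[OF R(1)] B(1) by auto
    ultimately have "j \<in> I" "insert i I - B = I - {j}" using i by auto
    then have "R' \<in> partitions_le2 (I - {j})" "R = insert {i, j} R'"
      using R' cR' ins j by (auto simp: partitions_le2_def)
    then show ?thesis using \<open>j \<in> I\<close> by blast
  qed
next
  fix R assume "R \<in> ?R"
  then consider R' where "R = insert {i} R'" "R' \<in> partitions_le2 I"
    | j R' where "j \<in> I" "R = insert {i, j} R'" "R' \<in> partitions_le2 (I - {j})" by blast
  then show "R \<in> partitions_le2 (insert i I)"
  proof cases
    case (1 R')
    then have "\<Union>R' = I" by (auto simp: partitions_le2_def partition_on_def)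
    with 1 i show ?thesis
      by (auto simp: partitions_le2_def partition_on_insert disjnt_def)
  next
    case (2 j R')
    then have "\<Union>R' = I - {j}" by (auto simp: partitions_le2_def partition_on_def)
    moreover have "insert i I - {i, j} = I - {j}" using i by auto
    ultimately show ?thesis
      using 2 i by (auto simp: partitions_le2_def partition_on_insert disjnt_def card_insert_if)
  qed
qed

lemma finite_partitions_le2: "finite I \<Longrightarrow> finite (partitions_le2 I)"
  by (rule finite_subset[OF _ finitely_many_partition_on[of I]]) (auto simp: partitions_le2_def)

lemma partitions_le2_notin:
  "R \<in> partitions_le2 I \<Longrightarrow> B \<in> R \<Longrightarrow> B \<subseteq> I"
  by (auto simp: partitions_le2_def partition_on_def)

text \<open>The block of \<open>i\<close> can be read off from the partition, so the pieces of
  \<open>partitions_le2_insert\<close> are disjoint and adding the block is injective.\<close>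

lemma sum_partitions_le2_insert:
  fixes w :: "'a set set \<Rightarrow> 'b::comm_monoid_add"
  assumes I: "finite I" and i: "i \<notin> I"
  shows "(\<Sum>R\<in>partitions_le2 (insert i I). w R) =
    (\<Sum>R\<in>partitions_le2 I. w (insert {i} R)) +
    (\<Sum>j\<in>I. \<Sum>R\<in>partitions_le2 (I - {j}). w (insert {i, j} R))"
proof -
  have notin: "B \<notin> R" if "R \<in> partitions_le2 J" "J \<subseteq> I" "i \<in> B" for R J B
    using partitions_le2_notin[OF that(1), of B] that(2,3) i by auto
  have inj: "inj_on (insert B) (partitions_le2 J)" if "J \<subseteq> I" "i \<in> B" for J B
  proof (rule inj_onI)
    fix R R' assume R: "R \<in> partitions_le2 J" "R' \<in> partitions_le2 J" and eq: "insert B R = insert B R'"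
    show "R = R'"
      using eq notin[OF R(1) that] notin[OF R(2) that] by (simp add: insert_ident)
  qed
  let ?A = "insert {i} ` partitions_le2 I"
  let ?B = "\<lambda>j. insert {i, j} ` partitions_le2 (I - {j})"
  have fin: "finite ?A" "\<And>j. finite (?B j)"
    using I by (auto intro: finite_partitions_le2)
  have "?A \<inter> (\<Union>j\<in>I. ?B j) = {}"
  proof -
    have False if "R \<in> partitions_le2 I" "R' \<in> partitions_le2 (I - {j})" "j \<in> I"
      "insert {i} R = insert {i, j} R'" for R R' j
    proof -
      have "{i, j} \<in> insert {i} R" unfolding that(4) by simp
      moreover have "{i, j} \<noteq> {i}" using i that(3) by auto
      ultimately have "{i, j} \<in> R" by simp
      then show False using notin[OF that(1) order_refl insertI1] by blast
    qed
    then show ?thesis by blast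
  qed
  moreover have "?B j \<inter> ?B k = {}" if "j \<in> I" "k \<in> I" "j \<noteq> k" for j k
  proof -
    have False if "R \<in> partitions_le2 (I - {j})" "R' \<in> partitions_le2 (I - {k})"
      "insert {i, j} R = insert {i, k} R'" for R R'
    proof -
      have "{i, k} \<in> insert {i, j} R" unfolding that(3) by simp
      moreover have "{i, k} \<noteq> {i, j}" using \<open>j \<noteq> k\<close> by (auto simp: doubleton_eq_iff)
      ultimately have "{i, k} \<in> R" by simp
      then show False using notin[OF that(1) Diff_subset insertI1] by blast
    qed
    then show ?thesis by blast
  qed
  ultimately have "(\<Sum>R\<in>partitions_le2 (insert i I). w R) = sum w ?A + (\<Sum>j\<in>I. sum w (?B j))"
    unfolding partitions_le2_insert[OF i] using fin I
    by (subst sum.union_disjoint) (auto simp: sum.UNION_disjoint)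
  also have "sum w ?A = (\<Sum>R\<in>partitions_le2 I. w (insert {i} R))"
    by (simp add: sum.reindex[OF inj])
  also have "(\<Sum>j\<in>I. sum w (?B j)) = (\<Sum>j\<in>I. \<Sum>R\<in>partitions_le2 (I - {j}). w (insert {i, j} R))"
    by (simp add: sum.reindex[OF inj])
  finally show ?thesis .
qed

lemma wick_empty: "wick a b ({} :: 'a set) = 1"
proof -
  have "partitions_le2 ({} :: 'a set) = {{}}"
    by (auto simp: partitions_le2_def partition_on_empty)
  then show ?thesis by (simp add: wick_def blocks_def)
qed

lemma blocks_insert: "blocks k (insert B R) = (if card B = k then insert B (blocks k R) else blocks k R)"
  by (auto simp: blocks_def)

text \<open>The recursion \<open>H (n + 1) = x * H n - n * H (n - 1)\<close> of the Hermite
  polynomials in polarized form; the minus sign is that of the additional pair.\<close>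

lemma wick_insert:
  assumes I: "finite I" and i: "i \<notin> I"
  shows "wick a b (insert i I) = a i * wick a b I - (\<Sum>j\<in>I. b {i, j} * wick a b (I - {j}))"
proof -
  have fin: "finite (blocks k R)" if "R \<in> partitions_le2 J" "J \<subseteq> I" for R J k
    using that finite_elements[of J R] finite_subset[OF that(2) I]
    by (auto simp: partitions_le2_def blocks_def)
  have notin: "B \<notin> blocks k R" if "R \<in> partitions_le2 J" "J \<subseteq> I" "i \<in> B" for R J B k
    using partitions_le2_notin[OF that(1), of B] that(2,3) i by (auto simp: blocks_def)
  let ?w = "\<lambda>R. (-1) ^ card (blocks 2 R) *
    ((\<Prod>B\<in>blocks 1 R. a (the_elem B)) * (\<Prod>B\<in>blocks 2 R. b B))"
  have 1: "?w (insert {i} R) = a i * ?w R" if "R \<in> partitions_le2 I" for R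
    using fin[OF that] notin[OF that] by (simp add: blocks_insert del: One_nat_def)
  have 2: "?w (insert {i, j} R) = - (b {i, j} * ?w R)" if "j \<in> I" "R \<in> partitions_le2 (I - {j})" for j R
  proof -
    have "i \<noteq> j" using that(1) i by auto
    then have "card {i, j} = 2" by simp
    then show ?thesis
      using fin[OF that(2)] notin[OF that(2)] by (simp add: blocks_insert del: One_nat_def)
  qed
  show ?thesis
    unfolding wick_def sum_partitions_le2_insert[OF I i]
    by (simp add: 1 2 sum_distrib_left sum_negf del: One_nat_def)
qed

subsection \<open>Gaussian white noise\<close>

lemma has_bochner_integral_exp_std_normal:
  "has_bochner_integral std_normal_distribution (\<lambda>x. exp (a * x)) (exp (a\<^sup>2 / 2))"
proof -
  \<comment> \<open>Completing the square: tilting by \<open>exp (a * x)\<close> moves the mean to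
    \<open>a\<close>.\<close>
  have eq: "std_normal_density x * exp (a * x) = exp (a\<^sup>2 / 2) * normal_density a 1 x" for x
    by (simp add: normal_density_def exp_add[symmetric] power2_diff field_simps)
  have "has_bochner_integral lborel (\<lambda>x. exp (a\<^sup>2 / 2) * normal_density a 1 x) (exp (a\<^sup>2 / 2) * 1)"
    by (intro has_bochner_integral_mult_right)
      (auto simp: has_bochner_integral_iff)
  then have "has_bochner_integral lborel (\<lambda>x. std_normal_density x *\<^sub>R exp (a * x)) (exp (a\<^sup>2 / 2))"
    by (simp add: eq)
  then show ?thesis
    by (subst has_bochner_integral_density) auto
qed

text \<open>Dominates \<open>(exp (t * w) - 1) / t\<close> by
  \<open>\<bar>w\<bar> * exp \<bar>w\<bar>\<close> for all nonzero \<open>t\<close> with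
  \<open>\<bar>t\<bar> < 1\<close>, as differentiation under the integral demands.\<close>

lemma abs_exp_minus_one_le: "\<bar>exp y - 1\<bar> \<le> \<bar>y\<bar> * exp \<bar>y\<bar>" for y :: real
proof (cases "0 \<le> y")
  case True
  have "(1 - y) * exp y \<le> exp (- y) * exp y"
    using exp_ge_add_one_self[of "- y"] by (intro mult_right_mono) auto
  then have "exp y - 1 \<le> y * exp y" by (simp add: exp_add[symmetric] algebra_simps)
  then show ?thesis using True by simp
next
  case False
  then have "exp y \<le> 1" by simp
  with False have "\<bar>exp y - 1\<bar> \<le> \<bar>y\<bar>" using exp_ge_add_one_self[of y] by linarith
  also have "\<dots> \<le> \<bar>y\<bar> * exp \<bar>y\<bar>" by (simp add: mult_le_cancel_left1)
  finally show ?thesis .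
qed

locale white_noise =
  fixes M :: "'w measure" and W :: "(real \<Rightarrow> real) \<Rightarrow> 'w \<Rightarrow> real"
  assumes wn: "gaussian_white_noise M W"
begin

sublocale prob_space M
  using wn by (simp add: gaussian_white_noise_def)

abbreviation sqi :: "(real \<Rightarrow> real) \<Rightarrow> bool" where
  "sqi h \<equiv> square_integrable unit_leb h"

definition ip :: "(real \<Rightarrow> real) \<Rightarrow> (real \<Rightarrow> real) \<Rightarrow> real" where
  "ip f g = (\<integral>x. f x * g x \<partial>unit_leb)"

lemma ip_self: "ip f f = (l2norm unit_leb f)\<^sup>2"
  unfolding ip_def l2norm_sq by (simp add: power2_eq_square)

lemma ip_commute: "ip f g = ip g f"
  by (simp add: ip_def mult.commute)

lemma ip_add_right:
  assumes "sqi f" "sqi g" "sqi h"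
  shows "ip f (\<lambda>x. a * g x + b * h x) = a * ip f g + b * ip f h"
proof -
  have "ip f (\<lambda>x. a * g x + b * h x) = (\<integral>x. a * (f x * g x) + b * (f x * h x) \<partial>unit_leb)"
    by (simp add: ip_def algebra_simps)
  also have "\<dots> = a * ip f g + b * ip f h"
    using integrable_mult_square_integrable[OF assms(1,2)] integrable_mult_square_integrable[OF assms(1,3)]
    by (simp add: ip_def)
  finally show ?thesis .
qed

lemma ip_add_self:
  assumes "sqi g" "sqi h"
  shows "ip (\<lambda>x. a * g x + b * h x) (\<lambda>x. a * g x + b * h x) =
    a\<^sup>2 * ip g g + 2 * a * b * ip g h + b\<^sup>2 * ip h h"
proof -
  have s: "sqi (\<lambda>x. a * g x + b * h x)" using assms by (rule square_integrable_lincomb)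
  have "ip (\<lambda>x. a * g x + b * h x) g = a * ip g g + b * ip g h"
    "ip (\<lambda>x. a * g x + b * h x) h = a * ip g h + b * ip h h"
    using assms by (simp_all add: ip_commute[of "\<lambda>x. a * g x + b * h x"] ip_add_right ip_commute[of h g])
  then show ?thesis
    by (simp add: ip_add_right[OF s assms] power2_eq_square algebra_simps)
qed

lemma sqi_const: "sqi (\<lambda>_. c)"
  by (rule finite_measure.square_integrable_bounded[of _ _ "\<bar>c\<bar>"])
    (auto intro: prob_space.finite_measure prob_space_unit_leb)

lemma sets_M: "sets M = sigma_sets (space M) {W h -` B \<inter> space M | h B. sqi h \<and> B \<in> sets borel}"
  using wn unfolding gaussian_white_noise_def by (elim conjE)

lemma measurable_W:
  assumes "sqi h"
  shows "W h \<in> borel_measurable M"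
proof (rule measurableI)
  fix B :: "real set" assume "B \<in> sets borel"
  then have "W h -` B \<inter> space M \<in>
      sigma_sets (space M) {W h -` B \<inter> space M | h B. sqi h \<and> B \<in> sets borel}"
    using assms by (intro sigma_sets.Basic) auto
  then show "W h -` B \<inter> space M \<in> sets M"
    by (simp only: sets_M)
qed simp

lemma W_lincomb:
  assumes "sqi h" "sqi g"
  shows "AE \<eta> in M. W (\<lambda>x. a * h x + b * g x) \<eta> = a * W h \<eta> + b * W g \<eta>"
proof -
  have "\<forall>h g a b. sqi h \<longrightarrow> sqi g \<longrightarrow>
      (AE \<eta> in M. W (\<lambda>x. a * h x + b * g x) \<eta> = a * W h \<eta> + b * W g \<eta>)"
    using wn unfolding gaussian_white_noise_def by (elim conjE)
  then show ?thesis using assms by simp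
qed

lemma W_scale:
  assumes "sqi h"
  shows "AE \<eta> in M. W (\<lambda>x. a * h x) \<eta> = a * W h \<eta>"
  using W_lincomb[OF assms assms, of a 0] by simp

lemma W_char:
  assumes "sqi h"
  shows "(\<integral>\<eta>. iexp (W h \<eta>) \<partial>M) = complex_of_real (exp (- (l2norm unit_leb h)\<^sup>2 / 2))"
proof -
  have "\<forall>h. sqi h \<longrightarrow>
      (\<integral>\<eta>. iexp (W h \<eta>) \<partial>M) = complex_of_real (exp (- (l2norm unit_leb h)\<^sup>2 / 2))"
    using wn unfolding gaussian_white_noise_def by (elim conjE)
  then show ?thesis using assms by simp
qed

text \<open>The characteristic function of \<open>W h\<close> at \<open>t\<close> is the given
  functional at \<open>t * h\<close>, and Levy's uniqueness theorem applies. A scaled standard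
  normal variable takes the place of a normal density because the norm of \<open>h\<close> may be
  zero.\<close>

lemma distr_W:
  assumes h: "sqi h"
  shows "distr M borel (W h) = distr std_normal_distribution borel (\<lambda>x. l2norm unit_leb h * x)"
proof (rule Levy_uniqueness)
  interpret N: real_distribution std_normal_distribution
    by (rule real_dist_normal_dist)
  note [measurable] = measurable_W[OF h]
  show "real_distribution (distr M borel (W h))"
    by (rule real_distribution_distr) simp
  show "real_distribution (distr std_normal_distribution borel (\<lambda>x. l2norm unit_leb h * x))"
    by (rule N.real_distribution_distr) simp
  show "char (distr M borel (W h)) = char (distr std_normal_distribution borel (\<lambda>x. l2norm unit_leb h * x))"
  proof
    fix t
    have th: "sqi (\<lambda>x. t * h x)" using h by (rule square_integrable_cmult)
    have "char (distr M borel (W h)) t = (\<integral>\<eta>. iexp (t * W h \<eta>) \<partial>M)"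
      by (simp add: char_def integral_distr)
    also have "\<dots> = (\<integral>\<eta>. iexp (W (\<lambda>x. t * h x) \<eta>) \<partial>M)"
      using W_scale[OF h, of t] measurable_W[OF th]
      by (intro integral_cong_AE) (auto elim!: eventually_mono)
    also have "\<dots> = complex_of_real (exp (- (t * l2norm unit_leb h)\<^sup>2 / 2))"
      by (simp add: W_char[OF th] l2norm_cmult power_mult_distrib)
    also have "\<dots> = char std_normal_distribution (t * l2norm unit_leb h)"
      by (simp add: char_std_normal_distribution)
    also have "\<dots> = char (distr std_normal_distribution borel (\<lambda>x. l2norm unit_leb h * x)) t"
      by (simp add: char_def integral_distr mult.assoc)
    finally show "char (distr M borel (W h)) t =
        char (distr std_normal_distribution borel (\<lambda>x. l2norm unit_leb h * x)) t" .
  qed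
qed

lemma has_bochner_integral_exp_W:
  assumes h: "sqi h"
  shows "has_bochner_integral M (\<lambda>\<eta>. exp (c * W h \<eta>)) (exp ((c * l2norm unit_leb h)\<^sup>2 / 2))"
proof -
  note [measurable] = measurable_W[OF h]
  have "has_bochner_integral std_normal_distribution (\<lambda>x. exp (c * (l2norm unit_leb h * x)))
      (exp ((c * l2norm unit_leb h)\<^sup>2 / 2))"
    using has_bochner_integral_exp_std_normal[of "c * l2norm unit_leb h"] by (simp add: mult.assoc)
  then have "has_bochner_integral (distr std_normal_distribution borel (\<lambda>x. l2norm unit_leb h * x))
      (\<lambda>x. exp (c * x)) (exp ((c * l2norm unit_leb h)\<^sup>2 / 2))"
    by (intro has_bochner_integral_distr) auto
  then have "has_bochner_integral (distr M borel (W h)) (\<lambda>x. exp (c * x)) (exp ((c * l2norm unit_leb h)\<^sup>2 / 2))"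
    by (simp add: distr_W[OF h])
  then show ?thesis
    unfolding has_bochner_integral_iff by (simp add: integrable_distr_eq integral_distr)
qed

text \<open>Random variables with finite absolute moments of all orders form an algebra which contains
  \<open>W h\<close> and \<open>exp (W h)\<close>.\<close>

definition tame :: "('w \<Rightarrow> real) \<Rightarrow> bool" where
  "tame X \<longleftrightarrow> X \<in> borel_measurable M \<and> (\<forall>p::nat. integrable M (\<lambda>\<eta>. \<bar>X \<eta>\<bar> ^ p))"

lemma tame_measurable: "tame X \<Longrightarrow> X \<in> borel_measurable M"
  and tame_power: "tame X \<Longrightarrow> integrable M (\<lambda>\<eta>. \<bar>X \<eta>\<bar> ^ p)"
  by (simp_all add: tame_def)

lemma tame_integrable: "tame X \<Longrightarrow> integrable M X"
  using tame_power[of X 1] tame_measurable[of X] by (simp add: integrable_abs_iff)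

lemma tame_square_integrable: "tame X \<Longrightarrow> square_integrable M X"
  using tame_power[of X 2] tame_measurable[of X] by (simp add: square_integrable_def)

lemma tame_bound:
  assumes "tame Y" "X \<in> borel_measurable M" "\<And>\<eta>. \<bar>X \<eta>\<bar> \<le> \<bar>Y \<eta>\<bar>"
  shows "tame X"
  unfolding tame_def
proof (intro conjI allI)
  note [measurable] = assms(2)
  fix p :: nat
  show "integrable M (\<lambda>\<eta>. \<bar>X \<eta>\<bar> ^ p)"
    by (rule Bochner_Integration.integrable_bound[OF tame_power[OF assms(1), of p]])
      (auto simp: power_abs intro!: power_mono assms(3))
qed fact

lemma tame_const: "tame (\<lambda>_. c)"
  by (simp add: tame_def)

lemma tame_mult:
  assumes "tame X" "tame Y"
  shows "tame (\<lambda>\<eta>. X \<eta> * Y \<eta>)"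
  unfolding tame_def
proof (intro conjI allI)
  note [measurable] = assms[THEN tame_measurable]
  show "(\<lambda>\<eta>. X \<eta> * Y \<eta>) \<in> borel_measurable M" by measurable
  fix p :: nat
  have "square_integrable M (\<lambda>\<eta>. \<bar>X \<eta>\<bar> ^ p)" "square_integrable M (\<lambda>\<eta>. \<bar>Y \<eta>\<bar> ^ p)"
    using tame_power[OF assms(1), of "p * 2"] tame_power[OF assms(2), of "p * 2"]
    by (simp_all add: square_integrable_def power_mult)
  from integrable_mult_square_integrable[OF this] show "integrable M (\<lambda>\<eta>. \<bar>X \<eta> * Y \<eta>\<bar> ^ p)"
    by (simp add: abs_mult power_mult_distrib)
qed

lemma tame_add:
  assumes "tame X" "tame Y"
  shows "tame (\<lambda>\<eta>. X \<eta> + Y \<eta>)"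
  unfolding tame_def
proof (intro conjI allI)
  note [measurable] = assms[THEN tame_measurable]
  show "(\<lambda>\<eta>. X \<eta> + Y \<eta>) \<in> borel_measurable M" by measurable
  fix p :: nat
  have "integrable M (\<lambda>\<eta>. 2 ^ p * (\<bar>X \<eta>\<bar> ^ p + \<bar>Y \<eta>\<bar> ^ p))"
    using assms by (intro integrable_mult_right Bochner_Integration.integrable_add tame_power)
  then show "integrable M (\<lambda>\<eta>. \<bar>X \<eta> + Y \<eta>\<bar> ^ p)"
  proof (rule Bochner_Integration.integrable_bound)
    show "AE \<eta> in M. norm (\<bar>X \<eta> + Y \<eta>\<bar> ^ p) \<le> norm (2 ^ p * (\<bar>X \<eta>\<bar> ^ p + \<bar>Y \<eta>\<bar> ^ p))"
    proof (rule AE_I2)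
      fix \<eta>
      have "\<bar>X \<eta> + Y \<eta>\<bar> ^ p \<le> (2 * max \<bar>X \<eta>\<bar> \<bar>Y \<eta>\<bar>) ^ p"
        by (intro power_mono) auto
      also have "\<dots> = 2 ^ p * max \<bar>X \<eta>\<bar> \<bar>Y \<eta>\<bar> ^ p" by (simp add: power_mult_distrib)
      also have "\<dots> \<le> 2 ^ p * (\<bar>X \<eta>\<bar> ^ p + \<bar>Y \<eta>\<bar> ^ p)"
        by (intro mult_left_mono) (auto simp: max_def)
      finally show "norm (\<bar>X \<eta> + Y \<eta>\<bar> ^ p) \<le> norm (2 ^ p * (\<bar>X \<eta>\<bar> ^ p + \<bar>Y \<eta>\<bar> ^ p))"
        by simp
    qed
  qed measurable
qed

lemma tame_sum: "(\<And>i. i \<in> I \<Longrightarrow> tame (X i)) \<Longrightarrow> tame (\<lambda>\<eta>. \<Sum>i\<in>I. X i \<eta>)"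
  by (induction I rule: infinite_finite_induct) (auto intro: tame_const tame_add)

lemma tame_exp_W: "sqi h \<Longrightarrow> tame (\<lambda>\<eta>. exp (c * W h \<eta>))"
  unfolding tame_def
proof (intro conjI allI)
  assume h: "sqi h"
  show "(\<lambda>\<eta>. exp (c * W h \<eta>)) \<in> borel_measurable M"
    using measurable_W[OF h] by measurable
  fix p :: nat
  have "integrable M (\<lambda>\<eta>. exp ((real p * c) * W h \<eta>))"
    using has_bochner_integral_exp_W[OF h] by (rule integrable.intros)
  then show "integrable M (\<lambda>\<eta>. \<bar>exp (c * W h \<eta>)\<bar> ^ p)"
    by (simp add: exp_of_nat_mult[symmetric] mult.assoc)
qed

text \<open>The factors 1 and -1 are written out to match the form
  \<open>exp (c * W h \<eta>)\<close> in \<open>tame_exp_W\<close>.\<close>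

lemma abs_le_exp_add_exp: "\<bar>x\<bar> \<le> exp (1 * x) + exp (-1 * x)" for x :: real
  using exp_ge_add_one_self[of x] exp_ge_add_one_self[of "-x"] exp_gt_zero[of x] exp_gt_zero[of "-x"]
  unfolding mult_1 mult_minus1 by linarith

lemma tame_W: "sqi h \<Longrightarrow> tame (W h)"
  by (rule tame_bound[OF tame_add[OF tame_exp_W[of h 1] tame_exp_W[of h "-1"]]],
      assumption, assumption, erule measurable_W, rule order_trans[OF abs_le_exp_add_exp abs_ge_self])

text \<open>Differentiation under the integral sign, the analytic input to Gaussian integration by
  parts.\<close>

lemma DERIV_integral_mult_exp:
  assumes Y: "tame Y" and f: "sqi f"
  shows "((\<lambda>t. \<integral>\<eta>. Y \<eta> * exp (t * W f \<eta>) \<partial>M) has_real_derivative (\<integral>\<eta>. Y \<eta> * W f \<eta> \<partial>M)) (at 0)"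
proof -
  let ?\<phi> = "\<lambda>t. \<integral>\<eta>. Y \<eta> * exp (t * W f \<eta>) \<partial>M"
  let ?B = "\<lambda>\<eta>. exp (1 * W f \<eta>) + exp (-1 * W f \<eta>)"
  note [measurable] = tame_measurable[OF Y] measurable_W[OF f]
  have int: "integrable M (\<lambda>\<eta>. Y \<eta> * exp (t * W f \<eta>))" for t
    by (intro tame_integrable tame_mult Y tame_exp_W f)
  \<comment> \<open>On the unit ball one integrable function dominates all difference quotients; the
    sequential form of the limit admits dominated convergence.\<close>
  have "((\<lambda>t. (?\<phi> (0 + t) - ?\<phi> 0) / t) \<longlongrightarrow> (\<integral>\<eta>. Y \<eta> * W f \<eta> \<partial>M)) (at 0 within ball 0 1)"
    unfolding tendsto_at_iff_sequentially
  proof (intro allI impI)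
    fix T :: "nat \<Rightarrow> real" assume T: "\<forall>i. T i \<in> ball 0 1 - {0}" and T0: "T \<longlonglongrightarrow> 0"
    let ?q = "\<lambda>i \<eta>. Y \<eta> * ((exp (T i * W f \<eta>) - 1) / T i)"
    have "(\<lambda>i. \<integral>\<eta>. ?q i \<eta> \<partial>M) \<longlonglongrightarrow> (\<integral>\<eta>. Y \<eta> * W f \<eta> \<partial>M)"
    proof (rule integral_dominated_convergence
        [where w="\<lambda>\<eta>. \<bar>Y \<eta>\<bar> * (\<bar>W f \<eta>\<bar> * ?B \<eta>)"])
      have "tame (\<lambda>\<eta>. Y \<eta> * (W f \<eta> * ?B \<eta>))"
        by (intro tame_mult tame_add Y tame_W tame_exp_W f)
      from integrable_abs[OF tame_integrable[OF this]]
      show "integrable M (\<lambda>\<eta>. \<bar>Y \<eta>\<bar> * (\<bar>W f \<eta>\<bar> * ?B \<eta>))"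
        by (simp add: abs_mult add_pos_pos abs_of_pos)
      show "AE \<eta> in M. (\<lambda>i. ?q i \<eta>) \<longlonglongrightarrow> Y \<eta> * W f \<eta>"
      proof (rule AE_I2)
        fix \<eta>
        have "((\<lambda>t. exp (t * W f \<eta>)) has_real_derivative W f \<eta>) (at 0)"
          by (auto intro!: derivative_eq_intros)
        then have "((\<lambda>t. (exp (t * W f \<eta>) - 1) / t) \<longlongrightarrow> W f \<eta>) (at 0)"
          by (simp add: DERIV_def)
        moreover have "filterlim T (at 0) sequentially"
          using T T0 by (auto simp: filterlim_at)
        ultimately have "(\<lambda>i. (exp (T i * W f \<eta>) - 1) / T i) \<longlonglongrightarrow> W f \<eta>"
          by (rule filterlim_compose)
        then show "(\<lambda>i. ?q i \<eta>) \<longlonglongrightarrow> Y \<eta> * W f \<eta>" by (intro tendsto_intros)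
      qed
      show "AE \<eta> in M. norm (?q i \<eta>) \<le> \<bar>Y \<eta>\<bar> * (\<bar>W f \<eta>\<bar> * ?B \<eta>)" for i
      proof (rule AE_I2)
        fix \<eta>
        have Ti: "\<bar>T i\<bar> < 1" "T i \<noteq> 0" using T by auto
        have "\<bar>exp (T i * W f \<eta>) - 1\<bar> \<le> \<bar>T i * W f \<eta>\<bar> * exp \<bar>T i * W f \<eta>\<bar>"
          by (rule abs_exp_minus_one_le)
        also have "\<dots> \<le> \<bar>T i * W f \<eta>\<bar> * exp \<bar>W f \<eta>\<bar>"
          using Ti by (intro mult_left_mono) (auto simp: abs_mult mult_left_le_one_le)
        also have "\<dots> \<le> \<bar>T i * W f \<eta>\<bar> * ?B \<eta>"
          by (intro mult_left_mono) (auto simp: abs_if)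
        finally have "\<bar>(exp (T i * W f \<eta>) - 1) / T i\<bar> \<le> \<bar>W f \<eta>\<bar> * ?B \<eta>"
          using Ti by (simp add: abs_mult divide_le_eq ac_simps)
        then show "norm (?q i \<eta>) \<le> \<bar>Y \<eta>\<bar> * (\<bar>W f \<eta>\<bar> * ?B \<eta>)"
          unfolding real_norm_def abs_mult[of "Y \<eta>"] by (intro mult_left_mono) auto
      qed
    qed measurable
    moreover have "(\<integral>\<eta>. ?q i \<eta> \<partial>M) = (?\<phi> (0 + T i) - ?\<phi> 0) / T i" for i
      using int[of "T i"] int[of 0] by (simp add: diff_divide_distrib right_diff_distrib)
    ultimately show "((\<lambda>t. (?\<phi> (0 + t) - ?\<phi> 0) / t) \<circ> T) \<longlonglongrightarrow> (\<integral>\<eta>. Y \<eta> * W f \<eta> \<partial>M)"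
      by (simp only: comp_def)
  qed
  then show ?thesis
    by (simp add: DERIV_def at_within_open[of 0 "ball 0 1"])
qed

section \<open>Exponential functionals and their pairing with Wick polynomials\<close>

definition E :: "(real \<Rightarrow> real) \<Rightarrow> 'w \<Rightarrow> real" where
  "E h \<eta> = exp (W h \<eta> - (l2norm unit_leb h)\<^sup>2 / 2)"

lemma tame_E: "sqi h \<Longrightarrow> tame (E h)"
  using tame_mult[OF tame_exp_W[of h 1] tame_const[of "exp (- (l2norm unit_leb h)\<^sup>2 / 2)"]]
  by (simp add: E_def[abs_def] exp_add[symmetric])

lemma integral_E: "sqi h \<Longrightarrow> (\<integral>\<eta>. E h \<eta> \<partial>M) = 1"
  using has_bochner_integral_integral_eq[OF has_bochner_integral_exp_W[of h 1]]
  by (simp add: E_def[abs_def] exp_diff)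

lemma E_lincomb:
  assumes "sqi g" "sqi h"
  shows "AE \<eta> in M. E (\<lambda>x. a * g x + b * h x) \<eta> =
    exp (a * W g \<eta> + b * W h \<eta> - (a\<^sup>2 * ip g g + 2 * a * b * ip g h + b\<^sup>2 * ip h h) / 2)"
  using W_lincomb[OF assms, of a b]
  by eventually_elim (simp only: E_def ip_self[symmetric] ip_add_self[OF assms])

definition wickW :: "('i \<Rightarrow> real \<Rightarrow> real) \<Rightarrow> 'i set \<Rightarrow> 'w \<Rightarrow> real" where
  "wickW f I \<eta> = wick (\<lambda>i. W (f i) \<eta> + 2 * (\<integral>t. f i t \<partial>unit_leb))
     (\<lambda>B. \<integral>x. (\<Prod>i\<in>B. f i x) \<partial>unit_leb) I"

lemma wickW_insert:
  assumes "finite I" "i \<notin> I"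
  shows "wickW f (insert i I) \<eta> = (W (f i) \<eta> + 2 * (\<integral>t. f i t \<partial>unit_leb)) * wickW f I \<eta> -
    (\<Sum>j\<in>I. ip (f i) (f j) * wickW f (I - {j}) \<eta>)"
proof -
  have "(\<integral>x. (\<Prod>k\<in>{i, j}. f k x) \<partial>unit_leb) = ip (f i) (f j)" if "j \<in> I" for j
  proof -
    have "i \<noteq> j" using that assms(2) by auto
    then show ?thesis by (simp add: ip_def)
  qed
  then show ?thesis
    unfolding wickW_def wick_insert[OF assms] by simp
qed

text \<open>By the Cameron-Martin formula \<open>E g\<close> shifts \<open>W f\<close> by \<open>ip f g\<close>. The induction step is Gaussian
  integration by parts, obtained by differentiating the induction hypothesis in the direction of
  \<open>f i\<close> at \<open>g\<close>.\<close>

lemma wickW_E: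
  assumes "finite I" "\<And>i. i \<in> I \<Longrightarrow> sqi (f i)" "sqi g"
  shows "tame (wickW f I) \<and>
    (\<integral>\<eta>. wickW f I \<eta> * E g \<eta> \<partial>M) = (\<Prod>i\<in>I. ip (f i) g + 2 * (\<integral>t. f i t \<partial>unit_leb))"
  using assms
\<comment> \<open>The recursion removes one index or two, so the claim is needed for all proper
  subsets; \<open>g\<close> varies because integration by parts uses the claim at
  \<open>g + t * f i\<close>.\<close>
proof (induction I arbitrary: g rule: finite_psubset_induct)
  case (psubset I)
  show ?case
  proof (cases "I = {}")
    case True
    have "tame (wickW f I)"
      using tame_const[of 1] by (simp add: True wickW_def[abs_def] wick_empty)
    then show ?thesis
      using integral_E[OF psubset.prems(2)] by (simp add: True wickW_def wick_empty tame_const)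
  next
    case False
    then obtain i J where J: "I = insert i J" "i \<notin> J"
      by (meson Set.set_insert ex_in_conv)
    then have fin: "finite J" using psubset.hyps by auto
    have fi: "sqi (f i)" and fj: "\<And>j. j \<in> J \<Longrightarrow> sqi (f j)" using psubset.prems J by auto
    note g = psubset.prems(2)
    define m where "m j g = ip (f j) g + 2 * (\<integral>t. f j t \<partial>unit_leb)" for j g
    have IH: "tame (wickW f K)" "sqi g \<Longrightarrow> (\<integral>\<eta>. wickW f K \<eta> * E g \<eta> \<partial>M) = (\<Prod>j\<in>K. m j g)"
      if "K \<subseteq> J" for K g
    proof -
      have "K \<subset> I" using that J by auto
      \<comment> \<open>Tameness does not involve \<open>g\<close> but stands behind the premise
        that \<open>g\<close> is square integrable; the zero function supplies an instance.\<close>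
      from psubset.IH[OF this, of g] psubset.IH[OF this, of "\<lambda>_. 0"] that fj
      show "tame (wickW f K)" "sqi g \<Longrightarrow> (\<integral>\<eta>. wickW f K \<eta> * E g \<eta> \<partial>M) = (\<Prod>j\<in>K. m j g)"
        by (auto simp: m_def square_integrable_zero subset_iff)
    qed
    have tJ: "tame (wickW f J)" by (rule IH) simp
    define Y where "Y \<eta> = wickW f J \<eta> * E g \<eta>" for \<eta>
    have tY: "tame Y" unfolding Y_def by (intro tame_mult tJ tame_E g)
    \<comment> \<open>The normalizing factor in
      \<open>E g * exp (t * W (f i)) = ?C t * E (g + t * f i)\<close>, valid almost
      everywhere.\<close>
    let ?C = "\<lambda>t. exp (t * ip (f i) g + t\<^sup>2 * ip (f i) (f i) / 2)"
    have \<phi>: "(\<integral>\<eta>. Y \<eta> * exp (t * W (f i) \<eta>) \<partial>M) =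
        ?C t * (\<Prod>j\<in>J. m j g + t * ip (f j) (f i))" for t
    proof -
      let ?g = "\<lambda>x. 1 * g x + t * f i x"
      have sg: "sqi ?g" using g fi by (rule square_integrable_lincomb)
      have "(\<integral>\<eta>. Y \<eta> * exp (t * W (f i) \<eta>) \<partial>M) =
          (\<integral>\<eta>. ?C t * (wickW f J \<eta> * E ?g \<eta>) \<partial>M)"
      proof (rule integral_cong_AE)
        show "(\<lambda>\<eta>. Y \<eta> * exp (t * W (f i) \<eta>)) \<in> borel_measurable M"
          by (intro tame_measurable tame_mult tY tame_exp_W fi)
        show "(\<lambda>\<eta>. ?C t * (wickW f J \<eta> * E ?g \<eta>)) \<in> borel_measurable M"
          by (intro tame_measurable tame_mult tame_const tJ tame_E sg)
        show "AE \<eta> in M. Y \<eta> * exp (t * W (f i) \<eta>) =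
            ?C t * (wickW f J \<eta> * E ?g \<eta>)"
          using E_lincomb[OF g fi, of 1 t]
        proof eventually_elim
          case (elim \<eta>)
          have "E g \<eta> * exp (t * W (f i) \<eta>) =
              ?C t * E ?g \<eta>"
            unfolding elim
            by (simp add: E_def ip_self[symmetric] exp_add[symmetric] ip_commute[of g "f i"] field_simps)
          then show ?case by (simp add: Y_def mult.assoc mult.left_commute)
        qed
      qed
      also have "\<dots> = ?C t * (\<Prod>j\<in>J. m j ?g)"
        using IH(2)[OF order_refl sg] by simp
      also have "(\<Prod>j\<in>J. m j ?g) = (\<Prod>j\<in>J. m j g + t * ip (f j) (f i))"
        using ip_add_right[OF fj g fi, of _ 1 t] by (intro prod.cong) (auto simp: m_def)
      finally show ?thesis .
    qed
    have "((\<lambda>t. ?C t * (\<Prod>j\<in>J. m j g + t * ip (f j) (f i)))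
        has_real_derivative (ip (f i) g * (\<Prod>j\<in>J. m j g) +
          (\<Sum>j\<in>J. ip (f i) (f j) * (\<Prod>k\<in>J - {j}. m k g)))) (at 0)"
    proof -
      have "((\<lambda>t. ?C t) has_real_derivative ip (f i) g) (at 0)"
        by (auto intro!: derivative_eq_intros)
      moreover have "((\<lambda>t. \<Prod>j\<in>J. m j g + t * ip (f j) (f i)) has_real_derivative
          (\<Sum>j\<in>J. ip (f j) (f i) * (\<Prod>k\<in>J - {j}. m k g + 0 * ip (f k) (f i)))) (at 0)"
        by (intro has_field_derivative_prod) (auto intro!: derivative_eq_intros)
      moreover have "(\<Sum>j\<in>J. ip (f j) (f i) * (\<Prod>k\<in>J - {j}. m k g + 0 * ip (f k) (f i))) =
          (\<Sum>j\<in>J. ip (f i) (f j) * (\<Prod>k\<in>J - {j}. m k g))"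
        by (rule sum.cong[OF refl], subst ip_commute) simp
      ultimately have "((\<lambda>t. ?C t) has_real_derivative ip (f i) g) (at 0)"
        "((\<lambda>t. \<Prod>j\<in>J. m j g + t * ip (f j) (f i)) has_real_derivative
          (\<Sum>j\<in>J. ip (f i) (f j) * (\<Prod>k\<in>J - {j}. m k g))) (at 0)"
        by (simp_all only:)
      then show ?thesis
        by (rule DERIV_mult'[THEN DERIV_cong]) simp
    qed
    \<comment> \<open>One function of \<open>t\<close>, differentiated under the integral and in
      closed form; equating the two derivatives is the integration by parts.\<close>
    with DERIV_integral_mult_exp[OF tY fi, unfolded \<phi>]
    have ibp: "(\<integral>\<eta>. Y \<eta> * W (f i) \<eta> \<partial>M) =
        ip (f i) g * (\<Prod>j\<in>J. m j g) + (\<Sum>j\<in>J. ip (f i) (f j) * (\<Prod>k\<in>J - {j}. m k g))"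
      by (rule DERIV_unique)
    let ?c = "2 * (\<integral>t. f i t \<partial>unit_leb)"
    have eq: "wickW f I \<eta> = (W (f i) \<eta> + ?c) * wickW f J \<eta> +
        (\<Sum>j\<in>J. - ip (f i) (f j) * wickW f (J - {j}) \<eta>)" for \<eta>
      unfolding J(1) wickW_insert[OF fin J(2)] by (simp add: sum_negf)
    have tI: "tame (wickW f I)"
      unfolding eq by (intro tame_add tame_mult tame_sum tame_W tame_const fi tJ IH(1)) auto
    have "(\<integral>\<eta>. wickW f I \<eta> * E g \<eta> \<partial>M) =
        (\<integral>\<eta>. Y \<eta> * W (f i) \<eta> + ?c * Y \<eta> + (\<Sum>j\<in>J. - ip (f i) (f j) * (wickW f (J - {j}) \<eta> * E g \<eta>)) \<partial>M)"
      by (simp add: eq Y_def algebra_simps sum_distrib_left sum_distrib_right)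
    also have "\<dots> = (\<integral>\<eta>. Y \<eta> * W (f i) \<eta> \<partial>M) + ?c * (\<integral>\<eta>. Y \<eta> \<partial>M) +
        (\<Sum>j\<in>J. - ip (f i) (f j) * (\<integral>\<eta>. wickW f (J - {j}) \<eta> * E g \<eta> \<partial>M))"
    proof -
      have 1: "integrable M (\<lambda>\<eta>. Y \<eta> * W (f i) \<eta>)" "integrable M Y"
        by (intro tame_integrable tame_mult tY tame_W fi)+
      have 2: "integrable M (\<lambda>\<eta>. wickW f (J - {j}) \<eta> * E g \<eta>)" for j
        by (intro tame_integrable tame_mult tame_E g IH(1)) auto
      show ?thesis using 1 2 by (simp del: mult_minus_left)
    qed
    \<comment> \<open>The pair terms of \<open>wickW_insert\<close> cancel the contraction sum in
      \<open>ibp\<close>, and only the shifted mean \<open>m i g\<close> remains.\<close>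
    also have "\<dots> = (m i g) * (\<Prod>j\<in>J. m j g)"
      unfolding ibp IH(2)[OF Diff_subset g] IH(2)[OF order_refl g, folded Y_def]
      by (simp add: sum_negf m_def algebra_simps)
    finally show ?thesis
      using fin J tI by (simp add: m_def)
  qed
qed

section \<open>The value of the kernel on products\<close>

definition Q :: "nat \<Rightarrow> (nat \<Rightarrow> real \<Rightarrow> real) \<Rightarrow> 'w \<Rightarrow> real" where
  "Q n f \<eta> = exp (- 1 / 2 - W (\<lambda>_. 1) \<eta>) *
     (\<Sum>R\<in>partitions_le2 {..<n}. (-1) ^ card (blocks 2 R) * partition_pairing W f \<eta> R)"

lemma Q_eq: "Q n f \<eta> = exp (- 1 / 2 - W (\<lambda>_. 1) \<eta>) * wickW f {..<n} \<eta>"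
  by (simp add: Q_def wickW_def wick_def partition_pairing_def)

lemma tame_Q:
  assumes "\<And>i. i < n \<Longrightarrow> sqi (f i)"
  shows "tame (Q n f)"
proof -
  have "tame (\<lambda>\<eta>. exp (- 1 / 2) * exp (-1 * W (\<lambda>_. 1) \<eta>) * wickW f {..<n} \<eta>)"
    by (intro tame_mult tame_const tame_exp_W sqi_const wickW_E[THEN conjunct1, OF _ _ sqi_const[of 0]])
      (auto intro: assms sqi_const)
  then show ?thesis
    by (simp add: Q_eq[abs_def] exp_add[symmetric])
qed

text \<open>The prefactor of \<open>Q\<close> turns \<open>E h\<close> into \<open>E (h - 1)\<close>
  up to the constant \<open>exp (- (\<integral>x. h x \<partial>unit_leb))\<close>. Under this shift
  \<open>W (f i)\<close> acquires the mean of \<open>f i * (h - 1)\<close>, and the 2 in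
  \<open>\<eta> + 2\<close> raises it to that of \<open>f i * (1 + h)\<close>, the weight which
  \<open>\<Phi>\<close> attaches to a point of the Poisson process.\<close>

lemma integral_Q_E:
  assumes f: "\<And>i. i < n \<Longrightarrow> sqi (f i)" and h: "sqi h"
  shows "(\<integral>\<eta>. Q n f \<eta> * E h \<eta> \<partial>M) =
    exp (- (\<integral>x. h x \<partial>unit_leb)) * (\<Prod>i<n. \<integral>x. f i x * (1 + h x) \<partial>unit_leb)"
proof -
  let ?g = "\<lambda>x. 1 * h x + (-1) * 1"
  have g: "sqi ?g" by (rule square_integrable_lincomb[OF h sqi_const])
  have iph: "ip h (\<lambda>_. 1) = (\<integral>x. h x \<partial>unit_leb)" "ip (\<lambda>_. 1) (\<lambda>_. 1) = 1"
    using prob_space.prob_space[OF prob_space_unit_leb] by (simp_all add: ip_def)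
  have "(\<integral>\<eta>. Q n f \<eta> * E h \<eta> \<partial>M) =
      (\<integral>\<eta>. exp (- (\<integral>x. h x \<partial>unit_leb)) * (wickW f {..<n} \<eta> * E ?g \<eta>) \<partial>M)"
  proof (rule integral_cong_AE)
    show "(\<lambda>\<eta>. Q n f \<eta> * E h \<eta>) \<in> borel_measurable M"
      by (intro tame_measurable tame_mult tame_Q tame_E f h)
    show "(\<lambda>\<eta>. exp (- (\<integral>x. h x \<partial>unit_leb)) * (wickW f {..<n} \<eta> * E ?g \<eta>)) \<in> borel_measurable M"
      by (intro tame_measurable tame_mult tame_const tame_E g wickW_E[THEN conjunct1, OF _ _ h]) (auto intro: f)
    show "AE \<eta> in M. Q n f \<eta> * E h \<eta> = exp (- (\<integral>x. h x \<partial>unit_leb)) * (wickW f {..<n} \<eta> * E ?g \<eta>)"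
      using E_lincomb[OF h sqi_const, of 1 "-1" 1]
    proof eventually_elim
      case (elim \<eta>)
      have "exp (- 1 / 2 - W (\<lambda>_. 1) \<eta>) * E h \<eta> = exp (- (\<integral>x. h x \<partial>unit_leb)) * E ?g \<eta>"
        unfolding elim by (simp add: E_def ip_self[symmetric] exp_add[symmetric] iph field_simps)
      then show ?case by (simp add: Q_eq ac_simps)
    qed
  qed
  also have "\<dots> = exp (- (\<integral>x. h x \<partial>unit_leb)) * (\<Prod>i<n. ip (f i) ?g + 2 * (\<integral>t. f i t \<partial>unit_leb))"
    using wickW_E[THEN conjunct2, of "{..<n}" f ?g] f g by simp
  also have "(\<Prod>i<n. ip (f i) ?g + 2 * (\<integral>t. f i t \<partial>unit_leb)) =
      (\<Prod>i<n. \<integral>x. f i x * (1 + h x) \<partial>unit_leb)"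
  proof (rule prod.cong[OF refl])
    fix i assume "i \<in> {..<n}"
    then have i: "sqi (f i)" using f by simp
    have "ip (f i) ?g = ip (f i) h - (\<integral>t. f i t \<partial>unit_leb)"
      using ip_add_right[OF i h sqi_const, of 1 "-1" 1] by (simp add: ip_def)
    moreover have "(\<integral>x. f i x * (1 + h x) \<partial>unit_leb) = (\<integral>t. f i t \<partial>unit_leb) + ip (f i) h"
      using integrable_mult_square_integrable[OF i h]
        integrable_mult_square_integrable[OF i sqi_const[of 1]]
      by (simp add: ip_def distrib_left)
    ultimately show "ip (f i) ?g + 2 * (\<integral>t. f i t \<partial>unit_leb) = (\<integral>x. f i x * (1 + h x) \<partial>unit_leb)"
      by simp
  qed
  finally show ?thesis .
qed

end

subsection \<open>Continuous operators on the cube\<close>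

lemma L2_linear_sum:
  assumes T: "L2_linear N M T" and f: "\<And>i. i \<in> I \<Longrightarrow> square_integrable N (f i)"
  shows "AE y in M. T (\<lambda>x. \<Sum>i\<in>I. f i x) y = (\<Sum>i\<in>I. T (f i) y)"
proof -
  have lin: "AE y in M. T (\<lambda>x. a * f x + b * g x) y = a * T f y + b * T g y"
    if "square_integrable N f" "square_integrable N g" for f g a b
    using T that unfolding L2_linear_def by blast
  have zero: "AE y in M. T (\<lambda>_. 0) y = 0"
    using lin[OF square_integrable_zero square_integrable_zero, of 0 0] by simp
  show ?thesis
    using f
  proof (induction I rule: infinite_finite_induct)
    case (insert i I)
    then have "AE y in M. T (\<lambda>x. 1 * f i x + 1 * (\<Sum>i\<in>I. f i x)) y = 1 * T (f i) y + 1 * T (\<lambda>x. \<Sum>i\<in>I. f i x) y"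
      by (intro lin square_integrable_sum) auto
    moreover have "AE y in M. T (\<lambda>x. \<Sum>i\<in>I. f i x) y = (\<Sum>i\<in>I. T (f i) y)"
      using insert by simp
    ultimately show ?case
      by eventually_elim (use insert.hyps in simp)
  qed (use zero in auto)
qed

text \<open>Operators act on functions here, and linearity alone would let them separate almost
  everywhere equal ones. The norm bound excludes this, since the difference has norm 0.\<close>

lemma L2_continuous_linear_cong:
  assumes T: "L2_continuous_linear N M T" and f: "square_integrable N f" "square_integrable N g"
    and eq: "AE x in N. f x = g x"
  shows "AE y in M. T f y = T g y"
proof -
  obtain C where C: "\<And>f. square_integrable N f \<Longrightarrow> l2norm M (T f) \<le> C * l2norm N f"
    and lin: "L2_linear N M T"
    using T unfolding L2_continuous_linear_def by blast
  let ?d = "\<lambda>x. 1 * f x + (-1) * g x"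
  have d: "square_integrable N ?d" using f by (rule square_integrable_lincomb)
  have "l2norm N ?d = 0"
    using eq by (subst l2norm_eq_0_iff[OF d]) auto
  with C[OF d] have "l2norm M (T ?d) = 0"
    using l2norm_nonneg[of M "T ?d"] by simp
  moreover have "square_integrable M (T ?d)"
    using lin d unfolding L2_linear_def by blast
  ultimately have "AE y in M. T ?d y = 0"
    using l2norm_eq_0_iff by blast
  moreover have "AE y in M. T ?d y = 1 * T f y + (-1) * T g y"
    using lin f unfolding L2_linear_def by blast
  ultimately show ?thesis by eventually_elim simp
qed

lemma L2_continuous_linear_tendsto:
  assumes T: "L2_continuous_linear N M T"
    and f: "\<And>i. square_integrable N (f i)" "square_integrable N g" "L2_tendsto N f g"
  shows "L2_tendsto M (\<lambda>i. T (f i)) (T g)"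
proof -
  obtain C where C: "\<And>f. square_integrable N f \<Longrightarrow> l2norm M (T f) \<le> C * l2norm N f"
    and lin: "L2_linear N M T"
    using T unfolding L2_continuous_linear_def by blast
  have sq: "square_integrable M (T f)" if "square_integrable N f" for f
    using lin that unfolding L2_linear_def by blast
  have bound: "l2norm M (\<lambda>y. T (f i) y - T g y) \<le> C * l2norm N (\<lambda>x. f i x - g x)" for i
  proof -
    let ?d = "\<lambda>x. 1 * f i x + (-1) * g x"
    have d: "square_integrable N ?d" using f(1,2) by (rule square_integrable_lincomb)
    have "AE y in M. T ?d y = 1 * T (f i) y + (-1) * T g y"
      using lin f(1,2) unfolding L2_linear_def by blast
    then have "l2norm M (\<lambda>y. T (f i) y - T g y) = l2norm M (T ?d)"
      by (intro l2norm_cong_AE square_integrable_measurable square_integrable_diff sq f d)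
        (auto elim: eventually_mono)
    also note C[OF d]
    finally show ?thesis by simp
  qed
  have lim: "(\<lambda>i. C * l2norm N (\<lambda>x. f i x - g x)) \<longlonglongrightarrow> 0"
    using f(3) unfolding L2_tendsto_def by (intro tendsto_mult_right_zero)
  show ?thesis
    unfolding L2_tendsto_def
    by (rule tendsto_sandwich[OF always_eventually always_eventually tendsto_const lim])
      (simp_all add: l2norm_nonneg bound)
qed

text \<open>Indicators of boxes are products, boxes generate the sigma-algebra of the cube, and
  indicators are total in L2; each extension step passes through linear combinations and L2
  limits.\<close>

lemma L2_continuous_linear_eqI_tensor:
  assumes T: "L2_continuous_linear (unit_leb_power n) M T" "L2_continuous_linear (unit_leb_power n) M T'"
    and tens: "\<And>f. (\<And>i. i < n \<Longrightarrow> square_integrable unit_leb (f i)) \<Longrightarrow>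
      AE y in M. T (tensor n f) y = T' (tensor n f) y"
    and f: "square_integrable (unit_leb_power n) f"
  shows "AE y in M. T f y = T' f y"
proof -
  let ?N = "unit_leb_power n"
  interpret U: prob_space unit_leb by (rule prob_space_unit_leb)
  interpret N: prob_space ?N by (rule prob_space_unit_leb_power)
  have lin: "L2_linear ?N M T" "L2_linear ?N M T'"
    using T by (auto simp: L2_continuous_linear_def)
  define V where "V f \<longleftrightarrow> square_integrable ?N f \<and> (AE y in M. T f y = T' f y)" for f
  have Vlin: "V (\<lambda>x. a * f x + b * g x)" if "V f" "V g" for f g a b
  proof -
    have sq: "square_integrable ?N f" "square_integrable ?N g" using that by (auto simp: V_def)
    have "AE y in M. T (\<lambda>x. a * f x + b * g x) y = a * T f y + b * T g y"
      "AE y in M. T' (\<lambda>x. a * f x + b * g x) y = a * T' f y + b * T' g y"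
      using lin sq unfolding L2_linear_def by blast+
    moreover have "AE y in M. T f y = T' f y" "AE y in M. T g y = T' g y"
      using that by (auto simp: V_def)
    ultimately have "AE y in M. T (\<lambda>x. a * f x + b * g x) y = T' (\<lambda>x. a * f x + b * g x) y"
      by eventually_elim simp
    then show ?thesis
      using square_integrable_lincomb[OF sq] by (simp add: V_def)
  qed
  have Vlim: "V g" if "\<And>i. V (f i)" "square_integrable ?N g" "L2_tendsto ?N f g" for f g
  proof -
    have sq: "square_integrable ?N (f i)" and eq: "AE y in M. T (f i) y = T' (f i) y" for i
      using that(1)[of i] by (auto simp: V_def)
    have sqT: "square_integrable M (T h)" "square_integrable M (T' h)" if "square_integrable ?N h" for h
      using lin that unfolding L2_linear_def by blast+
    note conv = T[THEN L2_continuous_linear_tendsto, OF sq that(2,3)]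
    have "l2norm M (\<lambda>y. T (f i) y - T' g y) = l2norm M (\<lambda>y. T' (f i) y - T' g y)" for i
      by (intro l2norm_cong_AE square_integrable_measurable square_integrable_diff sqT sq that)
        (use eq[of i] in \<open>auto elim: eventually_mono\<close>)
    with conv(2) have "L2_tendsto M (\<lambda>i. T (f i)) (T' g)"
      by (simp add: L2_tendsto_def)
    then have "AE y in M. T g y = T' g y"
      by (intro L2_tendsto_unique[OF sqT(1)[OF sq] sqT(1)[OF that(2)] sqT(2)[OF that(2)] conv(1)])
    then show ?thesis using that(2) by (simp add: V_def)
  qed
  \<comment> \<open>A constant sequence in \<open>Vlim\<close>. It is needed because a product of
    indicators and the indicator of the box agree only on the space of the cube.\<close>
  have Vcong: "V g" if "V f" "\<And>x. x \<in> space ?N \<Longrightarrow> f x = g x" for f g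
  proof -
    have "square_integrable ?N g"
      using that square_integrable_cong[of ?N f g] by (auto simp: V_def)
    then show ?thesis
      by (rule Vlim[of "\<lambda>_. f", OF that(1)])
        (use that(2) in \<open>simp add: L2_tendsto_def l2norm_def cong: Bochner_Integration.integral_cong\<close>)
  qed
  let ?I = "\<lambda>A x. complex_of_real (indicat_real A x)"
  have box: "V (?I (Pi\<^sub>E {..<n} X))" if X: "\<And>i. X i \<in> sets unit_leb" for X
  proof -
    have sq: "square_integrable unit_leb (indicat_real (X i))" for i
      by (rule U.square_integrable_bounded[where C=1]) (use X in auto)
    have eq: "tensor n (\<lambda>i. indicat_real (X i)) x = ?I (Pi\<^sub>E {..<n} X) x" if "x \<in> space ?N" for x
      using that unfolding tensor_def space_unit_leb_power
      by (auto simp: indicator_def PiE_iff prod_zero_iff)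
    have "square_integrable ?N (tensor n (\<lambda>i. indicat_real (X i)))"
    proof (rule square_integrable_cong[OF eq, THEN iffD2])
      have "Pi\<^sub>E {..<n} X \<in> sets ?N" using X by (intro sets_PiM_I_finite) auto
      then show "square_integrable ?N (?I (Pi\<^sub>E {..<n} X))"
        by (intro N.square_integrable_bounded[where C=1]) (auto simp: indicator_def)
    qed
    then have "V (tensor n (\<lambda>i. indicat_real (X i)))"
      using tens[of "\<lambda>i. indicat_real (X i)"] sq by (simp add: V_def)
    then show ?thesis using eq by (rule Vcong)
  qed
  have box1: "V (?I (\<Pi>\<^sub>E i\<in>{..<n}. space unit_leb))" by (intro box sets.top)
  have V0: "V (\<lambda>_. 0)" using Vlin[OF box1 box1, of 0 0] by simp
  have ind: "V (?I A)" if A: "A \<in> sets ?N" for A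
  proof -
    \<comment> \<open>The generator from \<open>sets_PiM_finite\<close>; its finiteness condition
      ranges over all indices, also those outside \<open>{..<n}\<close>.\<close>
    let ?G = "{(\<Pi>\<^sub>E i\<in>{..<n}. X i) |X. (\<forall>i. X i \<in> sets unit_leb) \<and> finite {i. X i \<noteq> space unit_leb}}"
    have space: "(\<Pi>\<^sub>E i\<in>{..<n}. space unit_leb) = space ?N" by (simp add: space_PiM)
    have "Int_stable ?G"
      unfolding Int_stable_def
    proof safe
      fix X Y :: "nat \<Rightarrow> real set"
      assume X: "\<forall>i. X i \<in> sets unit_leb" "finite {i. X i \<noteq> space unit_leb}"
        and Y: "\<forall>i. Y i \<in> sets unit_leb" "finite {i. Y i \<noteq> space unit_leb}"
      have "{i. X i \<inter> Y i \<noteq> space unit_leb} \<subseteq> {i. X i \<noteq> space unit_leb} \<union> {i. Y i \<noteq> space unit_leb}"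
        by auto
      from finite_subset[OF this] X(2) Y(2) have "finite {i. X i \<inter> Y i \<noteq> space unit_leb}" by blast
      moreover have "X i \<inter> Y i \<in> sets unit_leb" for i using X(1) Y(1) by blast
      ultimately show "\<exists>Z. Pi\<^sub>E {..<n} X \<inter> Pi\<^sub>E {..<n} Y = Pi\<^sub>E {..<n} Z \<and>
          (\<forall>i. Z i \<in> sets unit_leb) \<and> finite {i. Z i \<noteq> space unit_leb}"
        by (intro exI[of _ "\<lambda>i. X i \<inter> Y i"] conjI allI PiE_Int)
    qed
    moreover have "?G \<subseteq> Pow (\<Pi>\<^sub>E i\<in>{..<n}. space unit_leb)"
    proof
      fix A assume "A \<in> ?G"
      then obtain X where X: "A = Pi\<^sub>E {..<n} X" "\<forall>i. X i \<in> sets unit_leb" by blast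
      have "A \<subseteq> (\<Pi>\<^sub>E i\<in>{..<n}. space unit_leb)"
        unfolding X(1) by (rule PiE_mono) (use X(2) sets.sets_into_space in blast)
      then show "A \<in> Pow (\<Pi>\<^sub>E i\<in>{..<n}. space unit_leb)" by blast
    qed
    moreover have "A \<in> sigma_sets (\<Pi>\<^sub>E i\<in>{..<n}. space unit_leb) ?G"
      using A unfolding sets_PiM_finite .
    ultimately show ?thesis
    proof (induction rule: sigma_sets_induct_disjoint)
      case (basic A)
      then show ?case using box by blast
    next
      case empty
      show ?case
        using V0 by simp
    next
      case (compl A)
      have "V (\<lambda>x. 1 * ?I (\<Pi>\<^sub>E i\<in>{..<n}. space unit_leb) x + (-1) * ?I A x)"
        by (intro Vlin box1 compl)
      then show ?case
        by (rule Vcong) (unfold space, simp add: indicator_def)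
    next
      case (union A)
      have A: "A i \<in> sets ?N" for i using union(2) sets_PiM_finite by blast
      have S: "V (?I (\<Union>j<i. A j))" for i
      proof (induction i)
        case 0
        show ?case
          using V0 by simp
      next
        case (Suc i)
        have "A i \<inter> A j = {}" if "j < i" for j
          using union(1) that by (simp add: disjoint_family_on_def)
        then have "A i \<inter> (\<Union>j<i. A j) = {}" by blast
        then have "?I (\<Union>j<Suc i. A j) = (\<lambda>x. 1 * ?I (\<Union>j<i. A j) x + 1 * ?I (A i) x)"
          by (auto simp: fun_eq_iff indicator_def lessThan_Suc)
        then show ?case using Vlin[OF Suc.IH union(3)[of i], of 1 1] by simp
      qed
      have *: "(\<lambda>i. ?I (\<Union>j<i. A j) x) \<longlonglongrightarrow> ?I (\<Union>(range A)) x" for x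
        by (intro tendsto_of_real LIMSEQ_indicator_UN)
      have w: "square_integrable ?N (\<lambda>_. 1 :: real)"
        by (rule N.square_integrable_bounded[where C=1]) auto
      have m: "?I (\<Union>j<i. A j) \<in> borel_measurable ?N" "?I (\<Union>(range A)) \<in> borel_measurable ?N" for i
        using A by auto
      have b: "norm (?I (\<Union>j<i. A j) x) \<le> 1" for i x by (simp add: indicator_def)
      note dc = L2_dominated_convergence[where f="\<lambda>i. ?I (\<Union>j<i. A j)", OF m w b *]
      show ?case by (rule Vlim[OF S dc(2,3)])
    qed
  qed
  have "V f"
    using f by (rule N.L2_indicator_induct) (auto intro: Vlin Vlim ind)
  then show ?thesis by (simp add: V_def)
qed

section \<open>Product functions and permutations under the integral\<close>

lemma integrable_prod_unit_leb_power:
  fixes g :: "nat \<Rightarrow> real \<Rightarrow> real"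
  assumes "\<And>i. i < n \<Longrightarrow> integrable unit_leb (g i)"
  shows "integrable (unit_leb_power n) (\<lambda>x. \<Prod>i<n. g i (x i))"
    and "(\<integral>x. (\<Prod>i<n. g i (x i)) \<partial>unit_leb_power n) = (\<Prod>i<n. \<integral>x. g i x \<partial>unit_leb)"
proof -
  interpret product_sigma_finite "\<lambda>_. unit_leb" by (rule product_sigma_finite_unit_leb)
  show "integrable (unit_leb_power n) (\<lambda>x. \<Prod>i<n. g i (x i))"
    using assms by (intro product_integrable_prod) auto
  show "(\<integral>x. (\<Prod>i<n. g i (x i)) \<partial>unit_leb_power n) = (\<Prod>i<n. \<integral>x. g i x \<partial>unit_leb)"
    using assms by (intro product_integral_prod) auto
qed

lemma square_integrable_tensor:
  assumes "\<And>i. i < n \<Longrightarrow> square_integrable unit_leb (f i)"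
  shows "square_integrable (unit_leb_power n) (tensor n f)"
proof -
  have [measurable]: "(\<lambda>x. f i (x i)) \<in> borel_measurable (unit_leb_power n)" if "i < n" for i
    by (rule measurable_compose[OF measurable_component_singleton square_integrable_measurable])
      (use assms that in auto)
  have "integrable (unit_leb_power n) (\<lambda>x. \<Prod>i<n. (norm (f i (x i)))\<^sup>2)"
    by (rule integrable_prod_unit_leb_power) (intro square_integrable_integrable assms)
  then have "square_integrable (unit_leb_power n) (\<lambda>x. \<Prod>i<n. f i (x i))"
    unfolding square_integrable_def by (simp add: prod_power_distrib[symmetric])
  then show ?thesis
    unfolding tensor_def square_integrable_of_real .
qed

lemma
  fixes g :: "(nat \<Rightarrow> real) \<Rightarrow> real"
  assumes p: "p permutes {..<n}" and g: "integrable (unit_leb_power n) g"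
  shows integrable_perm: "integrable (unit_leb_power n) (\<lambda>x. g (x \<circ> p))"
    and integral_perm: "(\<integral>x. g (x \<circ> p) \<partial>unit_leb_power n) = (\<integral>x. g x \<partial>unit_leb_power n)"
proof -
  show "integrable (unit_leb_power n) (\<lambda>x. g (x \<circ> p))"
    by (rule integrable_distr[OF measurable_perm[OF p]]) (simp add: distr_unit_leb_power_perm[OF p] g)
  show "(\<integral>x. g (x \<circ> p) \<partial>unit_leb_power n) = (\<integral>x. g x \<partial>unit_leb_power n)"
    using integral_distr[OF measurable_perm[OF p], of g] g by (simp add: distr_unit_leb_power_perm[OF p])
qed

subsection \<open>The isometry\<close>

locale white_noise_poisson = white_noise M W
  for M :: "'w measure" and W +
  fixes P :: "real set measure" and \<Phi> :: "('w \<Rightarrow> complex) \<Rightarrow> real set \<Rightarrow> complex"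
  assumes P: "poisson_process_law P"
    and iso: "L2_isometry M P \<Phi>"
    and \<Phi>_exp: "\<And>h. square_integrable unit_leb h \<Longrightarrow>
      (AE \<omega> in P. \<Phi> (\<lambda>\<eta>. complex_of_real (exp (W h \<eta> - (l2norm unit_leb h)\<^sup>2 / 2))) \<omega> =
         complex_of_real ((\<Prod>x\<in>\<omega>. 1 + h x) * exp (- (\<integral>x. h x \<partial>unit_leb))))"
begin

sublocale P: prob_space P
  using P by (rule poisson_process_law_sets)

lemma space_P: "space P = configurations"
  using P by (rule poisson_process_law_sets)

lemma measurable_P: "f \<in> borel_measurable P \<longleftrightarrow> f \<in> borel_measurable configuration_space"
  using measurable_cong_sets[OF poisson_process_law_sets(1)[OF P] refl] by blast

lemma square_integrable_\<Phi>: "square_integrable M f \<Longrightarrow> square_integrable P (\<Phi> f)"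
  using iso unfolding L2_isometry_def L2_linear_def by blast

lemma l2norm_\<Phi>: "square_integrable M f \<Longrightarrow> l2norm P (\<Phi> f) = l2norm M f"
  using iso unfolding L2_isometry_def by blast

lemma \<Phi>_lincomb:
  "square_integrable M f \<Longrightarrow> square_integrable M g \<Longrightarrow>
    AE \<omega> in P. \<Phi> (\<lambda>x. a * f x + b * g x) \<omega> = a * \<Phi> f \<omega> + b * \<Phi> g \<omega>"
  using iso unfolding L2_isometry_def L2_linear_def by blast

lemma \<Phi>_continuous: "L2_continuous_linear M P \<Phi>"
  using iso unfolding L2_continuous_linear_def L2_isometry_def
  by (intro conjI exI[of _ 1]) auto

lemma \<Phi>_scale:
  assumes "square_integrable M f"
  shows "AE \<omega> in P. \<Phi> (\<lambda>x. a * f x) \<omega> = a * \<Phi> f \<omega>"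
  using \<Phi>_lincomb[OF assms assms, of a 0] by simp

lemma l2norm_\<Phi>_diff:
  assumes "square_integrable M f" "square_integrable M g"
  shows "l2norm P (\<lambda>\<omega>. \<Phi> f \<omega> - \<Phi> g \<omega>) = l2norm M (\<lambda>x. f x - g x)"
proof -
  have "AE \<omega> in P. \<Phi> (\<lambda>x. f x - g x) \<omega> = \<Phi> f \<omega> - \<Phi> g \<omega>"
    using \<Phi>_lincomb[OF assms, of 1 "-1"] by simp
  then have "l2norm P (\<lambda>\<omega>. \<Phi> f \<omega> - \<Phi> g \<omega>) = l2norm P (\<Phi> (\<lambda>x. f x - g x))"
    by (intro l2norm_cong_AE square_integrable_measurable square_integrable_diff square_integrable_\<Phi> assms)
      (auto elim: eventually_mono)
  then show ?thesis
    using l2norm_\<Phi>[OF square_integrable_diff[OF assms]] by simp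
qed

text \<open>The distance of \<open>f\<close> and \<open>g\<close> equals that of their images.
  Equalities between functionals of the noise are proved below by comparing images on the Poisson
  side.\<close>

lemma \<Phi>_inj:
  assumes f: "square_integrable M f" "square_integrable M g" and eq: "AE \<omega> in P. \<Phi> f \<omega> = \<Phi> g \<omega>"
  shows "AE \<eta> in M. f \<eta> = g \<eta>"
proof -
  have "l2norm P (\<lambda>\<omega>. \<Phi> f \<omega> - \<Phi> g \<omega>) = 0"
    using eq by (subst l2norm_eq_0_iff) (auto intro!: square_integrable_diff square_integrable_\<Phi> f)
  then have "l2norm M (\<lambda>x. f x - g x) = 0" by (simp add: l2norm_\<Phi>_diff f)
  then show ?thesis
    by (subst (asm) l2norm_eq_0_iff) (auto intro: square_integrable_diff f)
qed

text \<open>Polarization: the real part of the inner product is determined by the norms of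
  \<open>f\<close>, \<open>g\<close> and their difference. Imaginary parts are reached by
  multiplying \<open>g\<close> by \<open>\<i>\<close>.\<close>

lemma integral_\<Phi>_inner:
  assumes f: "square_integrable M f" and g: "square_integrable M g"
  shows "(\<integral>\<omega>. Re (\<Phi> f \<omega> * cnj (\<Phi> g \<omega>)) \<partial>P) = (\<integral>\<eta>. Re (f \<eta> * cnj (g \<eta>)) \<partial>M)"
proof -
  have sq: "(l2norm N (\<lambda>x. a x - b x))\<^sup>2 = (l2norm N a)\<^sup>2 + (l2norm N b)\<^sup>2 - 2 * (\<integral>x. Re (a x * cnj (b x)) \<partial>N)"
    if a: "square_integrable N a" and b: "square_integrable N b" for N :: "'b measure" and a b
  proof -
    have "square_integrable N (\<lambda>x. cnj (b x))"
      using b measurable_compose[OF square_integrable_measurable[OF b] borel_measurable_continuous_onI[of cnj]]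
      by (simp add: square_integrable_def continuous_on_cnj)
    define r where "r x = Re (a x * cnj (b x))" for x
    have int: "integrable N r"
      unfolding r_def using \<open>square_integrable N (\<lambda>x. cnj (b x))\<close> by (intro integrable_Re integrable_mult_square_integrable a)
    have eq: "(norm (a x - b x))\<^sup>2 = (norm (a x))\<^sup>2 + (norm (b x))\<^sup>2 - 2 * r x" for x
      unfolding r_def cmod_power2 by (simp add: power2_eq_square algebra_simps)
    have "(l2norm N (\<lambda>x. a x - b x))\<^sup>2 = (\<integral>x. (norm (a x))\<^sup>2 + (norm (b x))\<^sup>2 - 2 * r x \<partial>N)"
      by (simp only: l2norm_sq eq)
    also have "\<dots> = (l2norm N a)\<^sup>2 + (l2norm N b)\<^sup>2 - 2 * (\<integral>x. r x \<partial>N)"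
      using int a b by (simp add: square_integrable_integrable l2norm_sq)
    finally show ?thesis by (simp only: r_def)
  qed
  have "(l2norm P (\<lambda>\<omega>. \<Phi> f \<omega> - \<Phi> g \<omega>))\<^sup>2 = (l2norm M (\<lambda>x. f x - g x))\<^sup>2"
    by (simp add: l2norm_\<Phi>_diff f g)
  then show ?thesis
    unfolding sq[OF f g] sq[OF square_integrable_\<Phi>[OF f] square_integrable_\<Phi>[OF g]]
    by (simp add: l2norm_\<Phi> f g)
qed

lemma borel_measurable_prod_P:
  "u \<in> borel_measurable unit_leb \<Longrightarrow> (\<lambda>\<omega>. \<Prod>x\<in>\<omega>. u x) \<in> borel_measurable P"
  for u :: "real \<Rightarrow> real"
  unfolding measurable_P by (rule borel_measurable_prod_configuration)

lemma square_integrable_E: "sqi h \<Longrightarrow> square_integrable M (\<lambda>\<eta>. complex_of_real (E h \<eta>))"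
  by (simp add: square_integrable_of_real tame_square_integrable tame_E)

lemma \<Phi>_E:
  "sqi h \<Longrightarrow> AE \<omega> in P. \<Phi> (\<lambda>\<eta>. complex_of_real (E h \<eta>)) \<omega> =
    complex_of_real ((\<Prod>x\<in>\<omega>. 1 + h x) * exp (- (\<integral>x. h x \<partial>unit_leb)))"
  using \<Phi>_exp[of h] by (simp add: E_def)

lemma simple_function_square_integrable:
  fixes u :: "real \<Rightarrow> real"
  assumes "simple_function borel u" "\<And>x. 0 \<le> u x" "\<And>x. u x \<le> 1"
  shows "u \<in> borel_measurable unit_leb" "sqi u" "sqi (\<lambda>x. u x - 1)"
proof -
  show m: "u \<in> borel_measurable unit_leb"
    using assms(1) by (intro borel_measurable_unit_leb borel_measurable_simple_function)
  show "sqi u"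
    by (rule finite_measure.square_integrable_bounded[OF prob_space.finite_measure[OF prob_space_unit_leb] m, of 1])
      (use assms in auto)
  then show "sqi (\<lambda>x. u x - 1)"
    by (rule square_integrable_diff) (rule sqi_const)
qed

lemma square_integrable_prod_P:
  fixes u :: "real \<Rightarrow> real"
  assumes u: "simple_function borel u" "\<And>x. 0 \<le> u x" "\<And>x. u x \<le> 1"
  shows "square_integrable P (\<lambda>\<omega>. \<Prod>x\<in>\<omega>. u x)"
  by (rule P.square_integrable_bounded[where C=1])
    (use u in \<open>auto simp: abs_prod intro!: prod_le_1 borel_measurable_prod_P simple_function_square_integrable\<close>)

text \<open>Bounded functions orthogonal to \<open>X\<close> are closed under linear combinations
  and bounded limits, so orthogonality passes from multiplicative functionals to all events; a
  function with zero integral over every event vanishes almost everywhere.\<close>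

lemma multiplicative_functionals_total:
  fixes X :: "real set \<Rightarrow> real"
  assumes X: "square_integrable P X"
    and orth: "\<And>u. simple_function borel u \<Longrightarrow> (\<And>x. 0 \<le> u x) \<Longrightarrow> (\<And>x. u x \<le> 1) \<Longrightarrow>
      (\<integral>\<omega>. X \<omega> * (\<Prod>x\<in>\<omega>. u x) \<partial>P) = 0"
  shows "AE \<omega> in P. X \<omega> = 0"
proof -
  have Xi: "integrable P X" using X by (rule P.square_integrable_imp_integrable)
  have [measurable]: "X \<in> borel_measurable P" using X by (rule square_integrable_measurable)
  define V where "V v \<longleftrightarrow> v \<in> borel_measurable P \<and> (\<exists>C. \<forall>\<omega>\<in>configurations. \<bar>v \<omega>\<bar> \<le> C) \<and>
    (\<integral>\<omega>. X \<omega> * v \<omega> \<partial>P) = 0" for v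
  have int: "integrable P (\<lambda>\<omega>. X \<omega> * v \<omega>)"
    if "v \<in> borel_measurable P" "\<And>\<omega>. \<omega> \<in> configurations \<Longrightarrow> \<bar>v \<omega>\<bar> \<le> C" for v C
    by (intro integrable_mult_square_integrable X P.square_integrable_bounded[where C=C])
      (use that in \<open>auto simp: space_P\<close>)
  have V: "V (indicat_real A)" if "A \<in> sets configuration_space" for A
  proof (rule configuration_monotone_class[OF _ _ _ that])
    fix f g and a b :: real assume "V f" "V g"
    then obtain C D where f: "f \<in> borel_measurable P" "\<And>\<omega>. \<omega> \<in> configurations \<Longrightarrow> \<bar>f \<omega>\<bar> \<le> C"
      and g: "g \<in> borel_measurable P" "\<And>\<omega>. \<omega> \<in> configurations \<Longrightarrow> \<bar>g \<omega>\<bar> \<le> D"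
      and 0: "(\<integral>\<omega>. X \<omega> * f \<omega> \<partial>P) = 0" "(\<integral>\<omega>. X \<omega> * g \<omega> \<partial>P) = 0"
      unfolding V_def by blast
    have "(\<integral>\<omega>. X \<omega> * (a * f \<omega> + b * g \<omega>) \<partial>P) = (\<integral>\<omega>. a * (X \<omega> * f \<omega>) + b * (X \<omega> * g \<omega>) \<partial>P)"
      by (simp add: algebra_simps)
    also have "\<dots> = 0"
      using int[OF f] int[OF g] 0 by simp
    finally have eq: "(\<integral>\<omega>. X \<omega> * (a * f \<omega> + b * g \<omega>) \<partial>P) = 0" .
    have "\<bar>a * f \<omega> + b * g \<omega>\<bar> \<le> \<bar>a\<bar> * C + \<bar>b\<bar> * D" if "\<omega> \<in> configurations" for \<omega>
      using f(2)[OF that] g(2)[OF that] by (rule abs_lincomb_le)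
    then show "V (\<lambda>\<omega>. a * f \<omega> + b * g \<omega>)"
      unfolding V_def using eq f(1) g(1) by auto
  next
    fix f :: "nat \<Rightarrow> real set \<Rightarrow> real" and g C
    assume V: "\<And>i. V (f i)" and C: "\<And>i \<omega>. \<omega> \<in> configurations \<Longrightarrow> \<bar>f i \<omega>\<bar> \<le> C"
      and lim: "\<And>\<omega>. \<omega> \<in> configurations \<Longrightarrow> (\<lambda>i. f i \<omega>) \<longlonglongrightarrow> g \<omega>"
    have f [measurable]: "f i \<in> borel_measurable P" for i using V by (simp add: V_def)
    have g [measurable]: "g \<in> borel_measurable P"
      by (rule borel_measurable_LIMSEQ_real[where u=f]) (auto simp: space_P lim)
    have "(\<lambda>i. \<integral>\<omega>. X \<omega> * f i \<omega> \<partial>P) \<longlonglongrightarrow> (\<integral>\<omega>. X \<omega> * g \<omega> \<partial>P)"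
    proof (rule integral_dominated_convergence[where w="\<lambda>\<omega>. C * \<bar>X \<omega>\<bar>"])
      show "AE \<omega> in P. (\<lambda>i. X \<omega> * f i \<omega>) \<longlonglongrightarrow> X \<omega> * g \<omega>"
        by (intro AE_I2 tendsto_intros lim) (simp add: space_P)
      show "AE \<omega> in P. norm (X \<omega> * f i \<omega>) \<le> C * \<bar>X \<omega>\<bar>" for i
        using C by (intro AE_I2) (auto simp: space_P abs_mult mult.commute[of C] intro!: mult_left_mono)
    qed (use Xi in auto)
    moreover have "(\<integral>\<omega>. X \<omega> * f i \<omega> \<partial>P) = 0" for i using V[of i] by (simp add: V_def)
    ultimately have "(\<integral>\<omega>. X \<omega> * g \<omega> \<partial>P) = 0"
      by (simp add: LIMSEQ_const_iff)
    moreover have "\<bar>g \<omega>\<bar> \<le> C" if "\<omega> \<in> configurations" for \<omega>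
      by (rule LIMSEQ_le_const2[OF tendsto_rabs[OF lim[OF that]]]) (use C that in auto)
    ultimately show "V g" using g unfolding V_def by blast
  next
    fix u :: "real \<Rightarrow> real"
    assume u: "simple_function borel u" "\<And>x. 0 \<le> u x" "\<And>x. u x \<le> 1"
    have "\<forall>\<omega>\<in>configurations. \<bar>\<Prod>x\<in>\<omega>. u x\<bar> \<le> 1"
      using u by (auto simp: abs_prod intro!: prod_le_1)
    moreover have "(\<lambda>\<omega>. \<Prod>x\<in>\<omega>. u x) \<in> borel_measurable P"
      by (intro borel_measurable_prod_P simple_function_square_integrable u)
    ultimately show "V (\<lambda>\<omega>. \<Prod>x\<in>\<omega>. u x)"
      unfolding V_def using orth[OF u] by blast
  qed
  show ?thesis
  proof (rule P.density_unique_banach[OF Xi])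
    fix A assume "A \<in> sets P"
    then have "A \<in> sets configuration_space" using poisson_process_law_sets(1)[OF P] by simp
    from V[OF this] show "(LINT \<omega>:A|P. X \<omega>) = (LINT \<omega>:A|P. 0)"
      by (simp add: V_def set_lebesgue_integral_def mult.commute)
  qed simp
qed

section \<open>The range of the isometry\<close>

definition in_range :: "(real set \<Rightarrow> complex) \<Rightarrow> bool" where
  "in_range F \<longleftrightarrow> square_integrable P F \<and> (\<exists>G. square_integrable M G \<and> (AE \<omega> in P. \<Phi> G \<omega> = F \<omega>))"

lemma in_range_lincomb:
  assumes "in_range F" "in_range F'"
  shows "in_range (\<lambda>\<omega>. a * F \<omega> + b * F' \<omega>)"
proof -
  obtain G G' where G: "square_integrable M G" "AE \<omega> in P. \<Phi> G \<omega> = F \<omega>"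
    and G': "square_integrable M G'" "AE \<omega> in P. \<Phi> G' \<omega> = F' \<omega>"
    using assms unfolding in_range_def by blast
  have "AE \<omega> in P. \<Phi> (\<lambda>x. a * G x + b * G' x) \<omega> = a * F \<omega> + b * F' \<omega>"
    using \<Phi>_lincomb[OF G(1) G'(1), of a b] G(2) G'(2) by eventually_elim simp
  then show ?thesis
    using assms square_integrable_lincomb[OF G(1) G'(1)] square_integrable_lincomb
    unfolding in_range_def by blast
qed

text \<open>The range of an isometry on a complete space is closed: preimages of a convergent
  sequence are Cauchy, and \<open>\<Phi>\<close> maps their limit to the limit of the
  images.\<close>

lemma in_range_lim:
  assumes F: "\<And>i. in_range (F i)" and H: "square_integrable P H" "L2_tendsto P F H"
  shows "in_range H"
proof -
  have FP: "square_integrable P (F i)" for i using F by (simp add: in_range_def)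
  obtain G where G: "square_integrable M (G i)" "AE \<omega> in P. \<Phi> (G i) \<omega> = F i \<omega>" for i
    using F unfolding in_range_def by metis
  have dist: "l2norm M (\<lambda>x. G i x - G j x) = l2norm P (\<lambda>\<omega>. F i \<omega> - F j \<omega>)" for i j
    unfolding l2norm_\<Phi>_diff[OF G(1) G(1), symmetric]
    by (intro l2norm_cong_AE square_integrable_measurable square_integrable_diff square_integrable_\<Phi> G FP)
      (use G(2)[of i] G(2)[of j] in eventually_elim, simp)
  obtain K where K: "square_integrable M K" "L2_tendsto M G K"
  proof (rule L2_complete[of G])
    fix e :: real assume e: "e > 0"
    have "(\<lambda>n. l2norm P (\<lambda>\<omega>. F n \<omega> - H \<omega>)) \<longlonglongrightarrow> 0" using H(2) by (simp add: L2_tendsto_def)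
    from LIMSEQ_D[OF this, of "e/2"] e obtain N
      where N: "\<And>n. n \<ge> N \<Longrightarrow> l2norm P (\<lambda>\<omega>. F n \<omega> - H \<omega>) < e/2"
      by (auto simp: l2norm_nonneg)
    have "l2norm P (\<lambda>\<omega>. F i \<omega> - F j \<omega>) < e" if "i \<ge> N" "j \<ge> N" for i j
    proof -
      have "(l2norm P (\<lambda>\<omega>. F i \<omega> - F j \<omega>))\<^sup>2 \<le>
          2 * (l2norm P (\<lambda>\<omega>. F i \<omega> - H \<omega>))\<^sup>2 + 2 * (l2norm P (\<lambda>\<omega>. F j \<omega> - H \<omega>))\<^sup>2"
        using l2norm_sq_add_le[of P "\<lambda>\<omega>. F i \<omega> - H \<omega>" "\<lambda>\<omega>. H \<omega> - F j \<omega>"] FP H(1)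
        by (simp add: square_integrable_diff l2norm_minus_commute[of P H])
      also have "\<dots> < 2 * (e/2)\<^sup>2 + 2 * (e/2)\<^sup>2"
        using N[OF that(1)] N[OF that(2)]
        by (intro add_strict_mono mult_strict_left_mono power_strict_mono) (auto simp: l2norm_nonneg)
      also have "\<dots> = e\<^sup>2" by (simp add: power2_eq_square)
      finally show ?thesis using e by (simp add: power2_less_imp_less)
    qed
    then show "\<exists>N. \<forall>i\<ge>N. \<forall>j\<ge>N. l2norm M (\<lambda>x. G i x - G j x) < e" unfolding dist by blast
  qed (rule G)
  have "L2_tendsto P (\<lambda>i. \<Phi> (G i)) (\<Phi> K)"
    by (rule L2_continuous_linear_tendsto[OF \<Phi>_continuous G(1) K])
  moreover have "l2norm P (\<lambda>\<omega>. \<Phi> (G i) \<omega> - H \<omega>) = l2norm P (\<lambda>\<omega>. F i \<omega> - H \<omega>)" for i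
    by (intro l2norm_cong_AE square_integrable_measurable square_integrable_diff square_integrable_\<Phi> G FP H)
      (use G(2)[of i] in eventually_elim, simp)
  then have "L2_tendsto P (\<lambda>i. \<Phi> (G i)) H"
    using H(2) by (simp add: L2_tendsto_def)
  ultimately have "AE \<omega> in P. \<Phi> K \<omega> = H \<omega>"
    by (rule L2_tendsto_unique[rotated 3]) (intro square_integrable_\<Phi> G K H)+
  then show ?thesis using H(1) K(1) unfolding in_range_def by blast
qed

text \<open>Multiplicative functionals are constant multiples of images of exponential functionals.
  The monotone class argument puts all indicators of events into the range, and a closed linear
  range containing these is everything.\<close>

lemma \<Phi>_surj:
  assumes F: "square_integrable P F"
  obtains G where "square_integrable M G" "AE \<omega> in P. \<Phi> G \<omega> = F \<omega>"
proof -
  have "in_range (\<lambda>\<omega>. complex_of_real (indicat_real A \<omega>))" if A: "A \<in> sets P" for A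
  proof (rule configuration_monotone_class[where V="\<lambda>v. in_range (\<lambda>\<omega>. complex_of_real (v \<omega>))"])
    show "A \<in> sets configuration_space"
      using A poisson_process_law_sets(1)[OF P] by simp
  next
    fix f g :: "real set \<Rightarrow> real" and a b
    assume "in_range (\<lambda>\<omega>. complex_of_real (f \<omega>))" "in_range (\<lambda>\<omega>. complex_of_real (g \<omega>))"
    from in_range_lincomb[OF this, of "complex_of_real a" "complex_of_real b"]
    show "in_range (\<lambda>\<omega>. complex_of_real (a * f \<omega> + b * g \<omega>))" by simp
  next
    fix f :: "nat \<Rightarrow> real set \<Rightarrow> real" and g C
    assume V: "\<And>i. in_range (\<lambda>\<omega>. complex_of_real (f i \<omega>))"
      and C: "\<And>i \<omega>. \<omega> \<in> configurations \<Longrightarrow> \<bar>f i \<omega>\<bar> \<le> C"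
      and lim: "\<And>\<omega>. \<omega> \<in> configurations \<Longrightarrow> (\<lambda>i. f i \<omega>) \<longlonglongrightarrow> g \<omega>"
    have f [measurable]: "f i \<in> borel_measurable P" for i
      using V[of i] by (simp add: in_range_def square_integrable_of_real square_integrable_measurable)
    have g [measurable]: "g \<in> borel_measurable P"
      by (rule borel_measurable_LIMSEQ_real[where u=f]) (auto simp: space_P lim)
    have w: "square_integrable P (\<lambda>_. C)"
      by (rule P.square_integrable_bounded[where C="\<bar>C\<bar>"]) auto
    have m: "(\<lambda>\<omega>. complex_of_real (f i \<omega>)) \<in> borel_measurable P"
      "(\<lambda>\<omega>. complex_of_real (g \<omega>)) \<in> borel_measurable P" for i by measurable
    have b: "norm (complex_of_real (f i \<omega>)) \<le> C" if "\<omega> \<in> space P" for i \<omega>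
      using C that by (simp add: space_P)
    have l: "(\<lambda>i. complex_of_real (f i \<omega>)) \<longlonglongrightarrow> complex_of_real (g \<omega>)" if "\<omega> \<in> space P" for \<omega>
      using lim that by (intro tendsto_of_real) (simp add: space_P)
    note dc = L2_dominated_convergence[where f="\<lambda>i \<omega>. complex_of_real (f i \<omega>)", OF m w b l]
    show "in_range (\<lambda>\<omega>. complex_of_real (g \<omega>))"
      by (rule in_range_lim[OF V dc(2,3)])
  next
    fix u :: "real \<Rightarrow> real"
    assume u: "simple_function borel u" "\<And>x. 0 \<le> u x" "\<And>x. u x \<le> 1"
    \<comment> \<open>With this choice \<open>1 + ?h x = u x\<close>, and the constant
      \<open>?c\<close> removes the remaining exponential factor.\<close>
    let ?h = "\<lambda>x. u x - 1"
    have h: "sqi ?h" by (intro simple_function_square_integrable u)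
    note sq = square_integrable_prod_P[OF u]
    let ?c = "complex_of_real (exp (\<integral>x. ?h x \<partial>unit_leb))"
    have c: "?c * complex_of_real (y * exp (- (\<integral>x. ?h x \<partial>unit_leb))) = complex_of_real y" for y
      unfolding of_real_mult[symmetric] by (simp add: exp_minus)
    have "AE \<omega> in P. \<Phi> (\<lambda>\<eta>. ?c * complex_of_real (E ?h \<eta>)) \<omega> = complex_of_real (\<Prod>x\<in>\<omega>. u x)"
      using \<Phi>_scale[OF square_integrable_E[OF h], of ?c] \<Phi>_E[OF h]
      by eventually_elim (simp only: c, simp)
    moreover have "square_integrable P (\<lambda>\<omega>. complex_of_real (\<Prod>x\<in>\<omega>. u x))"
      unfolding square_integrable_of_real by (rule sq)
    ultimately show "in_range (\<lambda>\<omega>. complex_of_real (\<Prod>x\<in>\<omega>. u x))"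
      unfolding in_range_def using square_integrable_cmult[OF square_integrable_E[OF h], of ?c] by blast
  qed
  note ind = this
  from F have "in_range F"
  proof (rule P.L2_indicator_induct)
    show "in_range (\<lambda>\<omega>. a * F \<omega> + b * F' \<omega>)" if "in_range F" "in_range F'" for F F' a b
      using that by (rule in_range_lincomb)
    show "in_range H" if "\<And>i. in_range (F i)" "square_integrable P H" "L2_tendsto P F H" for F H
      using that by (rule in_range_lim)
  qed (rule ind)
  then show ?thesis using that unfolding in_range_def by blast
qed

text \<open>Only \<open>n\<close>-point configurations contribute. The product of the
  \<open>u x\<close> is invariant under permutations of the coordinates, so the
  \<open>fact n\<close> summands have equal integrals and cancel the factorial of the Poisson
  weight, leaving \<open>exp (-1)\<close>.\<close>

lemma integral_symmetrize_tensor: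
  fixes u :: "real \<Rightarrow> real"
  assumes f: "\<And>i. i < n \<Longrightarrow> sqi (f i)"
    and u: "simple_function borel u" "\<And>x. 0 \<le> u x" "\<And>x. u x \<le> 1"
  shows "square_integrable P (symmetrize n (\<lambda>x. \<Prod>i<n. f i (x i)))"
    and "(\<integral>\<omega>. symmetrize n (\<lambda>x. \<Prod>i<n. f i (x i)) \<omega> * (\<Prod>x\<in>\<omega>. u x) \<partial>P) =
      exp (-1) * (\<Prod>i<n. \<integral>x. f i x * u x \<partial>unit_leb)"
proof -
  note u' = simple_function_square_integrable[OF u]
  let ?S = "symmetrize n (\<lambda>x. \<Prod>i<n. f i (x i))"
  have "square_integrable P (symmetrize n (tensor n f))"
    by (intro square_integrable_symmetrize P square_integrable_tensor f)
  then have "square_integrable P (\<lambda>\<omega>. complex_of_real (?S \<omega>))"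
    unfolding tensor_def symmetrize_of_real .
  then show S: "square_integrable P ?S" by (simp only: square_integrable_of_real)
  note prod = square_integrable_prod_P[OF u]
  define g where "g x = (\<Prod>i<n. f i (x i) * u (x i))" for x
  have fu: "integrable unit_leb (\<lambda>x. f i x * u x)" if "i < n" for i
    by (intro integrable_mult_square_integrable f that u')
  have g: "integrable (unit_leb_power n) g"
    "(\<integral>x. g x \<partial>unit_leb_power n) = (\<Prod>i<n. \<integral>x. f i x * u x \<partial>unit_leb)"
    unfolding g_def using integrable_prod_unit_leb_power[of n "\<lambda>i x. f i x * u x"] fu by auto
  let ?G = "\<lambda>x. \<Sum>p | p permutes {..<n}. g (x \<circ> p)"
  have G: "integrable (unit_leb_power n) ?G"
    by (intro Bochner_Integration.integrable_sum integrable_perm g) auto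
  let ?F = "\<lambda>\<omega>. ?S \<omega> * (\<Prod>x\<in>\<omega>. u x)"
  have F: "?F (x ` {..<n}) = ?G x" if "x \<in> space (unit_leb_power n)" "inj_on x {..<n}" for x
  proof -
    have "(\<Prod>i<n. f i ((x \<circ> p) i)) * (\<Prod>y\<in>x ` {..<n}. u y) = g (x \<circ> p)" if p: "p permutes {..<n}" for p
    proof -
      have "(\<Prod>y\<in>x ` {..<n}. u y) = (\<Prod>i<n. u (x i))"
        using \<open>inj_on x {..<n}\<close> by (simp add: prod.reindex)
      also have "\<dots> = (\<Prod>i<n. u (x (p i)))"
        using prod.permute[OF p, of "\<lambda>i. u (x i)"] by (simp add: comp_def)
      finally show ?thesis by (simp add: g_def prod.distrib)
    qed
    then show ?thesis
      by (simp add: symmetrize_point_set[OF that] sum_distrib_right)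
  qed
  have AE: "AE x in unit_leb_power n. ?F (x ` {..<n}) = ?G x"
    using AE_unit_leb_power_inj[of n] AE_space by eventually_elim (rule F)
  have Fi: "integrable P ?F" by (rule integrable_mult_square_integrable[OF S prod])
  have m: "(\<lambda>x. ?F (x ` {..<n})) \<in> borel_measurable (unit_leb_power n)"
    using Fi by (intro measurable_compose[OF measurable_point_set]) (simp add: measurable_P[symmetric])
  have "(\<integral>\<omega>. ?F \<omega> \<partial>P) = exp (-1) / fact n * (\<integral>x. ?F (x ` {..<n}) \<partial>unit_leb_power n)"
  proof (rule integral_poisson_process_n[OF P Fi])
    show "integrable (unit_leb_power n) (\<lambda>x. ?F (x ` {..<n}))"
      by (subst integrable_cong_AE[OF m _ AE]) (use G in auto)
  qed (simp add: symmetrize_def)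
  also have "(\<integral>x. ?F (x ` {..<n}) \<partial>unit_leb_power n) = (\<integral>x. ?G x \<partial>unit_leb_power n)"
    by (rule integral_cong_AE[OF m _ AE]) (use G in auto)
  also have "\<dots> = (\<Sum>p | p permutes {..<n}. \<integral>x. g (x \<circ> p) \<partial>unit_leb_power n)"
    by (rule Bochner_Integration.integral_sum) (auto intro: integrable_perm g)
  also have "\<dots> = fact n * (\<Prod>i<n. \<integral>x. f i x * u x \<partial>unit_leb)"
    by (simp add: integral_perm g card_permutations[of "{..<n}" n])
  finally show "(\<integral>\<omega>. ?F \<omega> \<partial>P) = exp (-1) * (\<Prod>i<n. \<integral>x. f i x * u x \<partial>unit_leb)"
    by simp
qed

lemma square_integrable_Q:
  "(\<And>i. i < n \<Longrightarrow> sqi (f i)) \<Longrightarrow> square_integrable M (\<lambda>\<eta>. complex_of_real (Q n f \<eta>))"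
  by (simp add: square_integrable_of_real tame_square_integrable tame_Q)

text \<open>Both sides have the same inner products with the total family of all \<open>\<Phi> (E h)\<close>.\<close>

lemma \<Phi>_Q:
  assumes f: "\<And>i. i < n \<Longrightarrow> sqi (f i)"
  shows "AE \<omega> in P. \<Phi> (\<lambda>\<eta>. complex_of_real (Q n f \<eta>)) \<omega> = exp 1 * symmetrize n (tensor n f) \<omega>"
proof -
  let ?S = "symmetrize n (\<lambda>x. \<Prod>i<n. f i (x i))"
  let ?q = "\<lambda>\<eta>. complex_of_real (Q n f \<eta>)"
  have q: "square_integrable M ?q" by (intro square_integrable_Q f)
  note \<Phi>q = square_integrable_\<Phi>[OF q]
  \<comment> \<open>The function \<open>u\<close> does not occur in this part of the conclusion; the
    zero function serves as an instance.\<close>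
  have S: "square_integrable P ?S"
    by (rule integral_symmetrize_tensor(1)[of n f "\<lambda>_. 0"]) (use f in auto)
  have inner: "(\<integral>\<omega>. Re (\<Phi> ?q \<omega>) * (\<Prod>x\<in>\<omega>. u x) \<partial>P) = (\<Prod>i<n. \<integral>x. f i x * u x \<partial>unit_leb)"
    "(\<integral>\<omega>. Im (\<Phi> ?q \<omega>) * (\<Prod>x\<in>\<omega>. u x) \<partial>P) = 0"
    if u: "simple_function borel u" "\<And>x. 0 \<le> u x" "\<And>x. u x \<le> 1" for u :: "real \<Rightarrow> real"
  proof -
    let ?h = "\<lambda>x. u x - 1"
    let ?e = "\<lambda>\<eta>. complex_of_real (E ?h \<eta>)"
    let ?c = "exp (- (\<integral>x. ?h x \<partial>unit_leb))"
    have h: "sqi ?h" by (intro simple_function_square_integrable u)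
    note e = square_integrable_E[OF h]
    have prod [measurable]: "(\<lambda>\<omega>. \<Prod>x\<in>\<omega>. u x) \<in> borel_measurable P"
      by (intro borel_measurable_prod_P simple_function_square_integrable u)
    note [measurable] = square_integrable_measurable[OF \<Phi>q]
    have [measurable]: "\<Phi> ?e \<in> borel_measurable P" "\<Phi> (\<lambda>\<eta>. \<i> * ?e \<eta>) \<in> borel_measurable P"
      by (intro square_integrable_measurable square_integrable_\<Phi> square_integrable_cmult e)+
    have "(\<integral>\<omega>. Re (\<Phi> ?q \<omega>) * (\<Prod>x\<in>\<omega>. u x) \<partial>P) * ?c = (\<integral>\<omega>. Re (\<Phi> ?q \<omega>) * (\<Prod>x\<in>\<omega>. u x) * ?c \<partial>P)"
      by (rule integral_mult_left_zero[symmetric])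
    also have "\<dots> = (\<integral>\<omega>. Re (\<Phi> ?q \<omega> * cnj (\<Phi> ?e \<omega>)) \<partial>P)"
      by (rule integral_cong_AE) (use \<Phi>_E[OF h] in \<open>auto elim!: eventually_mono simp del: of_real_prod\<close>)
    also have "\<dots> = (\<integral>\<eta>. Re (?q \<eta> * cnj (?e \<eta>)) \<partial>M)"
      by (rule integral_\<Phi>_inner[OF q e])
    also have "\<dots> = (\<integral>\<eta>. Q n f \<eta> * E ?h \<eta> \<partial>M)" by simp
    also have "\<dots> = ?c * (\<Prod>i<n. \<integral>x. f i x * u x \<partial>unit_leb)"
      using integral_Q_E[of n f, OF _ h] f by simp
    finally show "(\<integral>\<omega>. Re (\<Phi> ?q \<omega>) * (\<Prod>x\<in>\<omega>. u x) \<partial>P) = (\<Prod>i<n. \<integral>x. f i x * u x \<partial>unit_leb)"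
      by simp
    have "(\<integral>\<omega>. Im (\<Phi> ?q \<omega>) * (\<Prod>x\<in>\<omega>. u x) \<partial>P) * ?c = (\<integral>\<omega>. Im (\<Phi> ?q \<omega>) * (\<Prod>x\<in>\<omega>. u x) * ?c \<partial>P)"
      by (rule integral_mult_left_zero[symmetric])
    \<comment> \<open>For real \<open>w\<close> the real part of \<open>z * cnj (\<i> * w)\<close>
      is \<open>Im z * w\<close>. On the Gaussian side \<open>?q\<close> and \<open>?e\<close> are
      real, so the corresponding integral is zero.\<close>
    also have "\<dots> = (\<integral>\<omega>. Re (\<Phi> ?q \<omega> * cnj (\<Phi> (\<lambda>\<eta>. \<i> * ?e \<eta>) \<omega>)) \<partial>P)"
    proof (rule integral_cong_AE)
      show "AE \<omega> in P. Im (\<Phi> ?q \<omega>) * (\<Prod>x\<in>\<omega>. u x) * ?c = Re (\<Phi> ?q \<omega> * cnj (\<Phi> (\<lambda>\<eta>. \<i> * ?e \<eta>) \<omega>))"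
        using \<Phi>_E[OF h] \<Phi>_scale[OF e, of \<i>] by eventually_elim (simp del: of_real_prod)
    qed auto
    also have "\<dots> = (\<integral>\<eta>. Re (?q \<eta> * cnj (\<i> * ?e \<eta>)) \<partial>M)"
      by (rule integral_\<Phi>_inner[OF q square_integrable_cmult[OF e]])
    also have "\<dots> = 0" by simp
    finally show "(\<integral>\<omega>. Im (\<Phi> ?q \<omega>) * (\<Prod>x\<in>\<omega>. u x) \<partial>P) = 0" by simp
  qed
  have "AE \<omega> in P. Re (\<Phi> ?q \<omega>) - exp 1 * ?S \<omega> = 0"
  proof (rule multiplicative_functionals_total)
    show "square_integrable P (\<lambda>\<omega>. Re (\<Phi> ?q \<omega>) - exp 1 * ?S \<omega>)"
      by (intro square_integrable_diff square_integrable_Re \<Phi>q square_integrable_cmult S)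
    fix u :: "real \<Rightarrow> real" assume u: "simple_function borel u" "\<And>x. 0 \<le> u x" "\<And>x. u x \<le> 1"
    note prod = square_integrable_prod_P[OF u]
    have "(\<integral>\<omega>. (Re (\<Phi> ?q \<omega>) - exp 1 * ?S \<omega>) * (\<Prod>x\<in>\<omega>. u x) \<partial>P) =
        (\<integral>\<omega>. Re (\<Phi> ?q \<omega>) * (\<Prod>x\<in>\<omega>. u x) - exp 1 * (?S \<omega> * (\<Prod>x\<in>\<omega>. u x)) \<partial>P)"
      by (simp add: algebra_simps)
    also have "\<dots> = (\<integral>\<omega>. Re (\<Phi> ?q \<omega>) * (\<Prod>x\<in>\<omega>. u x) \<partial>P) - exp 1 * (\<integral>\<omega>. ?S \<omega> * (\<Prod>x\<in>\<omega>. u x) \<partial>P)"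
      using integrable_mult_square_integrable[OF S prod]
        integrable_mult_square_integrable[OF square_integrable_Re[OF \<Phi>q] prod]
      by simp
    \<comment> \<open>Here \<open>exp 1\<close> meets the factor \<open>exp (-1)\<close> of the
      Poisson integral, which fixes the constant in the claim.\<close>
    also have "\<dots> = 0"
      using integral_symmetrize_tensor(2)[of n f, OF _ u] f inner(1)[OF u]
      by (simp add: mult.assoc[symmetric] exp_add[symmetric])
    finally show "(\<integral>\<omega>. (Re (\<Phi> ?q \<omega>) - exp 1 * ?S \<omega>) * (\<Prod>x\<in>\<omega>. u x) \<partial>P) = 0" .
  qed
  moreover have "AE \<omega> in P. Im (\<Phi> ?q \<omega>) = 0"
    by (rule multiplicative_functionals_total[OF square_integrable_Im[OF \<Phi>q] inner(2)])
  ultimately show ?thesis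
  proof eventually_elim
    case (elim \<omega>)
    have "symmetrize n (tensor n f) \<omega> = complex_of_real (?S \<omega>)"
      unfolding tensor_def symmetrize_of_real ..
    then have "exp 1 * symmetrize n (tensor n f) \<omega> = complex_of_real (exp 1 * ?S \<omega>)"
      by (simp add: exp_of_real[symmetric])
    then show ?case using elim by (simp add: complex_eq_iff)
  qed
qed

subsection \<open>The kernel\<close>

text \<open>A preimage is unique only almost everywhere, so a representative is chosen; linearity
  and symmetry then hold up to null sets. The factor \<open>exp 1\<close> compensates the
  \<open>exp (-1)\<close> in the integral against the Poisson law.\<close>

definition kernel :: "nat \<Rightarrow> ((nat \<Rightarrow> real) \<Rightarrow> complex) \<Rightarrow> 'w \<Rightarrow> complex" where
  "kernel n f = (SOME G. square_integrable M G \<and> (AE \<omega> in P. \<Phi> G \<omega> = exp 1 * symmetrize n f \<omega>))"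

lemma
  assumes f: "square_integrable (unit_leb_power n) f"
  shows square_integrable_kernel: "square_integrable M (kernel n f)"
    and \<Phi>_kernel: "AE \<omega> in P. \<Phi> (kernel n f) \<omega> = exp 1 * symmetrize n f \<omega>"
proof -
  obtain G where "square_integrable M G \<and> (AE \<omega> in P. \<Phi> G \<omega> = exp 1 * symmetrize n f \<omega>)"
    using \<Phi>_surj[OF square_integrable_cmult[OF square_integrable_symmetrize[OF P f]], of "exp 1"] by blast
  then have "square_integrable M (kernel n f) \<and> (AE \<omega> in P. \<Phi> (kernel n f) \<omega> = exp 1 * symmetrize n f \<omega>)"
    unfolding kernel_def
    by (rule someI[where P="\<lambda>G. square_integrable M G \<and> (AE \<omega> in P. \<Phi> G \<omega> = exp 1 * symmetrize n f \<omega>)"])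
  then show "square_integrable M (kernel n f)" "AE \<omega> in P. \<Phi> (kernel n f) \<omega> = exp 1 * symmetrize n f \<omega>"
    by auto
qed

lemma kernel_continuous: "L2_continuous_linear (unit_leb_power n) M (kernel n)"
  unfolding L2_continuous_linear_def L2_linear_def
proof (intro conjI exI allI impI)
  fix f g :: "(nat \<Rightarrow> real) \<Rightarrow> complex" and a b
  assume f: "square_integrable (unit_leb_power n) f"
  show "square_integrable M (kernel n f)" using f by (rule square_integrable_kernel)
  have sf: "square_integrable P (\<lambda>\<omega>. exp 1 * symmetrize n f \<omega>)"
    by (intro square_integrable_cmult square_integrable_symmetrize P f)
  have "l2norm M (kernel n f) = l2norm P (\<lambda>\<omega>. exp 1 * symmetrize n f \<omega>)"
    unfolding l2norm_\<Phi>[OF square_integrable_kernel[OF f], symmetric]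
    by (intro l2norm_cong_AE square_integrable_measurable square_integrable_\<Phi> square_integrable_kernel f sf \<Phi>_kernel)
  also have "\<dots> = exp 1 * l2norm P (symmetrize n f)"
    by (simp add: l2norm_cmult norm_exp_eq_Re)
  also have "\<dots> \<le> (exp 1 * fact n) * l2norm (unit_leb_power n) f"
    using l2norm_symmetrize_le[OF P f] by simp
  \<comment> \<open>This fixes the constant that was left open in the existential: it depends on
    \<open>n\<close> but not on \<open>f\<close>.\<close>
  finally show "l2norm M (kernel n f) \<le> (exp 1 * fact n) * l2norm (unit_leb_power n) f" .
  assume g: "square_integrable (unit_leb_power n) g"
  note fg = square_integrable_lincomb[OF f g, of a b]
  show "AE \<eta> in M. kernel n (\<lambda>x. a * f x + b * g x) \<eta> = a * kernel n f \<eta> + b * kernel n g \<eta>"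
  proof (rule \<Phi>_inj)
    show "square_integrable M (kernel n (\<lambda>x. a * f x + b * g x))"
      "square_integrable M (\<lambda>\<eta>. a * kernel n f \<eta> + b * kernel n g \<eta>)"
      by (intro square_integrable_kernel square_integrable_lincomb f g)+
    show "AE \<omega> in P. \<Phi> (kernel n (\<lambda>x. a * f x + b * g x)) \<omega> = \<Phi> (\<lambda>\<eta>. a * kernel n f \<eta> + b * kernel n g \<eta>) \<omega>"
      using \<Phi>_kernel[OF fg] \<Phi>_kernel[OF f] \<Phi>_kernel[OF g]
        \<Phi>_lincomb[OF square_integrable_kernel[OF f] square_integrable_kernel[OF g], of a b]
      by eventually_elim (simp add: symmetrize_lincomb algebra_simps)
  qed
qed

lemma generalized_kernel_kernel: "generalized_kernel M kernel"
  unfolding generalized_kernel_def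
proof (intro conjI allI impI kernel_continuous)
  fix n p and f :: "(nat \<Rightarrow> real) \<Rightarrow> complex"
  assume p: "p permutes {..<n}" and f: "square_integrable (unit_leb_power n) f"
  note fp = square_integrable_perm[OF p f]
  show "AE \<eta> in M. kernel n (\<lambda>x. f (x \<circ> p)) \<eta> = kernel n f \<eta>"
    by (rule \<Phi>_inj[OF square_integrable_kernel[OF fp] square_integrable_kernel[OF f]])
      (use \<Phi>_kernel[OF fp] \<Phi>_kernel[OF f] in eventually_elim, simp add: symmetrize_perm[OF p])
qed

section \<open>Equivalence of the formula and the kernel property\<close>

lemma white_noise_poisson_formula_iff:
  "white_noise_poisson_formula M W K \<longleftrightarrow>
    (\<forall>n f. (\<forall>i<n. sqi (f i)) \<longrightarrow> (AE \<eta> in M. K n (tensor n f) \<eta> = complex_of_real (Q n f \<eta>)))"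
  by (simp only: white_noise_poisson_formula_def Q_def)

lemma white_noise_poisson_formula_kernel: "white_noise_poisson_formula M W kernel"
  unfolding white_noise_poisson_formula_iff
proof (intro allI impI)
  fix n and f :: "nat \<Rightarrow> real \<Rightarrow> real" assume "\<forall>i<n. sqi (f i)"
  then have f: "\<And>i. i < n \<Longrightarrow> sqi (f i)" by simp
  have t: "square_integrable (unit_leb_power n) (tensor n f)"
    and q: "square_integrable M (\<lambda>\<eta>. complex_of_real (Q n f \<eta>))"
    by (intro square_integrable_tensor square_integrable_Q f; assumption)+
  have \<Phi>q: "AE \<omega> in P. \<Phi> (\<lambda>\<eta>. complex_of_real (Q n f \<eta>)) \<omega> = exp 1 * symmetrize n (tensor n f) \<omega>"
    by (intro \<Phi>_Q f)
  show "AE \<eta> in M. kernel n (tensor n f) \<eta> = complex_of_real (Q n f \<eta>)"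
    by (rule \<Phi>_inj[OF square_integrable_kernel[OF t] q])
      (use \<Phi>_kernel[OF t] \<Phi>q in eventually_elim, simp)
qed

text \<open>The formula prescribes values on products, and continuity leaves no freedom beyond
  them.\<close>

lemma kernel_unique:
  assumes K: "generalized_kernel M K" "white_noise_poisson_formula M W K"
    and f: "square_integrable (unit_leb_power n) f"
  shows "AE \<eta> in M. K n f \<eta> = kernel n f \<eta>"
proof (rule L2_continuous_linear_eqI_tensor[OF _ kernel_continuous _ f])
  show "L2_continuous_linear (unit_leb_power n) M (K n)"
    using K(1) by (simp add: generalized_kernel_def)
  fix f :: "nat \<Rightarrow> real \<Rightarrow> real" assume "\<And>i. i < n \<Longrightarrow> sqi (f i)"
  then have "AE \<eta> in M. K n (tensor n f) \<eta> = complex_of_real (Q n f \<eta>)"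
    "AE \<eta> in M. kernel n (tensor n f) \<eta> = complex_of_real (Q n f \<eta>)"
    using K(2) white_noise_poisson_formula_kernel unfolding white_noise_poisson_formula_iff by blast+
  then show "AE \<eta> in M. K n (tensor n f) \<eta> = kernel n (tensor n f) \<eta>"
    by eventually_elim simp
qed

text \<open>\<open>\<Phi>\<close> maps the partial sum over \<open>n < N\<close> to \<open>F\<close>
  cut off to configurations with fewer than \<open>N\<close> points. The cut-offs converge to
  \<open>F\<close> by domination, and the isometry carries the convergence back to the
  noise.\<close>

lemma formula_imp_is_kernel_of:
  assumes K: "generalized_kernel M K" "white_noise_poisson_formula M W K"
  shows "is_kernel_of M P \<Phi> K"
  unfolding is_kernel_of_def
proof (intro allI impI)
  fix F :: "real set \<Rightarrow> complex" assume F: "square_integrable P F"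
  obtain G where G: "square_integrable M G" "AE \<omega> in P. \<Phi> G \<omega> = F \<omega>"
    using \<Phi>_surj[OF F] .
  let ?g = "\<lambda>n \<eta>. complex_of_real (exp (-1) / fact n) * K n (npoint F n) \<eta>"
  note np = square_integrable_npoint[OF P F]
  have Ksq: "square_integrable M (K n f)" if "square_integrable (unit_leb_power n) f" for n f
    using K(1) that unfolding generalized_kernel_def L2_continuous_linear_def L2_linear_def by blast
  have g: "square_integrable M (?g n)" for n
    by (intro square_integrable_cmult Ksq np)
  have \<Phi>g: "AE \<omega> in P. \<Phi> (?g n) \<omega> = of_bool (card \<omega> = n) * F \<omega>" for n
  proof -
    have 1: "AE \<omega> in P. \<Phi> (?g n) \<omega> = complex_of_real (exp (-1) / fact n) * \<Phi> (K n (npoint F n)) \<omega>"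
      by (intro \<Phi>_scale Ksq np)
    have 2: "AE \<omega> in P. \<Phi> (K n (npoint F n)) \<omega> = \<Phi> (kernel n (npoint F n)) \<omega>"
      by (rule L2_continuous_linear_cong[OF \<Phi>_continuous])
        (intro Ksq square_integrable_kernel kernel_unique K np)+
    have c: "complex_of_real (exp (-1) / fact n) * (exp 1 * (fact n * z)) = z" for z
    proof -
      have "exp (-1) * exp 1 = (1 :: complex)" by (simp add: exp_add[symmetric])
      then show ?thesis by (simp add: exp_of_real[symmetric] field_simps)
    qed
    show ?thesis
      using 1 2 \<Phi>_kernel[OF np[of n]] AE_space
    proof eventually_elim
      case (elim \<omega>)
      then have "\<omega> \<in> configurations" by (simp add: space_P)
      then show ?case
        unfolding elim(1-3) symmetrize_npoint[OF \<open>\<omega> \<in> configurations\<close>] using c by simp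
    qed
  qed
  let ?S = "\<lambda>N \<eta>. \<Sum>n<N. ?g n \<eta>"
  have S: "square_integrable M (?S N)" for N by (intro square_integrable_sum g)
  have \<Phi>S: "AE \<omega> in P. \<Phi> (?S N) \<omega> = of_bool (card \<omega> < N) * F \<omega>" for N
  proof (induction N)
    case 0
    show ?case using \<Phi>_lincomb[OF G(1) G(1), of 0 0] by simp
  next
    case (Suc N)
    show ?case
      using \<Phi>_lincomb[OF S[of N] g[of N], of 1 1] Suc \<Phi>g[of N]
      by eventually_elim (auto simp: less_Suc_eq)
  qed
  let ?F = "\<lambda>N \<omega>. of_bool (card \<omega> < N) * F \<omega>"
  have [measurable]: "F \<in> borel_measurable P" using F by (rule square_integrable_measurable)
  have m: "?F N \<in> borel_measurable P" for N
  proof -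
    have "Measurable.pred configuration_space (\<lambda>\<omega>. card \<omega> < N)"
      using measurable_compose[OF measurable_card, of "\<lambda>k. k < N" "count_space UNIV"] by simp
    then have "(\<lambda>\<omega>. of_bool (card \<omega> < N) :: complex) \<in> borel_measurable P"
      unfolding measurable_P of_bool_def by (intro measurable_If) auto
    then show ?thesis by measurable
  qed
  have w: "square_integrable P (\<lambda>\<omega>. norm (F \<omega>))" using F by (auto simp: square_integrable_def)
  have bd: "norm (?F N \<omega>) \<le> norm (F \<omega>)" for N \<omega> by simp
  have lim: "(\<lambda>N. ?F N \<omega>) \<longlonglongrightarrow> F \<omega>" for \<omega>
    by (rule tendsto_eventually) (auto intro: eventually_mono[OF eventually_gt_at_top[of "card \<omega>"]])
  note dc = L2_dominated_convergence[where f="?F", OF m \<open>F \<in> borel_measurable P\<close> w bd lim]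
  have "l2norm M (\<lambda>\<eta>. ?S N \<eta> - G \<eta>) = l2norm P (\<lambda>\<omega>. ?F N \<omega> - F \<omega>)" for N
    unfolding l2norm_\<Phi>_diff[OF S G(1), symmetric]
    by (intro l2norm_cong_AE square_integrable_measurable square_integrable_diff square_integrable_\<Phi> S G dc(1) F)
      (use \<Phi>S[of N] G(2) in eventually_elim, simp)
  then have "has_kernel_integral M K F G"
    unfolding has_kernel_integral_def L2_sums_def using g G(1) dc(3)
    by (simp add: L2_tendsto_def)
  then show "\<exists>G. square_integrable M G \<and> (AE \<omega> in P. \<Phi> G \<omega> = F \<omega>) \<and> has_kernel_integral M K F G"
    using G by blast
qed

text \<open>The kernel property is tested on the symmetrization of a product. Only the
  \<open>n\<close>-th term of the series survives, and symmetry of \<open>K\<close> makes it a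
  multiple of \<open>K n (tensor n f)\<close>; its image under \<open>\<Phi>\<close> must be the
  test functional, just as for \<open>Q n f\<close> up to the factor \<open>exp 1\<close>.\<close>

lemma is_kernel_of_imp_formula:
  assumes K: "generalized_kernel M K" and ker: "is_kernel_of M P \<Phi> K"
  shows "white_noise_poisson_formula M W K"
  unfolding white_noise_poisson_formula_iff
proof (intro allI impI)
  fix n and f :: "nat \<Rightarrow> real \<Rightarrow> real" assume "\<forall>i<n. sqi (f i)"
  then have f: "\<And>i. i < n \<Longrightarrow> sqi (f i)" by simp
  have Kc: "L2_continuous_linear (unit_leb_power m) M (K m)" for m
    using K by (simp add: generalized_kernel_def)
  then have Kl: "L2_linear (unit_leb_power m) M (K m)" for m
    by (simp add: L2_continuous_linear_def)
  then have Ksq: "square_integrable M (K m f)" if "square_integrable (unit_leb_power m) f" for m f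
    using that unfolding L2_linear_def by blast
  have t: "square_integrable (unit_leb_power n) (tensor n f)"
    and q: "square_integrable M (\<lambda>\<eta>. complex_of_real (Q n f \<eta>))"
    by (intro square_integrable_tensor square_integrable_Q f; assumption)+
  have \<Phi>q: "AE \<omega> in P. \<Phi> (\<lambda>\<eta>. complex_of_real (Q n f \<eta>)) \<omega> = exp 1 * symmetrize n (tensor n f) \<omega>"
    by (intro \<Phi>_Q f)
  define F where "F = symmetrize n (tensor n f)"
  have F: "square_integrable P F" unfolding F_def by (rule square_integrable_symmetrize[OF P t])
  obtain G where G: "square_integrable M G" "AE \<omega> in P. \<Phi> G \<omega> = F \<omega>" "has_kernel_integral M K F G"
    using ker F unfolding is_kernel_of_def by blast
  note np = square_integrable_npoint[OF P F]
  have npF: "AE x in unit_leb_power m. npoint F m x =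
      (if m = n then \<Sum>p | p permutes {..<n}. tensor n f (x \<circ> p) else 0)" for m
    using AE_unit_leb_power_inj[of m] AE_space unfolding F_def
    by eventually_elim (rule npoint_symmetrize)
  have K0: "AE \<eta> in M. K m (npoint F m) \<eta> = 0" if "m \<noteq> n" for m
  proof -
    have "AE \<eta> in M. K m (npoint F m) \<eta> = K m (\<lambda>_. 0) \<eta>"
      by (rule L2_continuous_linear_cong[OF Kc np square_integrable_zero])
        (use npF[of m] that in \<open>auto elim: eventually_mono\<close>)
    moreover have "AE \<eta> in M. K m (\<lambda>_. 0) \<eta> = 0"
      using L2_linear_sum[OF Kl, of "{}"] by simp
    ultimately show ?thesis by eventually_elim simp
  qed
  \<comment> \<open>Symmetry of \<open>K\<close> enters here: all \<open>fact n\<close> permuted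
    products have the same pairing.\<close>
  have Kn: "AE \<eta> in M. K n (npoint F n) \<eta> = fact n * K n (tensor n f) \<eta>"
  proof -
    have tp: "square_integrable (unit_leb_power n) (\<lambda>x. tensor n f (x \<circ> p))" if "p permutes {..<n}" for p
      using that t by (rule square_integrable_perm)
    have "AE \<eta> in M. K n (npoint F n) \<eta> = K n (\<lambda>x. \<Sum>p | p permutes {..<n}. tensor n f (x \<circ> p)) \<eta>"
      by (rule L2_continuous_linear_cong[OF Kc np])
        (use npF[of n] in \<open>auto intro!: square_integrable_sum tp\<close>)
    moreover have "AE \<eta> in M. K n (\<lambda>x. \<Sum>p | p permutes {..<n}. tensor n f (x \<circ> p)) \<eta> =
        (\<Sum>p | p permutes {..<n}. K n (\<lambda>x. tensor n f (x \<circ> p)) \<eta>)"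
      by (rule L2_linear_sum[OF Kl]) (auto intro: tp)
    moreover have "AE \<eta> in M. \<forall>p\<in>{p. p permutes {..<n}}. K n (\<lambda>x. tensor n f (x \<circ> p)) \<eta> = K n (tensor n f) \<eta>"
    proof (rule AE_finite_allI)
      show "finite {p. p permutes {..<n}}" by (simp add: finite_permutations)
      fix p assume "p \<in> {p. p permutes {..<n}}"
      then show "AE \<eta> in M. K n (\<lambda>x. tensor n f (x \<circ> p)) \<eta> = K n (tensor n f) \<eta>"
        using K t unfolding generalized_kernel_def by blast
    qed
    ultimately show ?thesis
      by eventually_elim (simp add: card_permutations[of "{..<n}" n])
  qed
  let ?g = "\<lambda>m \<eta>. complex_of_real (exp (-1) / fact m) * K m (npoint F m) \<eta>"
  let ?S = "\<lambda>N \<eta>. \<Sum>m<N. ?g m \<eta>"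
  let ?H = "\<lambda>\<eta>. complex_of_real (exp (-1)) * K n (tensor n f) \<eta>"
  have H: "square_integrable M ?H" by (intro square_integrable_cmult Ksq t)
  have S: "square_integrable M (?S N)" for N
    by (intro square_integrable_sum square_integrable_cmult Ksq np)
  \<comment> \<open>A countable union of null sets, so that one exceptional set serves all partial
    sums.\<close>
  have "AE \<eta> in M. \<forall>m\<in>UNIV - {n}. K m (npoint F m) \<eta> = 0"
    by (subst AE_ball_countable) (auto intro: K0)
  then have SH: "AE \<eta> in M. ?S N \<eta> = ?H \<eta>" if "N > n" for N
    using Kn
  proof eventually_elim
    case (elim \<eta>)
    have "?S N \<eta> = (\<Sum>m<N. if m = n then ?H \<eta> else 0)"
      using elim by (intro sum.cong) auto
    then show ?case using that by simp
  qed
  have "L2_tendsto M ?S ?H"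
    unfolding L2_tendsto_def
  proof (rule tendsto_eventually)
    have "l2norm M (\<lambda>\<eta>. ?S N \<eta> - ?H \<eta>) = 0" if "N > n" for N
      using SH[OF that] by (subst l2norm_eq_0_iff[OF square_integrable_diff[OF S H]]) (auto elim: eventually_mono)
    then show "\<forall>\<^sub>F N in sequentially. l2norm M (\<lambda>\<eta>. ?S N \<eta> - ?H \<eta>) = 0"
      by (auto intro: eventually_mono[OF eventually_gt_at_top[of n]])
  qed
  moreover have "L2_tendsto M ?S G"
    using G(3) unfolding has_kernel_integral_def L2_sums_def L2_tendsto_def by blast
  ultimately have GH: "AE \<eta> in M. ?H \<eta> = G \<eta>"
    by (rule L2_tendsto_unique[OF S H G(1)])
  note Kt = Ksq[OF t]
  show "AE \<eta> in M. K n (tensor n f) \<eta> = complex_of_real (Q n f \<eta>)"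
  proof (rule \<Phi>_inj[OF Kt q])
    have "AE \<omega> in P. \<Phi> ?H \<omega> = \<Phi> G \<omega>"
      by (rule L2_continuous_linear_cong[OF \<Phi>_continuous H G(1) GH])
    then show "AE \<omega> in P. \<Phi> (K n (tensor n f)) \<omega> = \<Phi> (\<lambda>\<eta>. complex_of_real (Q n f \<eta>)) \<omega>"
      using \<Phi>_scale[OF Kt, of "complex_of_real (exp (-1))"] G(2) \<Phi>q
    proof eventually_elim
      case (elim \<omega>)
      then have "exp (-1) * \<Phi> (K n (tensor n f)) \<omega> = F \<omega>"
        by (simp add: exp_of_real[symmetric])
      then have "exp 1 * (exp (-1) * \<Phi> (K n (tensor n f)) \<omega>) = exp 1 * F \<omega>" by simp
      then show ?case
        using elim(4) by (simp add: F_def mult.assoc[symmetric] exp_add[symmetric])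
    qed
  qed
qed

end

text \<open>The existence part says that the pairings given on products do extend to a generalized
  kernel, so that the equivalence is not vacuous: together they give a kernel of \<Phi>, and every
  kernel of \<Phi> satisfies the formula.\<close>

theorem theorem5:
  fixes M :: "'w measure"
    and W :: "(real \<Rightarrow> real) \<Rightarrow> 'w \<Rightarrow> real"
    and P :: "real set measure"
    and \<Phi> :: "('w \<Rightarrow> complex) \<Rightarrow> real set \<Rightarrow> complex"
  assumes "gaussian_white_noise M W"
    and "poisson_process_law P"
    and "L2_isometry M P \<Phi>"
    and "\<And>h. square_integrable unit_leb h \<Longrightarrow>
      (AE \<omega> in P. \<Phi> (\<lambda>\<eta>. complex_of_real (exp (W h \<eta> - (l2norm unit_leb h)\<^sup>2 / 2))) \<omega> =
         complex_of_real ((\<Prod>x\<in>\<omega>. 1 + h x) * exp (- (\<integral>x. h x \<partial>unit_leb))))"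
  shows "(\<exists>K. generalized_kernel M K \<and> white_noise_poisson_formula M W K) \<and>
    (\<forall>K. generalized_kernel M K \<longrightarrow>
      (is_kernel_of M P \<Phi> K \<longleftrightarrow> white_noise_poisson_formula M W K))"
proof -
  interpret white_noise_poisson M W P \<Phi>
    by unfold_locales (fact assms)+
  show ?thesis
    using generalized_kernel_kernel white_noise_poisson_formula_kernel
      formula_imp_is_kernel_of is_kernel_of_imp_formula by blast
qed

end
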